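(* Let $\Lambda$ be an odd selfdual lattice of rank $24$ and minimum $2$, and put $R=\Lambda_2$ and $h_R=|R|/24$. Then there exist strongly eutactic root systems $S,T\subset\mathbb R^{24}$ of norm 2, with Coxeter numbers $h_S,h_T$, such that: $R=S\cap T$; $h_S+h_T=3h_R+2$; $\langle s,t\rangle=\pm\tfrac12$ for all $s\in S\setminus R$, $t\in T\setminus R$; and $\mathrm{Sh}(\Lambda)_2=(S\setminus R)\cup(T\setminus R)$. Moreover, $T=R$ or $S=R$ if and only if $R$ is strongly eutactic.
   Context: A selfdual lattice is an integral lattice equal to its dual; odd means some vector has odd norm. Shadow of an odd selfdual $\Lambda$: $\mathrm{Sh}(\Lambda)=\Lambda_0^\sharp\setminus\Lambda$, with $\Lambda_0$ the sublattice of vectors of even norm and $\Lambda_0^\sharp$ its dual. Shell $A_m=\{x\in A:\langle x,x\rangle=m\}$; $\Lambda_2$ is a root system of norm 2. Root systems need not span the ambient space and may be empty; a root system is strongly eutactic if all its irreducible components have the same Coxeter number $h$ (for irreducible $R'\subset\mathbb R^{d}$, $h=|R'|/d$; the empty irreducible system $O_1\subset\mathbb R^1$ has $h=0$), in which case the Coxeter number of a strongly eutactic $S\subset\mathbb R^{24}$ satisfies $|S|=24h_S$. *)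

theory Defs
  imports "HOL-Analysis.Analysis"
begin

type_synonym vec24 = "real^24"

definition lattice24 :: "vec24 set \<Rightarrow> bool" where
  "lattice24 L \<longleftrightarrow> (\<exists>b :: 24 \<Rightarrow> vec24. inj b \<and> independent (range b) \<and>
      L = {(\<Sum>i\<in>UNIV. of_int (c i) *\<^sub>R b i) | c :: 24 \<Rightarrow> int. True})"

definition dual_set :: "vec24 set \<Rightarrow> vec24 set" where
  "dual_set A = {y. \<forall>x\<in>A. x \<bullet> y \<in> \<int>}"

definition integral_lattice :: "vec24 set \<Rightarrow> bool" where
  "integral_lattice L \<longleftrightarrow> lattice24 L \<and> (\<forall>x\<in>L. \<forall>y\<in>L. x \<bullet> y \<in> \<int>)"

definition selfdual :: "vec24 set \<Rightarrow> bool" where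
  "selfdual L \<longleftrightarrow> integral_lattice L \<and> dual_set L = L"

definition odd_lattice :: "vec24 set \<Rightarrow> bool" where
  "odd_lattice L \<longleftrightarrow> (\<exists>x\<in>L. \<exists>k::int. x \<bullet> x = of_int k \<and> odd k)"

definition has_minimum :: "vec24 set \<Rightarrow> real \<Rightarrow> bool" where
  "has_minimum L m \<longleftrightarrow> (\<forall>x\<in>L. x \<noteq> 0 \<longrightarrow> m \<le> x \<bullet> x) \<and> (\<exists>x\<in>L. x \<noteq> 0 \<and> x \<bullet> x = m)"

definition even_part :: "vec24 set \<Rightarrow> vec24 set" where
  "even_part L = {x\<in>L. \<exists>k::int. x \<bullet> x = of_int k \<and> even k}"

definition shadow :: "vec24 set \<Rightarrow> vec24 set" where
  "shadow L = dual_set (even_part L) - L"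

definition shell :: "vec24 set \<Rightarrow> real \<Rightarrow> vec24 set" where
  "shell A m = {x\<in>A. x \<bullet> x = m}"

text \<open>Root system of norm 2 (possibly empty, not necessarily spanning): finite, all norms 2,
  integral (crystallographic) and closed under the reflections s_r(x) = x - (x.r) r.\<close>
definition root_system_norm2 :: "vec24 set \<Rightarrow> bool" where
  "root_system_norm2 S \<longleftrightarrow> finite S \<and> (\<forall>r\<in>S. r \<bullet> r = 2) \<and>
     (\<forall>r\<in>S. \<forall>s\<in>S. r \<bullet> s \<in> \<int>) \<and>
     (\<forall>r\<in>S. \<forall>s\<in>S. s - (s \<bullet> r) *\<^sub>R r \<in> S)"

definition component :: "vec24 set \<Rightarrow> vec24 \<Rightarrow> vec24 set" where
  "component S r = {s\<in>S. (r, s) \<in> {(a, b). a \<in> S \<and> b \<in> S \<and> a \<bullet> b \<noteq> 0}\<^sup>*}"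

text \<open>Strongly eutactic: all irreducible components have the same Coxeter number h,
  where an irreducible component C has Coxeter number |C| / dim(span C); the orthogonal
  complement of span S is made up of copies of the empty irreducible system O_1
  (Coxeter number 0).\<close>
definition strongly_eutactic :: "vec24 set \<Rightarrow> bool" where
  "strongly_eutactic S \<longleftrightarrow> (\<exists>h::real.
      (\<forall>r\<in>S. real (card (component S r)) = h * real (dim (span (component S r)))) \<and>
      (span S \<noteq> UNIV \<longrightarrow> h = 0))"

definition coxeter_number :: "vec24 set \<Rightarrow> real" where
  "coxeter_number S = real (card S) / 24"

end

theory Submission
  imports Defs "HOL-Probability.Probability" "HOL-Complex_Analysis.Complex_Analysis" "HOL-Real_Asymp.Real_Asymp"
begin

text \<open>
  Write \<open>\<Lambda>\<^sub>0\<close> for the even sublattice and \<open>w\<close> for a vector of the shadow, which is the coset \<open>w + \<Lambda>\<close>.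
  The theta function of the shadow is the transform under inversion of that of \<open>\<Lambda>\<close> at \<open>\<tau> + 1\<close>; the relations
  of the modular group make it invariant under \<open>\<tau> \<mapsto> \<tau> + 1\<close>, and by positivity all norms in the shadow are even.
  Hence \<open>\<Lambda>\<^sub>0 \<union> (w + \<Lambda>\<^sub>0)\<close> is an even selfdual lattice for every \<open>w\<close> in the shadow; the two lattices obtained
  in this way have root systems \<open>S\<close> and \<open>T\<close>. For an even selfdual lattice of rank 24 the theta function with a
  harmonic quadratic coefficient is a cusp form of weight 14, so it vanishes; its first coefficient says that the
  roots form an eutactic configuration, and taking traces on the components shows that it is strongly eutactic.
  Pairing the theta functions of \<open>\<Lambda>\<close> and of its shadow with those of weight 2 attached to \<open>D\<^sub>4\<close> and comparing with
  \<open>\<int>\<^sup>2\<^sup>4\<close> yields another cusp form of weight 14, whose first coefficient counts the shadow vectors of norm 2: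
  there are 48 more of them than roots of \<open>\<Lambda>\<close>.
\<close>

section \<open>Fourier uniqueness\<close>

text \<open>Both counting steps need weight 14. A theta function of rank 24 has weight 12, where the
  discriminant is a cusp form, so there a constant term does not determine the later coefficients. A
  harmonic polynomial of degree 2 as coefficient, or a factor of weight 2, raises the weight to 14,
  where no cusp form is left: the automorphy factor \<open>\<tau> ^ 14\<close> is -1 at the fixed
  point \<open>\<i>\<close> of inversion and forces one zero too many. The modular group enters only
  through inversion and translation of series in \<open>exp (pi * \<i> * \<tau>)\<close>, and
  invariance under \<open>\<tau> \<mapsto> \<tau> + 1\<close> is evenness in that variable. All
  inversion formulas come from Poisson summation for Gaussians, obtained for a lattice by induction
  on a basis from the one-dimensional case; this is the purpose of the Fourier analysis. The
  relation between the Coxeter numbers is a count: \<open>S\<close> and \<open>T\<close> meet in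
  \<open>R\<close> and the rest of both is the set of shadow vectors of norm 2, so |S| + |T| = 2 |R|
  + (|R| + 48), to be divided by 24.\<close>

definition fourier_char :: "int \<Rightarrow> real \<Rightarrow> complex" where
  "fourier_char k x = exp (2 * pi * \<i> * of_int k * of_real x)"

lemma continuous_on_fourier_char [continuous_intros]: "continuous_on S (fourier_char k)"
  unfolding fourier_char_def by (intro continuous_intros)

lemma fourier_char_mult: "fourier_char j x * fourier_char k x = fourier_char (j + k) x"
  by (simp add: fourier_char_def exp_add [symmetric] algebra_simps)

lemma fourier_char_of_int: "fourier_char k (of_int m) = 1"
proof -
  have "2 * pi * \<i> * of_int k * of_int m = 2 * of_int (k * m) * of_real pi * \<i>" by simp
  then show ?thesis
    unfolding fourier_char_def of_real_of_int_eq by (auto simp: exp_eq_1 intro: exI [of _ "k * m"])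
qed

lemma fourier_char_add: "fourier_char k (x + y) = fourier_char k x * fourier_char k y"
  by (simp add: fourier_char_def exp_add [symmetric] algebra_simps)

lemma norm_fourier_char [simp]: "norm (fourier_char k x) = 1"
proof -
  have "fourier_char k x = exp (\<i> * of_real (2 * pi * k * x))"
    by (simp add: fourier_char_def algebra_simps)
  then show ?thesis by (simp only: norm_exp_i_times)
qed

lemma integral_fourier_char: "integral {0..1} (fourier_char k) = (if k = 0 then 1 else 0)"
proof (cases "k = 0")
  case False
  have "(fourier_char k has_integral (fourier_char k 1 / (2 * pi * \<i> * k) - fourier_char k 0 / (2 * pi * \<i> * k))) {0..1}"
  proof (rule fundamental_theorem_of_calculus)
    fix x :: real
    have "((\<lambda>z. exp (2 * pi * \<i> * of_int k * z) / (2 * pi * \<i> * k)) has_field_derivative exp (2 * pi * \<i> * of_int k * of_real x)) (at (of_real x))"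
      using False by (auto intro!: derivative_eq_intros)
    then have "((\<lambda>x. exp (2 * pi * \<i> * of_int k * of_real x) / (2 * pi * \<i> * k)) has_vector_derivative fourier_char k x) (at x)"
      unfolding fourier_char_def by (rule has_vector_derivative_real_field)
    then show "((\<lambda>x. fourier_char k x / (2 * pi * \<i> * k)) has_vector_derivative fourier_char k x) (at x within {0..1})"
      unfolding fourier_char_def by (rule has_vector_derivative_at_within)
  qed simp
  moreover have "fourier_char k 1 = 1" "fourier_char k 0 = 1"
    using fourier_char_of_int [of k 1] fourier_char_of_int [of k 0] by simp_all
  ultimately show ?thesis using False by (simp add: integral_unique)
qed (simp add: fourier_char_def [abs_def])

text \<open>The real functions that multiply \<open>no_fourier_coeffs\<close> into itself form a ring, to which
  Stone--Weierstrass applies.\<close>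

definition no_fourier_coeffs :: "(real \<Rightarrow> complex) set" where
  "no_fourier_coeffs = {\<phi>. continuous_on {0..1} \<phi> \<and> (\<forall>k. integral {0..1} (\<lambda>x. \<phi> x * fourier_char k x) = 0)}"

lemma no_fourier_coeffs_add:
  assumes "\<phi> \<in> no_fourier_coeffs" "\<psi> \<in> no_fourier_coeffs"
  shows "(\<lambda>x. \<phi> x + \<psi> x) \<in> no_fourier_coeffs"
proof -
  have "integral {0..1} (\<lambda>x. (\<phi> x + \<psi> x) * fourier_char k x) =
     integral {0..1} (\<lambda>x. \<phi> x * fourier_char k x) + integral {0..1} (\<lambda>x. \<psi> x * fourier_char k x)" for k
    unfolding distrib_right using assms
    by (intro integral_add integrable_continuous_real continuous_intros) (auto simp: no_fourier_coeffs_def)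
  then show ?thesis using assms by (auto simp: no_fourier_coeffs_def intro!: continuous_intros)
qed

lemma no_fourier_coeffs_cmult:
  assumes "\<phi> \<in> no_fourier_coeffs" shows "(\<lambda>x. c * \<phi> x) \<in> no_fourier_coeffs"
  using assms by (auto simp: no_fourier_coeffs_def mult.assoc intro!: continuous_intros)

lemma no_fourier_coeffs_shift:
  assumes "\<phi> \<in> no_fourier_coeffs" shows "(\<lambda>x. fourier_char j x * \<phi> x) \<in> no_fourier_coeffs"
proof -
  have "(\<lambda>x. fourier_char j x * \<phi> x * fourier_char k x) = (\<lambda>x. \<phi> x * fourier_char (j + k) x)" for k
    by (auto simp flip: fourier_char_mult)
  then show ?thesis using assms by (auto simp: no_fourier_coeffs_def intro!: continuous_intros)
qed

lemma Re_fourier_char: "complex_of_real (Re (fourier_char 1 x)) = 1/2 * fourier_char 1 x + 1/2 * fourier_char (-1) x"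
  and Im_fourier_char: "complex_of_real (Im (fourier_char 1 x)) = -\<i>/2 * fourier_char 1 x + \<i>/2 * fourier_char (-1) x"
proof -
  have "fourier_char k x = cis (2 * pi * k * x)" for k
    by (simp add: fourier_char_def cis_conv_exp algebra_simps)
  then show "complex_of_real (Re (fourier_char 1 x)) = 1/2 * fourier_char 1 x + 1/2 * fourier_char (-1) x"
    "complex_of_real (Im (fourier_char 1 x)) = -\<i>/2 * fourier_char 1 x + \<i>/2 * fourier_char (-1) x"
    by (simp_all add: complex_eq_iff)
qed

text \<open>The real and imaginary parts of the circle coordinate are combinations of
  \<open>fourier_char 1\<close> and \<open>fourier_char (- 1)\<close>, so they lie in the ring
  \<open>R\<close> and separate the points of the circle. Elements of \<open>R\<close> approximate
  \<open>h\<close> uniformly, and their integrals against \<open>g\<close> are zeroth Fourier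
  coefficients.\<close>

lemma no_fourier_coeffs_orthogonal:
  fixes g :: "real \<Rightarrow> complex" and h :: "real \<Rightarrow> real"
  assumes g: "g \<in> no_fourier_coeffs" and h: "continuous_on {0..1} h" "h 0 = h 1"
  shows "integral {0..1} (\<lambda>x. h x * g x) = 0"
proof -
  define R where "R = {P :: complex \<Rightarrow> real. continuous_on (sphere 0 1) P \<and>
     (\<forall>\<phi> \<in> no_fourier_coeffs. (\<lambda>x. of_real (P (fourier_char 1 x)) * \<phi> x) \<in> no_fourier_coeffs)}"
  have ReIm: "Re \<in> R" "Im \<in> R"
  proof -
    have "(\<lambda>x. of_real (Re (fourier_char 1 x)) * \<phi> x) \<in> no_fourier_coeffs"
         "(\<lambda>x. of_real (Im (fourier_char 1 x)) * \<phi> x) \<in> no_fourier_coeffs" if "\<phi> \<in> no_fourier_coeffs" for \<phi>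
      unfolding Re_fourier_char Im_fourier_char distrib_right mult.assoc
      by (intro no_fourier_coeffs_add no_fourier_coeffs_cmult no_fourier_coeffs_shift that)+
    then show "Re \<in> R" "Im \<in> R" by (auto simp: R_def intro!: continuous_intros)
  qed
  interpret function_ring_on R "sphere 0 1"
  proof
    show "(\<lambda>x. f x + g x) \<in> R" "(\<lambda>x. f x * g x) \<in> R" if "f \<in> R" "g \<in> R" for f g
      using that by (auto simp: R_def distrib_right mult.assoc intro!: continuous_intros no_fourier_coeffs_add)
    show "\<exists>f\<in>R. f x \<noteq> f y" if "x \<noteq> y" for x y
      using that ReIm by (auto simp: complex_eq_iff)
  qed (auto simp: R_def intro!: continuous_intros no_fourier_coeffs_cmult)
  \<comment> \<open>Since \<open>h 0 = h 1\<close>, \<open>h\<close> descends to the unit circle.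
    \<open>Arg2pi\<close> jumps at the point 1, so continuity is taken from the passage from loops
    to circle maps, applied to the trivial homotopy of \<open>h\<close>.\<close>
  define H where "H = h \<circ> (\<lambda>z. Arg2pi z / (2 * pi))"
  have H: "H (fourier_char 1 x) = h x" if "x \<in> {0..1}" for x
  proof (cases "x = 1")
    case True
    then show ?thesis using h(2) fourier_char_of_int [of 1 1] Arg2pi_of_real [of 1] by (simp add: H_def)
  next
    case False
    then have "Arg2pi (fourier_char 1 x) = 2 * pi * x"
      using that by (intro Arg2pi_unique [of 1]) (auto simp: fourier_char_def algebra_simps)
    then show ?thesis by (simp add: H_def)
  qed
  have "homotopic_loops UNIV h h"
    using h by (simp add: homotopic_loops_refl path_def pathfinish_def pathstart_def)
  then have contH: "continuous_on (sphere 0 1) H"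
    unfolding H_def using homotopic_with_imp_continuous [OF homotopic_loops_imp_homotopic_circlemaps] by blast
  have gc: "continuous_on {0..1} g" using g by (simp add: no_fourier_coeffs_def)
  then have "compact (g ` {0..1})" by (intro compact_continuous_image) auto
  then obtain B where B: "B > 0" "\<And>x. x \<in> {0..1} \<Longrightarrow> norm (g x) \<le> B"
    using compact_imp_bounded bounded_pos by (metis imageI)
  have "norm (integral {0..1} (\<lambda>x. h x * g x)) \<le> e" if "e > 0" for e
  proof -
    obtain P where P: "P \<in> R" "\<forall>z\<in>sphere 0 1. \<bar>H z - P z\<bar> < e / B"
      using Stone_Weierstrass_basic [OF contH, of "e / B"] \<open>B > 0\<close> \<open>e > 0\<close> by auto
    then have Pg: "(\<lambda>x. of_real (P (fourier_char 1 x)) * g x) \<in> no_fourier_coeffs"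
      using g by (auto simp: R_def)
    then have 0: "integral {0..1} (\<lambda>x. of_real (P (fourier_char 1 x)) * g x * fourier_char 0 x) = 0"
      by (simp add: no_fourier_coeffs_def)
    have "((\<lambda>x. h x * g x - of_real (P (fourier_char 1 x)) * g x) has_integral
        (integral {0..1} (\<lambda>x. h x * g x) - integral {0..1} (\<lambda>x. of_real (P (fourier_char 1 x)) * g x))) {0..1}"
    proof (intro has_integral_diff integrable_integral integrable_continuous_real)
      show "continuous_on {0..1} (\<lambda>x. of_real (P (fourier_char 1 x)) * g x)"
        using Pg by (simp add: no_fourier_coeffs_def)
    qed (use h gc in \<open>auto intro!: continuous_intros\<close>)
    then have I: "((\<lambda>x. h x * g x - of_real (P (fourier_char 1 x)) * g x) has_integral
        (integral {0..1} (\<lambda>x. h x * g x))) {0..1}"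
      using 0 by (simp add: fourier_char_def)
    have "norm (integral {0..1} (\<lambda>x. h x * g x)) \<le> e * measure lborel (cbox 0 (1::real))"
    proof (rule has_integral_bound [where f = "\<lambda>x. h x * g x - of_real (P (fourier_char 1 x)) * g x"])
      fix x :: real assume "x \<in> cbox 0 1"
      then have x: "x \<in> {0..1}" by simp
      have "norm (h x * g x - of_real (P (fourier_char 1 x)) * g x) = \<bar>h x - P (fourier_char 1 x)\<bar> * norm (g x)"
        by (metis left_diff_distrib norm_mult norm_of_real of_real_diff)
      also have "\<dots> \<le> (e / B) * B"
        using P(2) [rule_format, of "fourier_char 1 x"] H [OF x] B x \<open>e > 0\<close> by (intro mult_mono) auto
      finally show "norm (h x * g x - of_real (P (fourier_char 1 x)) * g x) \<le> e"
        using \<open>B > 0\<close> by simp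
    qed (use I \<open>e > 0\<close> in auto)
    then show ?thesis by simp
  qed
  then have "norm (integral {0..1} (\<lambda>x. h x * g x)) \<le> 0" by (rule field_le_epsilon) auto
  then show ?thesis by simp
qed

text \<open>The real and imaginary parts of \<open>g\<close> may serve as the test function
  \<open>h\<close> above; the corresponding part of that integral is then the integral of the square
  of a continuous function.\<close>

lemma fourier_uniqueness:
  assumes g: "g \<in> no_fourier_coeffs" "g 0 = g 1" and x: "x \<in> {0..1}"
  shows "g x = 0"
proof -
  have gc: "continuous_on {0..1} g" using g by (simp add: no_fourier_coeffs_def)
  have "h x = 0" if h: "h = (\<lambda>x. Re (g x)) \<or> h = (\<lambda>x. Im (g x))" for h
  proof -
    have hc: "continuous_on {0..1} h" using h gc by (auto intro!: continuous_intros)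
    have *: "integral {0..1} (\<lambda>x. h x * g x) = 0"
      using h g by (intro no_fourier_coeffs_orthogonal hc) auto
    have "(\<lambda>x. h x * g x) integrable_on {0..1}"
      using hc gc by (intro integrable_continuous_real continuous_intros)
    then have i: "((\<lambda>x. h x * g x) has_integral 0) {0..1}"
      using * by (metis integrable_integral)
    have "integral {0..1} (\<lambda>x. (h x)\<^sup>2) = 0"
    proof (cases "h = (\<lambda>x. Re (g x))")
      case True
      then have "(h x)\<^sup>2 = Re (h x * g x)" for x by (simp add: power2_eq_square)
      then show ?thesis using has_integral_linear [OF i bounded_linear_Re] by (simp add: o_def integral_unique)
    next
      case False
      then have "(h x)\<^sup>2 = Im (h x * g x)" for x using h by (auto simp add: power2_eq_square)
      then show ?thesis using has_integral_linear [OF i bounded_linear_Im] by (simp add: o_def integral_unique)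
    qed
    moreover have "continuous_on {0..1} (\<lambda>x. (h x)\<^sup>2)" using hc by (intro continuous_intros)
    ultimately show ?thesis
      using x integral_eq_0_iff [of 0 1 "\<lambda>x. (h x)\<^sup>2"] by auto
  qed
  then show ?thesis by (auto simp: complex_eq_iff)
qed

section \<open>One-dimensional Poisson summation for Gaussians\<close>

lemma summable_on_power_abs_int:
  fixes r :: real
  assumes "0 \<le> r" "r < 1"
  shows "(\<lambda>m::int. r ^ nat \<bar>m\<bar>) summable_on UNIV"
proof -
  have r: "(\<lambda>n::nat. r ^ n) summable_on UNIV"
    using assms by (intro summable_nonneg_imp_summable_on summable_geometric) auto
  have "(\<lambda>m::int. r ^ nat \<bar>m\<bar>) summable_on range int"
    by (subst summable_on_reindex) (auto simp: o_def r)
  moreover have "(\<lambda>m::int. r ^ nat \<bar>m\<bar>) summable_on range (\<lambda>n. - int n)"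
    by (subst summable_on_reindex) (auto simp: o_def r inj_on_def)
  ultimately have "(\<lambda>m::int. r ^ nat \<bar>m\<bar>) summable_on (range int \<union> range (\<lambda>n. - int n))"
    by (rule summable_on_union)
  moreover have "range int \<union> range (\<lambda>n. - int n) = UNIV"
    by (auto simp: image_iff) (metis int_cases2)
  ultimately show ?thesis by simp
qed

text \<open>A square \<open>y\<^sup>2\<close> is at least \<open>2 * \<bar>y\<bar> - 1\<close>, so
  the Gaussian is dominated by a geometric series. The constant depends on \<open>x\<close> only
  through the bound \<open>A\<close>, as uniform convergence on an interval requires.\<close>

lemma gaussian_le_geometric:
  fixes s x A :: real
  assumes "s > 0" "\<bar>x\<bar> \<le> A"
  shows "exp (- pi * s * (x + of_int m)\<^sup>2) \<le> exp (pi * s * (2 * A + 1)) * exp (- 2 * pi * s) ^ nat \<bar>m\<bar>"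
proof -
  have "0 \<le> (\<bar>x + of_int m\<bar> - 1)\<^sup>2" by simp
  then have "2 * \<bar>x + of_int m\<bar> - 1 \<le> (x + of_int m)\<^sup>2" by (simp add: power2_diff)
  moreover have "\<bar>of_int m\<bar> \<le> \<bar>x + of_int m\<bar> + A" using assms by linarith
  ultimately have "2 * \<bar>of_int m\<bar> - (2 * A + 1) \<le> (x + of_int m)\<^sup>2" by argo
  then have "pi * s * (2 * \<bar>of_int m\<bar> - (2 * A + 1)) \<le> pi * s * (x + of_int m)\<^sup>2"
    using assms by (intro mult_left_mono) auto
  then show ?thesis
    by (simp add: exp_of_nat_mult [symmetric] exp_add [symmetric] algebra_simps)
qed

lemma summable_on_gaussian_int:
  assumes "s > 0"
  shows "(\<lambda>m::int. exp (- pi * s * (x + of_int m)\<^sup>2)) summable_on UNIV"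
proof (rule summable_on_comparison_test)
  show "(\<lambda>m::int. exp (pi * s * (2 * \<bar>x\<bar> + 1)) * exp (- 2 * pi * s) ^ nat \<bar>m\<bar>) summable_on UNIV"
    using assms by (intro summable_on_cmult_right summable_on_power_abs_int) auto
qed (use assms gaussian_le_geometric in auto)

lemma filterlim_symmetric_int_intervals:
  "filterlim (\<lambda>n. {- int n..<int n}) (finite_subsets_at_top UNIV) sequentially"
  unfolding filterlim_finite_subsets_at_top
proof (intro allI impI)
  fix X :: "int set" assume X: "finite X \<and> X \<subseteq> UNIV"
  then obtain N where N: "\<And>m. m \<in> X \<Longrightarrow> \<bar>m\<bar> \<le> N"
    by (metis finite_imageI finite_nat_set_iff_bounded_le Max_ge imageI)
  show "\<forall>\<^sub>F n in sequentially. finite {- int n..<int n} \<and> X \<subseteq> {- int n..<int n} \<and> {- int n..<int n} \<subseteq> UNIV"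
    using eventually_gt_at_top [of "nat N"]
  proof eventually_elim
    case (elim n)
    then show ?case using N by fastforce
  qed
qed

lemma integral_symmetric_unfold:
  fixes f :: "real \<Rightarrow> complex"
  assumes "continuous_on UNIV f"
  shows "(\<Sum>m\<in>{- int n..<int n}. integral {0..1} (\<lambda>x. f (x + of_int m))) = integral {- real n..real n} f"
proof (induction n)
  case (Suc n)
  have i: "f integrable_on {a..b}" for a b
    by (rule integrable_continuous_real) (use assms continuous_on_subset in blast)
  have shift: "integral {0..1} (\<lambda>x. f (x + c)) = integral {c..c + 1} f" for c
    using integral_shift_real_ivl [of c c "c + 1" f] by simp
  have "{- int (Suc n)..<int (Suc n)} = insert (- int (Suc n)) (insert (int n) {- int n..<int n})" by auto
  then have "(\<Sum>m\<in>{- int (Suc n)..<int (Suc n)}. integral {0..1} (\<lambda>x. f (x + of_int m))) =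
     integral {- real (Suc n)..- real n} f + (integral {real n..real (Suc n)} f + integral {- real n..real n} f)"
    using Suc.IH by (simp add: shift algebra_simps)
  also have "integral {real n..real (Suc n)} f + integral {- real n..real n} f = integral {- real n..real (Suc n)} f"
    using Henstock_Kurzweil_Integration.integral_combine [of "- real n" "real n" "real (Suc n)" f] i by (simp add: add.commute)
  also have "integral {- real (Suc n)..- real n} f + integral {- real n..real (Suc n)} f = integral {- real (Suc n)..real (Suc n)} f"
    by (rule Henstock_Kurzweil_Integration.integral_combine) (auto intro: i)
  finally show ?case .
qed auto

lemma has_integral_UNIV_imp_symmetric_limit:
  fixes f :: "real \<Rightarrow> complex"
  assumes "(f has_integral I) UNIV"
  shows "(\<lambda>n. integral {- real n..real n} f) \<longlonglongrightarrow> I"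
proof (rule LIMSEQ_I)
  fix e :: real assume "e > 0"
  obtain B where B: "\<And>a b. ball 0 B \<subseteq> cbox a b \<Longrightarrow> \<exists>z. (f has_integral z) (cbox a b) \<and> norm (z - I) < e"
    using assms \<open>e > 0\<close> unfolding has_integral' [of f I UNIV] by simp blast
  show "\<exists>no. \<forall>n\<ge>no. norm (integral {- real n..real n} f - I) < e"
  proof (intro exI allI impI)
    fix n assume "nat \<lceil>B\<rceil> \<le> n"
    then have "ball 0 B \<subseteq> cbox (- real n) (real n)" by (auto simp: dist_real_def)
    with B obtain z where "(f has_integral z) (cbox (- real n) (real n))" "norm (z - I) < e" by blast
    then show "norm (integral {- real n..real n} f - I) < e" by (auto simp: integral_unique)
  qed
qed

text \<open>Domination by \<open>M\<close> makes the series uniformly convergent, so it may be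
  integrated term by term. Along symmetric intervals of integers the partial integrals join up to
  the integral of \<open>f\<close> over a symmetric real interval.\<close>

lemma periodization:
  fixes f :: "real \<Rightarrow> complex"
  assumes f: "continuous_on UNIV f" "(f has_integral I) UNIV"
    and M: "\<And>m x. x \<in> {0..1} \<Longrightarrow> norm (f (x + of_int m)) \<le> M m" "M summable_on (UNIV :: int set)"
  shows "((\<lambda>x. \<Sum>\<^sub>\<infinity>m::int. f (x + of_int m)) has_integral I) {0..1}"
    and "continuous_on {0..1} (\<lambda>x. \<Sum>\<^sub>\<infinity>m::int. f (x + of_int m))"
proof -
  have u: "uniform_limit {0..1} (\<lambda>X x. \<Sum>m\<in>X. f (x + of_int m)) (\<lambda>x. \<Sum>\<^sub>\<infinity>m::int. f (x + of_int m)) (finite_subsets_at_top UNIV)"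
    using M by (intro Weierstrass_m_test_general) auto
  have fc: "continuous_on S (\<lambda>x. f (x + of_int m))" for S m
    by (rule continuous_on_compose2 [OF f(1)]) (auto intro!: continuous_intros)
  have c: "continuous_on {0..1} (\<lambda>x. \<Sum>m\<in>X. f (x + of_int m))" for X
    by (intro continuous_intros fc)
  show "continuous_on {0..1} (\<lambda>x. \<Sum>\<^sub>\<infinity>m::int. f (x + of_int m))"
    by (rule uniform_limit_theorem [OF always_eventually u]) (use c in auto)
  obtain I' J where I': "\<And>X. ((\<lambda>x. \<Sum>m\<in>X. f (x + of_int m)) has_integral I' X) {0..1}"
    and J: "((\<lambda>x. \<Sum>\<^sub>\<infinity>m::int. f (x + of_int m)) has_integral J) {0..1}"
    and lim: "(I' \<longlongrightarrow> J) (finite_subsets_at_top UNIV)"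
    using uniform_limit_integral [OF u c] by auto
  have "I' X = (\<Sum>m\<in>X. integral {0..1} (\<lambda>x. f (x + of_int m)))" if "finite X" for X
    using I' [of X] that integral_sum [of X "\<lambda>m x. f (x + of_int m)" "{0..1}"]
    by (simp add: integral_unique integrable_continuous_real fc)
  then have "I' {- int n..<int n} = integral {- real n..real n} f" for n
    by (simp add: integral_symmetric_unfold [OF f(1)])
  moreover have "(\<lambda>n. I' {- int n..<int n}) \<longlonglongrightarrow> J"
    using filterlim_compose [OF lim filterlim_symmetric_int_intervals] .
  ultimately have "J = I"
    using has_integral_UNIV_imp_symmetric_limit [OF f(2)] LIMSEQ_unique by simp blast
  then show "((\<lambda>x. \<Sum>\<^sub>\<infinity>m::int. f (x + of_int m)) has_integral I) {0..1}" using J by simp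
qed

text \<open>A rescaled characteristic function of the standard normal distribution: up to the factor
  \<open>sqrt (2 * pi)\<close>, the substitution by \<open>d\<close> turns the density into
  \<open>exp (- pi * s * x\<^sup>2)\<close>, and \<open>t\<close> is the frequency with
  \<open>t * d = 2 * pi * c\<close>.\<close>

lemma has_integral_gaussian_fourier:
  fixes s c :: real
  assumes "s > 0"
  shows "((\<lambda>x. exp (of_real (- pi * s * x\<^sup>2) + 2 * pi * \<i> * c * x)) has_integral
     complex_of_real (exp (- pi * c\<^sup>2 / s) / sqrt s)) UNIV"
proof -
  define d where "d = sqrt (2 * pi * s)"
  define t where "t = 2 * pi * c / d"
  have d: "d > 0" "d\<^sup>2 = 2 * pi * s" using assms by (auto simp: d_def)
  interpret real_distribution std_normal_distribution
    by (rule real_dist_normal_dist)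
  define F where "F x = std_normal_density x *\<^sub>R iexp (t * x)" for x
  have "integrable std_normal_distribution (\<lambda>x. iexp (t * x))"
    by (rule integrable_iexp) auto
  then have iF: "integrable lborel F"
    unfolding F_def by (subst (asm) integrable_density) (auto simp: normal_density_nonneg)
  have "(LINT x|lborel. F x) = char std_normal_distribution t"
    unfolding char_def F_def by (subst integral_density) (auto simp: normal_density_nonneg)
  also have "\<dots> = exp (- (t\<^sup>2) / 2)"
    by (simp add: char_std_normal_distribution)
  finally have "(LINT x|lborel. F x) = exp (- (t\<^sup>2) / 2)" .
  then have I: "(LINT x|lborel. F (0 + d * x)) = complex_of_real (exp (- (t\<^sup>2) / 2) / d)"
    using lborel_integral_real_affine [of d F 0] d by (simp add: scaleR_conv_of_real field_simps)
  have "integrable lborel (\<lambda>x. F (0 + d * x))"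
    using lborel_integrable_real_affine [OF iF, of d 0] d by simp
  then have "((\<lambda>x. F (0 + d * x)) has_integral complex_of_real (exp (- (t\<^sup>2) / 2) / d)) UNIV"
    using has_integral_integral_lborel [of "\<lambda>x. F (0 + d * x)"] I by simp
  then have "((\<lambda>x. sqrt (2 * pi) * F (0 + d * x)) has_integral (sqrt (2 * pi) * complex_of_real (exp (- (t\<^sup>2) / 2) / d))) UNIV"
    by (rule has_integral_mult_right)
  moreover have "sqrt (2 * pi) * F (0 + d * x) = exp (of_real (- pi * s * x\<^sup>2) + 2 * pi * \<i> * c * x)" for x
  proof -
    have "sqrt (2 * pi) * std_normal_density (d * x) = exp (- pi * s * x\<^sup>2)"
      using d by (simp add: std_normal_density_def power_mult_distrib)
    then have "complex_of_real (sqrt (2 * pi)) * of_real (std_normal_density (d * x)) = exp (of_real (- pi * s * x\<^sup>2))"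
      by (metis exp_of_real of_real_mult)
    moreover have "iexp (t * (d * x)) = exp (2 * pi * \<i> * c * x)" using d by (simp add: t_def algebra_simps)
    ultimately show ?thesis
      by (simp add: F_def scaleR_conv_of_real exp_add exp_diff exp_minus field_simps)
  qed
  moreover have "sqrt (2 * pi) * complex_of_real (exp (- (t\<^sup>2) / 2) / d) = complex_of_real (exp (- pi * c\<^sup>2 / s) / sqrt s)"
  proof -
    have "t\<^sup>2 = (2 * pi * c)\<^sup>2 / (2 * pi * s)" by (simp add: t_def power_divide d(2))
    then have "- (t\<^sup>2) / 2 = - pi * c\<^sup>2 / s"
      using assms by (simp add: power2_eq_square field_simps)
    moreover have "sqrt (2 * pi) / d = 1 / sqrt s" using assms by (simp add: d_def real_sqrt_mult)
    ultimately have "sqrt (2 * pi) * (exp (- (t\<^sup>2) / 2) / d) = exp (- pi * c\<^sup>2 / s) / sqrt s"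
      by (metis (no_types) mult.commute times_divide_eq_left times_divide_eq_right mult_1)
    then show ?thesis by (metis of_real_mult)
  qed
  ultimately show ?thesis by simp
qed

text \<open>Both sides are continuous in \<open>x\<close>, of period 1, and have the same Fourier
  coefficients: on the left by \<open>periodization\<close>, on the right by orthogonality of the
  characters. Uniqueness does the rest.\<close>

theorem poisson_gaussian_periodic:
  fixes s x b :: real
  assumes s: "s > 0"
  shows "(\<Sum>\<^sub>\<infinity>m::int. exp (of_real (- pi * s * (x + of_int m)\<^sup>2) + 2 * pi * \<i> * b * (x + of_int m))) =
     (\<Sum>\<^sub>\<infinity>k::int. of_real (exp (- pi * (of_int k - b)\<^sup>2 / s) / sqrt s) * fourier_char k x)"
    (is "?H x = ?K x")
proof -
  define f where "f x = exp (of_real (- pi * s * x\<^sup>2) + 2 * pi * \<i> * b * of_real x)" for x :: real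
  define c where "c k = exp (- pi * (of_int k - b)\<^sup>2 / s) / sqrt s" for k :: int
  have norm_f: "norm (f x) = exp (- pi * s * x\<^sup>2)" for x
    by (simp add: f_def norm_exp_eq_Re)
  have cont_f: "continuous_on UNIV f" unfolding f_def by (intro continuous_intros)
  have H: "((\<lambda>x. (\<Sum>\<^sub>\<infinity>m::int. f (x + of_int m)) * fourier_char k x) has_integral of_real (c (- k))) {0..1}"
    and cH: "continuous_on {0..1} (\<lambda>x. (\<Sum>\<^sub>\<infinity>m::int. f (x + of_int m)) * fourier_char k x)" for k
  proof -
    let ?g = "\<lambda>x. f x * fourier_char k x"
    have g: "?g x = exp (of_real (- pi * s * x\<^sup>2) + 2 * pi * \<i> * (b + k) * x)" for x
      by (simp add: f_def fourier_char_def exp_add [symmetric] algebra_simps)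
    have I: "(?g has_integral of_real (c (- k))) UNIV"
      using has_integral_gaussian_fourier [OF s, of "b + k"] unfolding g c_def
      by (simp add: power2_commute add.commute algebra_simps)
    have bnd: "norm (?g (x + of_int m)) \<le> exp (pi * s * (2 * 1 + 1)) * exp (- 2 * pi * s) ^ nat \<bar>m\<bar>" if "x \<in> {0..1}" for x m
      using gaussian_le_geometric [OF s, of x 1 m] that by (simp add: norm_mult norm_f)
    have sm: "(\<lambda>m::int. exp (pi * s * (2 * 1 + 1)) * exp (- 2 * pi * s) ^ nat \<bar>m\<bar>) summable_on UNIV"
      using s by (intro summable_on_cmult_right summable_on_power_abs_int) auto
    have eq: "(\<Sum>\<^sub>\<infinity>m::int. ?g (x + of_int m)) = (\<Sum>\<^sub>\<infinity>m::int. f (x + of_int m)) * fourier_char k x" for x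
      unfolding fourier_char_add fourier_char_of_int mult_1_right by (rule infsum_cmult_left')
    have "continuous_on UNIV ?g" by (intro continuous_intros cont_f)
    from periodization [OF this I bnd sm]
    show "((\<lambda>x. (\<Sum>\<^sub>\<infinity>m::int. f (x + of_int m)) * fourier_char k x) has_integral of_real (c (- k))) {0..1}"
      "continuous_on {0..1} (\<lambda>x. (\<Sum>\<^sub>\<infinity>m::int. f (x + of_int m)) * fourier_char k x)"
      unfolding eq by auto
  qed
  have c_pos: "c k > 0" for k using s by (simp add: c_def)
  have c_sum: "c summable_on UNIV"
    using summable_on_cmult_right [OF summable_on_gaussian_int [of "1 / s" "- b"], of "1 / sqrt s"] s
    by (simp add: c_def [abs_def] algebra_simps)
  have K: "((\<lambda>x. ?K x * fourier_char k x) has_integral of_real (c (- k))) {0..1}" 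
    and cK: "continuous_on {0..1} (\<lambda>x. ?K x * fourier_char k x)" for k
  proof -
    have u: "uniform_limit {0..1} (\<lambda>X x. \<Sum>j\<in>X. of_real (c j) * fourier_char j x * fourier_char k x)
       (\<lambda>x. \<Sum>\<^sub>\<infinity>j. of_real (c j) * fourier_char j x * fourier_char k x) (finite_subsets_at_top UNIV)"
      using c_pos by (intro Weierstrass_m_test_general [OF _ c_sum]) (auto simp: norm_mult less_imp_le)
    have co: "continuous_on {0..1} (\<lambda>x. \<Sum>j\<in>X. of_real (c j) * fourier_char j x * fourier_char k x)" for X
      by (intro continuous_intros)
    obtain I' J where I': "\<And>X. ((\<lambda>x. \<Sum>j\<in>X. of_real (c j) * fourier_char j x * fourier_char k x) has_integral I' X) {0..1}"
      and J: "((\<lambda>x. \<Sum>\<^sub>\<infinity>j. of_real (c j) * fourier_char j x * fourier_char k x) has_integral J) {0..1}"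
      and lim: "(I' \<longlongrightarrow> J) (finite_subsets_at_top UNIV)"
      using uniform_limit_integral [OF u co] by auto
    \<comment> \<open>Only the term \<open>j = - k\<close> has a nonzero integral, so the partial
      integrals are constant as soon as the finite set contains \<open>- k\<close>.\<close>
    have "I' X = of_real (c (- k))" if "finite X" "- k \<in> X" for X
    proof -
      have "((\<lambda>x. \<Sum>j\<in>X. of_real (c j) * fourier_char (j + k) x) has_integral
          (\<Sum>j\<in>X. of_real (c j) * (if j + k = 0 then 1 else 0))) {0..1}"
        unfolding integral_fourier_char [symmetric]
        by (intro has_integral_sum that has_integral_mult_right integrable_integral
            integrable_continuous_real continuous_intros)
      moreover have "(\<Sum>j\<in>X. of_real (c j) * (if j + k = 0 then 1 else 0)) = (\<Sum>j\<in>X. if j = - k then complex_of_real (c j) else 0)"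
        by (intro sum.cong) auto
      ultimately show ?thesis using I' [of X] that
        by (simp add: mult.assoc fourier_char_mult has_integral_unique)
    qed
    then have ev: "eventually (\<lambda>X. I' X = of_real (c (- k))) (finite_subsets_at_top UNIV)"
      unfolding eventually_finite_subsets_at_top by (intro exI [of _ "{- k}"]) auto
    have "((\<lambda>X. of_real (c (- k))) \<longlongrightarrow> J) (finite_subsets_at_top (UNIV :: int set))"
      using ev by (rule Lim_transform_eventually [OF lim])
    then have "J = of_real (c (- k))" by (metis finite_subsets_at_top_neq_bot tendsto_const tendsto_unique)
    moreover have eq: "(\<Sum>\<^sub>\<infinity>j. of_real (c j) * fourier_char j x * fourier_char k x) = ?K x * fourier_char k x" for x
      unfolding c_def by (rule infsum_cmult_left')
    ultimately show "((\<lambda>x. ?K x * fourier_char k x) has_integral of_real (c (- k))) {0..1}" using J by simp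
    have "continuous_on {0..1} (\<lambda>x. \<Sum>\<^sub>\<infinity>j. of_real (c j) * fourier_char j x * fourier_char k x)"
      by (rule uniform_limit_theorem [OF always_eventually u]) (use co in auto)
    then show "continuous_on {0..1} (\<lambda>x. ?K x * fourier_char k x)" unfolding eq .
  qed
  have HK: "?H x - ?K x = (\<Sum>\<^sub>\<infinity>m::int. f (x + of_int m)) - ?K x" for x
    by (simp add: f_def)
  have per: "?H (x + of_int j) - ?K (x + of_int j) = ?H x - ?K x" for j x
  proof -
    have "(\<Sum>\<^sub>\<infinity>m::int. f (x + of_int j + of_int m)) = (\<Sum>\<^sub>\<infinity>m::int. f (x + of_int m))"
      by (rule infsum_reindex_bij_witness [of _ "\<lambda>m. m - j" "\<lambda>m. m + j"]) (auto simp: algebra_simps)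
    then show ?thesis unfolding HK by (simp add: fourier_char_add fourier_char_of_int)
  qed
  have "(\<lambda>x. ?H x - ?K x) \<in> no_fourier_coeffs"
  proof -
    have "continuous_on {0..1} (\<lambda>x. ?H x - ?K x)"
      using cH [of 0] cK [of 0] unfolding HK by (intro continuous_intros) (auto simp: fourier_char_def)
    moreover have "integral {0..1} (\<lambda>x. (?H x - ?K x) * fourier_char k x) = 0" for k
      using has_integral_diff [OF H [of k] K [of k]] unfolding HK
      by (intro integral_unique) (simp add: left_diff_distrib)
    ultimately show ?thesis by (simp add: no_fourier_coeffs_def)
  qed
  then have "?H (frac x) - ?K (frac x) = 0"
    using per [of 0 1] frac_lt_1 [of x] by (intro fourier_uniqueness) (auto simp: less_imp_le)
  then show ?thesis using per [of "frac x" "\<lfloor>x\<rfloor>"] by (simp add: frac_def)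
qed

text \<open>A phase moves the character from \<open>x + m\<close> to \<open>m\<close> and the dual
  sum to the shifted integers \<open>k - b\<close>; this form enters the induction on the
  rank.\<close>

corollary poisson_gaussian_int:
  fixes s x b :: real
  assumes s: "s > 0"
  shows "(\<Sum>\<^sub>\<infinity>m::int. exp (of_real (- pi * s * (x + of_int m)\<^sup>2) + 2 * pi * \<i> * b * of_int m)) =
     of_real (1 / sqrt s) * (\<Sum>\<^sub>\<infinity>k::int. exp (of_real (- pi * (of_int k - b)\<^sup>2 / s) + 2 * pi * \<i> * x * (of_int k - b)))"
proof -
  have "exp (of_real (- pi * s * (x + of_int m)\<^sup>2) + 2 * pi * \<i> * b * of_int m) =
      exp (- 2 * pi * \<i> * b * x) * exp (of_real (- pi * s * (x + of_int m)\<^sup>2) + 2 * pi * \<i> * b * (x + of_int m))" for m :: int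
    by (simp add: exp_add [symmetric] algebra_simps)
  then have "(\<Sum>\<^sub>\<infinity>m::int. exp (of_real (- pi * s * (x + of_int m)\<^sup>2) + 2 * pi * \<i> * b * of_int m)) =
     exp (- 2 * pi * \<i> * b * x) * (\<Sum>\<^sub>\<infinity>k::int. of_real (exp (- pi * (of_int k - b)\<^sup>2 / s) / sqrt s) * fourier_char k x)"
    by (simp only: infsum_cmult_right' poisson_gaussian_periodic [OF s])
  also have "\<dots> = (\<Sum>\<^sub>\<infinity>k::int. of_real (1 / sqrt s) * exp (of_real (- pi * (of_int k - b)\<^sup>2 / s) + 2 * pi * \<i> * x * (of_int k - b)))"
    unfolding infsum_cmult_right' [symmetric]
  proof (intro infsum_cong)
    fix k :: int
    have "complex_of_real (exp (- pi * (of_int k - b)\<^sup>2 / s) / sqrt s) = of_real (1 / sqrt s) * exp (of_real (- pi * (of_int k - b)\<^sup>2 / s))"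
      by (simp only: exp_of_real of_real_mult [symmetric]) simp
    moreover have "exp (- 2 * pi * \<i> * b * x) * fourier_char k x = exp (2 * pi * \<i> * x * (of_int k - b))"
      unfolding fourier_char_def exp_add [symmetric] by (simp add: algebra_simps)
    ultimately show "exp (- 2 * pi * \<i> * b * x) * (of_real (exp (- pi * (of_int k - b)\<^sup>2 / s) / sqrt s) * fourier_char k x) =
        of_real (1 / sqrt s) * exp (of_real (- pi * (of_int k - b)\<^sup>2 / s) + 2 * pi * \<i> * x * (of_int k - b))"
      by (simp only: exp_add mult.assoc mult.left_commute)
  qed
  finally show ?thesis by (simp only: infsum_cmult_right')
qed

section \<open>Poisson summation over lattices\<close>

lemma summable_on_product_nonneg:
  fixes f :: "'a \<Rightarrow> real" and g :: "'b \<Rightarrow> real"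
  assumes "f summable_on A" "g summable_on B" "\<And>x. f x \<ge> 0" "\<And>y. g y \<ge> 0"
  shows "(\<lambda>(x, y). f x * g y) summable_on A \<times> B"
proof (rule summable_on_SigmaI)
  show "((\<lambda>y. case (x, y) of (x, y) \<Rightarrow> f x * g y) has_sum f x * infsum g B) B" for x
    using assms(2) by (auto intro!: has_sum_cmult_right)
  show "(\<lambda>x. f x * infsum g B) summable_on A"
    using assms(1) by (rule summable_on_cmult_left)
qed (use assms in auto)

lemma summable_on_norm_le:
  fixes f :: "'a \<Rightarrow> complex"
  assumes "g summable_on A" "\<And>x. x \<in> A \<Longrightarrow> norm (f x) \<le> g x"
  shows "f summable_on A"
  by (rule abs_summable_summable, rule Infinite_Sum.abs_summable_on_comparison_test' [OF assms])

lemma le_norm_of_real_eq: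
  fixes z :: complex
  assumes "complex_of_real r = z" shows "r \<le> norm z"
  using assms by auto

text \<open>On the dual side \<open>x\<close> occurs only in phases of modulus 1, so the triangle
  inequality there gives a bound uniform in \<open>x\<close>. It controls the fibres in
  \<open>poisson_gaussian_span\<close>.\<close>

lemma infsum_gaussian_int_bounded:
  assumes s: "s > 0"
  obtains K where "\<And>x. (\<Sum>\<^sub>\<infinity>m::int. exp (- pi * s * (x + of_int m)\<^sup>2)) \<le> K"
proof
  fix x :: real
  have sm: "(\<lambda>k::int. exp (- pi * (1 / s) * (0 + of_int k)\<^sup>2)) summable_on UNIV"
    using s by (intro summable_on_gaussian_int) auto
  have "complex_of_real (\<Sum>\<^sub>\<infinity>m::int. exp (- pi * s * (x + of_int m)\<^sup>2)) = (\<Sum>\<^sub>\<infinity>m::int. of_real (exp (- pi * s * (x + of_int m)\<^sup>2)))"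
    by (rule infsumI [OF has_sum_of_real [OF has_sum_infsum [OF summable_on_gaussian_int [OF s, of x]]], symmetric])
  also have "\<dots> = (\<Sum>\<^sub>\<infinity>m::int. exp (of_real (- pi * s * (x + of_int m)\<^sup>2) + 2 * pi * \<i> * (0::real) * of_int m))"
    by (simp add: exp_of_real [symmetric])
  also have "\<dots> = of_real (1 / sqrt s) * (\<Sum>\<^sub>\<infinity>k::int. exp (of_real (- pi * (of_int k - 0)\<^sup>2 / s) + 2 * pi * \<i> * x * (of_int k - (0::real))))"
    by (rule poisson_gaussian_int [OF s])
  also note * = le_norm_of_real_eq [OF calculation]
  have n: "norm (exp (of_real (- pi * (of_int k - 0)\<^sup>2 / s) + 2 * pi * \<i> * x * (of_int k - (0::real)))) = exp (- pi * (1 / s) * (0 + of_int k)\<^sup>2)" for k :: int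
    by (simp add: norm_exp_eq_Re)
  have "norm (\<Sum>\<^sub>\<infinity>k::int. exp (of_real (- pi * (of_int k - 0)\<^sup>2 / s) + 2 * pi * \<i> * x * (of_int k - (0::real))))
     \<le> (\<Sum>\<^sub>\<infinity>k::int. exp (- pi * (1 / s) * (0 + of_int k)\<^sup>2))"
    unfolding n [symmetric] by (rule norm_infsum_bound) (use sm in \<open>simp only: n\<close>)
  then have "\<bar>1 / sqrt s\<bar> * norm (\<Sum>\<^sub>\<infinity>k::int. exp (of_real (- pi * (of_int k - 0)\<^sup>2 / s) + 2 * pi * \<i> * x * (of_int k - (0::real))))
     \<le> \<bar>1 / sqrt s\<bar> * (\<Sum>\<^sub>\<infinity>k::int. exp (- pi * (1 / s) * (0 + of_int k)\<^sup>2))"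
    by (rule mult_left_mono) simp
  with * show "(\<Sum>\<^sub>\<infinity>m::int. exp (- pi * s * (x + of_int m)\<^sup>2)) \<le> \<bar>1 / sqrt s\<bar> * (\<Sum>\<^sub>\<infinity>k::int. exp (- pi * (1 / s) * (0 + of_int k)\<^sup>2))"
    unfolding norm_mult norm_of_real by (rule order_trans)
qed

section \<open>Integer spans of independent sets, their dual cosets and Poisson summation over
  them\<close>

definition int_span :: "'a::euclidean_space set \<Rightarrow> 'a set" where
  "int_span B = {(\<Sum>b\<in>B. of_int (c b) *\<^sub>R b) | c :: 'a \<Rightarrow> int. True}"

text \<open>The dual lattice of \<open>int_span B\<close> inside \<open>span B\<close>, translated
  by minus the projection of \<open>b\<close>. It is the support of the dual sum when the lattice
  sum carries the character \<open>exp (2 * pi * \<i> * of_real (x \<bullet> b))\<close>.\<close>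

definition int_dual_coset :: "'a::euclidean_space set \<Rightarrow> 'a \<Rightarrow> 'a set" where
  "int_dual_coset B b = {y \<in> span B. \<forall>x\<in>B. (y + b) \<bullet> x \<in> \<int>}"

lemma int_span_subset_span: "int_span B \<subseteq> span B"
  by (auto simp: int_span_def intro!: span_sum span_scale intro: span_base)

lemma bij_betw_int_span_insert:
  assumes "finite B" "v \<notin> span B"
  shows "bij_betw (\<lambda>(m::int, x). x + of_int m *\<^sub>R v) (UNIV \<times> int_span B) (int_span (insert v B))"
  unfolding bij_betw_def
proof
  have "v \<notin> B" using assms span_base by blast
  show "inj_on (\<lambda>(m::int, x). x + of_int m *\<^sub>R v) (UNIV \<times> int_span B)"
  proof (clarsimp simp: inj_on_def)
    fix m m' :: int and x x' assume x: "x \<in> int_span B" "x' \<in> int_span B"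
      and eq: "x + of_int m *\<^sub>R v = x' + of_int m' *\<^sub>R v"
    have "(of_int m - of_int m') *\<^sub>R v = x' - x" using eq by (simp add: algebra_simps)
    also have "\<dots> \<in> span B" using x int_span_subset_span by (intro span_diff) auto
    finally have "m = m'" using assms(2) span_mul [of "(of_int m - of_int m') *\<^sub>R v" B "1 / (of_int m - of_int m')"]
      by (cases "m = m'") auto
    then show "m = m' \<and> x = x'" using eq by simp
  qed
  show "(\<lambda>(m::int, x). x + of_int m *\<^sub>R v) ` (UNIV \<times> int_span B) = int_span (insert v B)"
  proof (intro equalityI subsetI)
    fix z assume "z \<in> (\<lambda>(m::int, x). x + of_int m *\<^sub>R v) ` (UNIV \<times> int_span B)"
    then obtain m c where z: "z = (\<Sum>b\<in>B. of_int (c b) *\<^sub>R b) + of_int m *\<^sub>R v"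
      by (auto simp: int_span_def)
    then have "z = (\<Sum>b\<in>insert v B. of_int ((c(v := m)) b) *\<^sub>R b)"
      using assms(1) \<open>v \<notin> B\<close> by (auto intro!: sum.cong)
    then show "z \<in> int_span (insert v B)" unfolding int_span_def by blast
  next
    fix z assume "z \<in> int_span (insert v B)"
    then obtain c where "z = of_int (c v) *\<^sub>R v + (\<Sum>b\<in>B. of_int (c b) *\<^sub>R b)"
      using assms(1) \<open>v \<notin> B\<close> by (auto simp: int_span_def)
    then have "z = (\<Sum>b\<in>B. of_int (c b) *\<^sub>R b) + of_int (c v) *\<^sub>R v" by simp
    then show "z \<in> (\<lambda>(m::int, x). x + of_int m *\<^sub>R v) ` (UNIV \<times> int_span B)"
      unfolding image_iff by (intro bexI [of _ "(c v, \<Sum>b\<in>B. of_int (c b) *\<^sub>R b)"]) (auto simp: int_span_def)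
  qed
qed

text \<open>An element \<open>z\<close> is determined by its projection \<open>y\<close> to
  \<open>span B\<close> and its component along \<open>u\<close>. The latter is fixed by the integer
  \<open>k\<close>, the inner product of \<open>z + b\<close> with \<open>v\<close>.\<close>

lemma bij_betw_int_dual_coset_insert:
  fixes v :: "'a::euclidean_space"
  assumes v: "v = p + u" "p \<in> span B" "\<forall>x\<in>span B. u \<bullet> x = 0" "u \<noteq> 0"
  shows "bij_betw (\<lambda>(y, k::int). y + ((of_int k - v \<bullet> (y + b)) / (u \<bullet> u)) *\<^sub>R u)
           (int_dual_coset B b \<times> UNIV) (int_dual_coset (insert v B) b)"
  unfolding bij_betw_def
proof
  let ?f = "\<lambda>(y, k::int). y + ((of_int k - v \<bullet> (y + b)) / (u \<bullet> u)) *\<^sub>R u"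
  have uu: "u \<bullet> u \<noteq> 0" using v by simp
  have uv: "u \<bullet> v = u \<bullet> u" "v \<bullet> u = u \<bullet> u" using v by (auto simp: inner_add_right inner_commute)
  show "inj_on ?f (int_dual_coset B b \<times> UNIV)"
  proof (clarsimp simp: inj_on_def)
    fix y y' and k k' :: int assume y: "y \<in> int_dual_coset B b" "y' \<in> int_dual_coset B b"
      and eq: "y + ((of_int k - v \<bullet> (y + b)) / (u \<bullet> u)) *\<^sub>R u = y' + ((of_int k' - v \<bullet> (y' + b)) / (u \<bullet> u)) *\<^sub>R u"
    have sp: "y \<in> span B" "y' \<in> span B" using y by (auto simp: int_dual_coset_def)
    then have "u \<bullet> (y + ((of_int k - v \<bullet> (y + b)) / (u \<bullet> u)) *\<^sub>R u) = of_int k - v \<bullet> (y + b)"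
       "u \<bullet> (y' + ((of_int k' - v \<bullet> (y' + b)) / (u \<bullet> u)) *\<^sub>R u) = of_int k' - v \<bullet> (y' + b)"
      using v(3) uu by (auto simp: inner_add_right)
    with eq have e: "of_int k - v \<bullet> (y + b) = of_int k' - v \<bullet> (y' + b)" by simp
    with eq have "y = y'" by simp
    with e show "y = y' \<and> k = k'" by simp
  qed
  show "?f ` (int_dual_coset B b \<times> UNIV) = int_dual_coset (insert v B) b"
  proof (intro equalityI subsetI)
    fix z assume "z \<in> ?f ` (int_dual_coset B b \<times> UNIV)"
    then obtain y k where y: "y \<in> int_dual_coset B b" and z: "z = y + ((of_int k - v \<bullet> (y + b)) / (u \<bullet> u)) *\<^sub>R u" by auto
    have "u = v - p" using v by simp
    then have "u \<in> span (insert v B)"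
      using v(2) span_mono [of B "insert v B"] by (metis insertI1 span_base span_diff subsetD subset_insertI)
    moreover have "y \<in> span (insert v B)"
      using y span_mono [of B "insert v B"] by (auto simp: int_dual_coset_def)
    ultimately have "z \<in> span (insert v B)" unfolding z by (intro span_add span_scale)
    moreover have "(z + b) \<bullet> v = of_int k"
      unfolding z using uu uv by (simp add: inner_add_left inner_add_right inner_commute)
    moreover have "(z + b) \<bullet> x = (y + b) \<bullet> x" if "x \<in> B" for x
      unfolding z using v(3) [rule_format, OF span_base [OF that]] by (simp add: inner_add_left)
    ultimately show "z \<in> int_dual_coset (insert v B) b"
      using y by (auto simp: int_dual_coset_def)
  next
    fix z assume z: "z \<in> int_dual_coset (insert v B) b"
    define y where "y = z - ((u \<bullet> z) / (u \<bullet> u)) *\<^sub>R u"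
    obtain c where c: "z - c *\<^sub>R v \<in> span B"
      using z span_breakdown_eq [of z v B] by (auto simp: int_dual_coset_def)
    have "u \<bullet> z = c * (u \<bullet> u)" using v(3) [rule_format, OF c] uv by (simp add: inner_diff_right)
    then have "y = (z - c *\<^sub>R v) + c *\<^sub>R p" using uu v(1) by (simp add: y_def algebra_simps)
    then have ysp: "y \<in> span B" using c v(2) by (simp add: span_add span_scale)
    have "(y + b) \<bullet> x = (z + b) \<bullet> x" if "x \<in> B" for x
      unfolding y_def using v(3) [rule_format, OF span_base [OF that]] by (simp add: inner_add_left inner_diff_left)
    then have y: "y \<in> int_dual_coset B b"
      using z ysp by (auto simp: int_dual_coset_def)
    obtain k where k: "(z + b) \<bullet> v = of_int k"
      using z by (auto simp: int_dual_coset_def elim: Ints_cases)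
    have "of_int k - v \<bullet> (y + b) = v \<bullet> (z - y)"
      using k by (simp add: inner_add_right inner_add_left inner_diff_right inner_commute)
    also have "\<dots> = u \<bullet> z" using uu uv by (simp add: y_def)
    finally have "z = ?f (y, k)" by (simp add: y_def)
    then show "z \<in> ?f ` (int_dual_coset B b \<times> UNIV)" using y by blast
  qed
qed

text \<open>Induction on the basis: \<open>v\<close> splits into \<open>p\<close> in
  \<open>span B\<close> and an orthogonal \<open>u\<close>, the induction hypothesis treats each
  fibre with fixed multiple \<open>m\<close> of \<open>v\<close>, and after an exchange of sums the
  sum over \<open>m\<close> is one-dimensional. A general shift \<open>a\<close> is carried along
  because the shift of a fibre varies with \<open>m\<close>. The constant \<open>C\<close> is the
  reciprocal covolume, the product of the factors \<open>1 / sqrt uu\<close>; only its independence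
  of \<open>t\<close> is recorded.\<close>

lemma poisson_gaussian_span:
  fixes B :: "'a::euclidean_space set"
  assumes "finite B" "independent B"
  shows "\<exists>C>0. \<forall>t>0.
    (\<forall>a\<in>span B. (\<lambda>x. exp (- pi * t * ((x + a) \<bullet> (x + a)))) summable_on int_span B) \<and>
    (\<forall>b. (\<lambda>y. exp (- pi * t * (y \<bullet> y))) summable_on int_dual_coset B b) \<and>
    (\<forall>a\<in>span B. \<forall>b. (\<Sum>\<^sub>\<infinity>x\<in>int_span B. exp (of_real (- pi * t * ((x + a) \<bullet> (x + a))) + 2 * pi * \<i> * of_real (x \<bullet> b))) =
       of_real (C * (1 / sqrt t) ^ card B) *
       (\<Sum>\<^sub>\<infinity>y\<in>int_dual_coset B b. exp (of_real (- pi * (y \<bullet> y) / t) + 2 * pi * \<i> * of_real (y \<bullet> a))))"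
  using assms
proof (induction B rule: finite_induct)
  case empty
  have "int_dual_coset {} b = {0}" for b :: 'a by (auto simp: int_dual_coset_def)
  moreover have "int_span ({} :: 'a set) = {0}" by (auto simp: int_span_def)
  ultimately show ?case by (intro exI [of _ 1]) auto
next
  case (insert v B)
  have indB: "independent B" and v: "v \<notin> span B"
    using insert.prems insert.hyps by (auto simp: independent_insert)
  obtain C where C: "C > 0" and
    IH1: "\<And>t a. t > 0 \<Longrightarrow> a \<in> span B \<Longrightarrow> (\<lambda>x. exp (- pi * t * ((x + a) \<bullet> (x + a)))) summable_on int_span B" and
    IH2: "\<And>t b. t > 0 \<Longrightarrow> (\<lambda>y. exp (- pi * t * (y \<bullet> y))) summable_on int_dual_coset B b" and
    IH3: "\<And>t a b. t > 0 \<Longrightarrow> a \<in> span B \<Longrightarrow> (\<Sum>\<^sub>\<infinity>x\<in>int_span B. exp (of_real (- pi * t * ((x + a) \<bullet> (x + a))) + 2 * pi * \<i> * of_real (x \<bullet> b))) =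
       of_real (C * (1 / sqrt t) ^ card B) *
       (\<Sum>\<^sub>\<infinity>y\<in>int_dual_coset B b. exp (of_real (- pi * (y \<bullet> y) / t) + 2 * pi * \<i> * of_real (y \<bullet> a)))"
    using insert.IH [OF indB] by blast
  obtain p u where pu: "p \<in> span B" "\<forall>x\<in>span B. u \<bullet> x = 0" "v = p + u"
    using orthogonal_subspace_decomp_exists [of B v] unfolding orthogonal_def by metis
  have "u \<noteq> 0" using pu v by auto
  define uu where "uu = u \<bullet> u"
  have uu: "uu > 0" using \<open>u \<noteq> 0\<close> by (simp add: uu_def)
  note bij1 = bij_betw_int_span_insert [OF insert.hyps(1) v]
  note bij2 = bij_betw_int_dual_coset_insert [OF pu(3,1,2) \<open>u \<noteq> 0\<close>, folded uu_def]
  have norm2: "(y + c *\<^sub>R u) \<bullet> (y + c *\<^sub>R u) = y \<bullet> y + c\<^sup>2 * uu" if "y \<in> span B" for y c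
    using pu(2) [rule_format, OF that] by (simp add: inner_add_left inner_add_right inner_commute uu_def power2_eq_square)
  have S2: "(\<lambda>y. exp (- pi * t * (y \<bullet> y))) summable_on int_dual_coset (insert v B) b" if t: "t > 0" for t b
  proof -
    obtain K where K: "\<And>x. (\<Sum>\<^sub>\<infinity>m::int. exp (- pi * (t / uu) * (x + of_int m)\<^sup>2)) \<le> K"
      using infsum_gaussian_int_bounded [of "t / uu"] t uu by auto
    have "(\<lambda>(y, k::int). exp (- pi * t * (y \<bullet> y)) * exp (- pi * (t / uu) * (- (v \<bullet> (y + b)) + of_int k)\<^sup>2))
        summable_on int_dual_coset B b \<times> UNIV"
    proof (rule summable_on_SigmaI)
      fix y
      show "((\<lambda>k. case (y, k) of (y, k::int) \<Rightarrow> exp (- pi * t * (y \<bullet> y)) * exp (- pi * (t / uu) * (- (v \<bullet> (y + b)) + of_int k)\<^sup>2))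
         has_sum exp (- pi * t * (y \<bullet> y)) * (\<Sum>\<^sub>\<infinity>k::int. exp (- pi * (t / uu) * (- (v \<bullet> (y + b)) + of_int k)\<^sup>2))) UNIV"
        unfolding prod.case using t uu by (intro has_sum_cmult_right has_sum_infsum summable_on_gaussian_int) auto
    next
      show "(\<lambda>y. exp (- pi * t * (y \<bullet> y)) * (\<Sum>\<^sub>\<infinity>k::int. exp (- pi * (t / uu) * (- (v \<bullet> (y + b)) + of_int k)\<^sup>2)))
         summable_on int_dual_coset B b"
      proof (rule summable_on_comparison_test)
        show "(\<lambda>y. exp (- pi * t * (y \<bullet> y)) * K) summable_on int_dual_coset B b"
          using IH2 [OF t] by (rule summable_on_cmult_left)
        show "exp (- pi * t * (y \<bullet> y)) * (\<Sum>\<^sub>\<infinity>k::int. exp (- pi * (t / uu) * (- (v \<bullet> (y + b)) + of_int k)\<^sup>2)) \<le> exp (- pi * t * (y \<bullet> y)) * K" for y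
          by (intro mult_left_mono K) simp
      qed (auto intro!: mult_nonneg_nonneg infsum_nonneg)
    qed auto
    moreover have "exp (- pi * t * (y \<bullet> y)) * exp (- pi * (t / uu) * (- (v \<bullet> (y + b)) + of_int k)\<^sup>2) =
       exp (- pi * t * ((y + ((of_int k - v \<bullet> (y + b)) / uu) *\<^sub>R u) \<bullet> (y + ((of_int k - v \<bullet> (y + b)) / uu) *\<^sub>R u)))"
      if "y \<in> int_dual_coset B b" for y and k :: int
    proof -
      have y: "y \<in> span B" using that by (simp add: int_dual_coset_def)
      have sq: "((of_int k - v \<bullet> (y + b)) / uu)\<^sup>2 * uu = (- (v \<bullet> (y + b)) + of_int k)\<^sup>2 / uu"
        using uu by (simp add: power2_eq_square)
      show ?thesis unfolding norm2 [OF y] sq exp_add [symmetric] by (simp add: distrib_left)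
    qed
    ultimately have "(\<lambda>(y, k::int). exp (- pi * t * ((y + ((of_int k - v \<bullet> (y + b)) / uu) *\<^sub>R u) \<bullet> (y + ((of_int k - v \<bullet> (y + b)) / uu) *\<^sub>R u))))
        summable_on int_dual_coset B b \<times> UNIV"
      by (subst summable_on_cong [where g = "\<lambda>(y, k::int). exp (- pi * t * (y \<bullet> y)) * exp (- pi * (t / uu) * (- (v \<bullet> (y + b)) + of_int k)\<^sup>2)"]) auto
    then show ?thesis
      by (subst summable_on_reindex_bij_betw [OF bij2, symmetric]) (simp only: case_prod_unfold)
  qed
  have "(\<lambda>x. exp (- pi * t * ((x + a) \<bullet> (x + a)))) summable_on int_span (insert v B) \<and>
    (\<Sum>\<^sub>\<infinity>x\<in>int_span (insert v B). exp (of_real (- pi * t * ((x + a) \<bullet> (x + a))) + 2 * pi * \<i> * of_real (x \<bullet> b))) =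
       of_real (C / sqrt uu * (1 / sqrt t) ^ card (insert v B)) *
       (\<Sum>\<^sub>\<infinity>y\<in>int_dual_coset (insert v B) b. exp (of_real (- pi * (y \<bullet> y) / t) + 2 * pi * \<i> * of_real (y \<bullet> a)))"
    if t: "t > 0" and a: "a \<in> span (insert v B)" for t a b
  proof -
    obtain \<alpha> where \<alpha>: "a - \<alpha> *\<^sub>R v \<in> span B" using a span_breakdown_eq by blast
    \<comment> \<open>Chosen so that \<open>x + of_int m *\<^sub>R v + a\<close> is
      \<open>x + a1 m\<close> in \<open>span B\<close> plus \<open>\<alpha> + of_int m\<close> times
      the orthogonal vector \<open>u\<close>.\<close>
    define a1 where "a1 m = (a - \<alpha> *\<^sub>R v) + (\<alpha> + of_int m) *\<^sub>R p" for m :: int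
    have a1: "a1 m \<in> span B" for m using \<alpha> pu by (simp add: a1_def span_add span_scale)
    define E where "E m = exp (of_real (- pi * (t * uu) * (\<alpha> + of_int m)\<^sup>2) + 2 * pi * \<i> * of_real (of_int m * (v \<bullet> b)))" for m :: int
    define En where "En m = exp (- pi * (t * uu) * (\<alpha> + of_int m)\<^sup>2)" for m :: int
    have En: "En summable_on UNIV" unfolding En_def using t uu by (intro summable_on_gaussian_int) auto
    have nsplit: "(x + of_int m *\<^sub>R v + a) \<bullet> (x + of_int m *\<^sub>R v + a) = (x + a1 m) \<bullet> (x + a1 m) + (\<alpha> + of_int m)\<^sup>2 * uu"
      if "x \<in> int_span B" for x and m :: int
    proof -
      have "x + of_int m *\<^sub>R v + a = (x + a1 m) + (\<alpha> + of_int m) *\<^sub>R u"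
        unfolding a1_def pu(3) by (simp add: algebra_simps)
      moreover have "x + a1 m \<in> span B" using that int_span_subset_span a1 by (blast intro: span_add)
      ultimately show ?thesis by (simp only: norm2)
    qed
    define T where "T = (\<Sum>\<^sub>\<infinity>y\<in>int_dual_coset B 0. exp (- pi * (1 / t) * (y \<bullet> y)))"
    \<comment> \<open>The dual side bounds the fibre sums uniformly in \<open>m\<close>, so the
      double sum over \<open>m\<close> and \<open>x\<close> is absolutely summable.\<close>
    have inner_le: "(\<Sum>\<^sub>\<infinity>x\<in>int_span B. exp (- pi * t * ((x + a1 m) \<bullet> (x + a1 m)))) \<le> C * (1 / sqrt t) ^ card B * T" for m
    proof -
      have "complex_of_real (\<Sum>\<^sub>\<infinity>x\<in>int_span B. exp (- pi * t * ((x + a1 m) \<bullet> (x + a1 m)))) =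
         (\<Sum>\<^sub>\<infinity>x\<in>int_span B. of_real (exp (- pi * t * ((x + a1 m) \<bullet> (x + a1 m)))))"
        by (rule infsumI [OF has_sum_of_real [OF has_sum_infsum [OF IH1 [OF t a1]]], symmetric])
      also have "\<dots> = (\<Sum>\<^sub>\<infinity>x\<in>int_span B. exp (of_real (- pi * t * ((x + a1 m) \<bullet> (x + a1 m))) + 2 * pi * \<i> * of_real (x \<bullet> 0)))"
        by (simp add: exp_of_real [symmetric])
      also have "\<dots> = of_real (C * (1 / sqrt t) ^ card B) *
         (\<Sum>\<^sub>\<infinity>y\<in>int_dual_coset B 0. exp (of_real (- pi * (y \<bullet> y) / t) + 2 * pi * \<i> * of_real (y \<bullet> a1 m)))"
        by (rule IH3 [OF t a1])
      also note * = le_norm_of_real_eq [OF calculation]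
      have n: "norm (exp (of_real (- pi * (y \<bullet> y) / t) + 2 * pi * \<i> * of_real (y \<bullet> a1 m))) = exp (- pi * (1 / t) * (y \<bullet> y))" for y
        by (simp add: norm_exp_eq_Re)
      have "norm (\<Sum>\<^sub>\<infinity>y\<in>int_dual_coset B 0. exp (of_real (- pi * (y \<bullet> y) / t) + 2 * pi * \<i> * of_real (y \<bullet> a1 m))) \<le> T"
        unfolding T_def n [symmetric] by (rule norm_infsum_bound) (use IH2 [of "1 / t"] t in \<open>simp only: n\<close>, simp)
      then show ?thesis
        using C t by (intro order_trans [OF *], unfold norm_mult norm_of_real) (intro mult_mono, auto)
    qed
    have sum1: "(\<lambda>(m::int, x). En m * exp (- pi * t * ((x + a1 m) \<bullet> (x + a1 m)))) summable_on UNIV \<times> int_span B"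
    proof (rule summable_on_SigmaI)
      show "((\<lambda>x. case (m, x) of (m::int, x) \<Rightarrow> En m * exp (- pi * t * ((x + a1 m) \<bullet> (x + a1 m))))
         has_sum En m * (\<Sum>\<^sub>\<infinity>x\<in>int_span B. exp (- pi * t * ((x + a1 m) \<bullet> (x + a1 m))))) (int_span B)" for m
        unfolding prod.case by (intro has_sum_cmult_right has_sum_infsum IH1 t a1)
      show "(\<lambda>m. En m * (\<Sum>\<^sub>\<infinity>x\<in>int_span B. exp (- pi * t * ((x + a1 m) \<bullet> (x + a1 m))))) summable_on UNIV"
      proof (rule summable_on_comparison_test)
        show "(\<lambda>m. En m * (C * (1 / sqrt t) ^ card B * T)) summable_on UNIV"
          using En by (rule summable_on_cmult_left)
        show "En m * (\<Sum>\<^sub>\<infinity>x\<in>int_span B. exp (- pi * t * ((x + a1 m) \<bullet> (x + a1 m)))) \<le> En m * (C * (1 / sqrt t) ^ card B * T)" for m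
          by (intro mult_left_mono inner_le) (simp add: En_def)
      qed (auto intro!: mult_nonneg_nonneg infsum_nonneg simp: En_def)
    qed (auto simp: En_def)
    have sum1': "(\<lambda>x. exp (- pi * t * ((x + a) \<bullet> (x + a)))) summable_on int_span (insert v B)"
    proof -
      have "(\<lambda>(m::int, x). exp (- pi * t * ((x + of_int m *\<^sub>R v + a) \<bullet> (x + of_int m *\<^sub>R v + a)))) summable_on UNIV \<times> int_span B"
        by (rule summable_on_cong [THEN iffD1, OF _ sum1])
           (auto simp: nsplit En_def exp_add [symmetric] distrib_left mult_ac)
      then show ?thesis
        by (subst summable_on_reindex_bij_betw [OF bij1, symmetric]) (simp only: case_prod_unfold)
    qed
    let ?F = "\<lambda>x. exp (of_real (- pi * t * ((x + a) \<bullet> (x + a))) + 2 * pi * \<i> * of_real (x \<bullet> b))"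
    let ?G = "\<lambda>y. exp (of_real (- pi * (y \<bullet> y) / t) + 2 * pi * \<i> * of_real (y \<bullet> a))"
    have sumF: "(\<lambda>(m::int, x). ?F (x + of_int m *\<^sub>R v)) summable_on UNIV \<times> int_span B"
    proof (rule summable_on_norm_le [OF sum1])
      show "norm (case z of (m::int, x) \<Rightarrow> ?F (x + of_int m *\<^sub>R v)) \<le> (case z of (m, x) \<Rightarrow> En m * exp (- pi * t * ((x + a1 m) \<bullet> (x + a1 m))))"
        if "z \<in> UNIV \<times> int_span B" for z
        using that by (auto simp: norm_exp_eq_Re nsplit En_def exp_add [symmetric] distrib_left mult_ac)
    qed
    have Fsplit: "?F (x + of_int m *\<^sub>R v) = E m * exp (of_real (- pi * t * ((x + a1 m) \<bullet> (x + a1 m))) + 2 * pi * \<i> * of_real (x \<bullet> b))"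
      if "x \<in> int_span B" for x and m :: int
      unfolding nsplit [OF that] E_def exp_add [symmetric] by (simp add: algebra_simps)
    define H where "H m y = E m * exp (of_real (- pi * (y \<bullet> y) / t) + 2 * pi * \<i> * of_real (y \<bullet> a1 m))" for m :: int and y
    have sumH: "(\<lambda>(m, y). H m y) summable_on UNIV \<times> int_dual_coset B b"
    proof (rule summable_on_norm_le)
      show "(\<lambda>(m, y). En m * exp (- pi * (1 / t) * (y \<bullet> y))) summable_on UNIV \<times> int_dual_coset B b"
        using t by (intro summable_on_product_nonneg En IH2) (auto simp: En_def)
    qed (auto simp: H_def norm_mult norm_exp_eq_Re E_def En_def)
    \<comment> \<open>For fixed \<open>y\<close> this is one-dimensional Poisson summation with
      parameter \<open>t * uu\<close>, shift \<open>\<alpha>\<close> and frequency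
      \<open>\<beta> = v \<bullet> (y + b)\<close>; its dual variable \<open>k\<close> is the
      integer coordinate of \<open>bij2\<close>.\<close>
    have inner: "(\<Sum>\<^sub>\<infinity>m. H m y) = of_real (1 / sqrt (t * uu)) * (\<Sum>\<^sub>\<infinity>k::int. ?G (y + ((of_int k - v \<bullet> (y + b)) / uu) *\<^sub>R u))"
      if "y \<in> int_dual_coset B b" for y
    proof -
      have y: "y \<in> span B" using that by (simp add: int_dual_coset_def)
      have yu: "y \<bullet> u = 0" using pu(2) [rule_format, OF y] by (simp add: inner_commute)
      define \<beta> where "\<beta> = v \<bullet> (y + b)"
      define c where "c = exp (of_real (- pi * (y \<bullet> y) / t) + 2 * pi * \<i> * of_real (y \<bullet> a))"
      have ya1: "y \<bullet> a1 m = y \<bullet> a + of_int m * (y \<bullet> v)" for m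
        unfolding a1_def pu(3) using yu by (simp add: inner_add_right inner_diff_right algebra_simps)
      have "H m y = c * exp (of_real (- pi * (t * uu) * (\<alpha> + of_int m)\<^sup>2) + 2 * pi * \<i> * \<beta> * of_int m)" for m
        unfolding H_def E_def c_def exp_add [symmetric] ya1 \<beta>_def by (simp add: inner_add_right inner_commute algebra_simps)
      then have "(\<Sum>\<^sub>\<infinity>m. H m y) = c * (of_real (1 / sqrt (t * uu)) *
         (\<Sum>\<^sub>\<infinity>k::int. exp (of_real (- pi * (of_int k - \<beta>)\<^sup>2 / (t * uu)) + 2 * pi * \<i> * \<alpha> * (of_int k - \<beta>))))"
        using t uu by (simp only: infsum_cmult_right') (subst poisson_gaussian_int, auto)
      also have "\<dots> = of_real (1 / sqrt (t * uu)) *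
         (\<Sum>\<^sub>\<infinity>k::int. c * exp (of_real (- pi * (of_int k - \<beta>)\<^sup>2 / (t * uu)) + 2 * pi * \<i> * \<alpha> * (of_int k - \<beta>)))"
        by (simp only: infsum_cmult_right' mult.left_commute)
      also note 0 = calculation
      have "c * exp (of_real (- pi * (of_int k - \<beta>)\<^sup>2 / (t * uu)) + 2 * pi * \<i> * \<alpha> * (of_int k - \<beta>)) =
          ?G (y + ((of_int k - v \<bullet> (y + b)) / uu) *\<^sub>R u)" for k :: int
      proof -
        let ?r = "(of_int k - \<beta>) / uu"
        have 1: "(y + ?r *\<^sub>R u) \<bullet> (y + ?r *\<^sub>R u) = y \<bullet> y + (of_int k - \<beta>)\<^sup>2 / uu"
          using norm2 [OF y, of ?r] uu by (simp add: power2_eq_square)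
        have "u \<bullet> a = \<alpha> * uu"
          using pu(2) [rule_format, OF \<alpha>] pu(2) [rule_format, OF pu(1)] unfolding pu(3) uu_def by (simp add: inner_diff_right inner_add_right)
        then have 2: "(y + ?r *\<^sub>R u) \<bullet> a = y \<bullet> a + \<alpha> * (of_int k - \<beta>)"
          using uu by (simp add: inner_add_left)
        have 3: "- pi * (y \<bullet> y + (of_int k - \<beta>)\<^sup>2 / uu) / t = - pi * (y \<bullet> y) / t + - pi * (of_int k - \<beta>)\<^sup>2 / (t * uu)"
          using t uu by (simp add: field_simps)
        show ?thesis
          unfolding \<beta>_def [symmetric] 1 2 3 c_def exp_add [symmetric] of_real_add of_real_mult of_real_diff
          by (intro arg_cong [where f = exp]) (simp only: ring_distribs of_real_of_int_eq mult_ac add_ac)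
      qed
      then show ?thesis unfolding 0 by simp
    qed
    have sumG: "(\<lambda>(y, k::int). ?G (y + ((of_int k - v \<bullet> (y + b)) / uu) *\<^sub>R u)) summable_on int_dual_coset B b \<times> UNIV"
    proof -
      have "?G summable_on int_dual_coset (insert v B) b"
        using t by (intro summable_on_norm_le [OF S2 [of "1 / t"]]) (auto simp: norm_exp_eq_Re)
      then show ?thesis
        by (subst (asm) summable_on_reindex_bij_betw [OF bij2, symmetric]) (simp only: case_prod_unfold)
    qed
    have "infsum ?F (int_span (insert v B)) = (\<Sum>\<^sub>\<infinity>(m::int, x)\<in>UNIV \<times> int_span B. ?F (x + of_int m *\<^sub>R v))"
      by (subst infsum_reindex_bij_betw [OF bij1, symmetric]) (simp only: case_prod_unfold)
    also have "\<dots> = (\<Sum>\<^sub>\<infinity>m::int. \<Sum>\<^sub>\<infinity>x\<in>int_span B. ?F (x + of_int m *\<^sub>R v))"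
      by (rule infsum_Sigma'_banach [OF sumF, symmetric])
    also have "\<dots> = (\<Sum>\<^sub>\<infinity>m::int. \<Sum>\<^sub>\<infinity>x\<in>int_span B. E m * exp (of_real (- pi * t * ((x + a1 m) \<bullet> (x + a1 m))) + 2 * pi * \<i> * of_real (x \<bullet> b)))"
      by (intro infsum_cong Fsplit)
    also have "\<dots> = (\<Sum>\<^sub>\<infinity>m::int. of_real (C * (1 / sqrt t) ^ card B) * (\<Sum>\<^sub>\<infinity>y\<in>int_dual_coset B b. H m y))"
    proof (rule infsum_cong)
      fix m
      show "(\<Sum>\<^sub>\<infinity>x\<in>int_span B. E m * exp (of_real (- pi * t * ((x + a1 m) \<bullet> (x + a1 m))) + 2 * pi * \<i> * of_real (x \<bullet> b))) =
         of_real (C * (1 / sqrt t) ^ card B) * (\<Sum>\<^sub>\<infinity>y\<in>int_dual_coset B b. H m y)"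
        unfolding H_def infsum_cmult_right' IH3 [OF t a1] by (rule mult.left_commute)
    qed
    also have "\<dots> = of_real (C * (1 / sqrt t) ^ card B) * (\<Sum>\<^sub>\<infinity>m::int. \<Sum>\<^sub>\<infinity>y\<in>int_dual_coset B b. H m y)"
      by (rule infsum_cmult_right')
    also have "(\<Sum>\<^sub>\<infinity>m::int. \<Sum>\<^sub>\<infinity>y\<in>int_dual_coset B b. H m y) = (\<Sum>\<^sub>\<infinity>y\<in>int_dual_coset B b. \<Sum>\<^sub>\<infinity>m::int. H m y)"
      by (rule infsum_swap_banach [OF sumH])
    also have "\<dots> = (\<Sum>\<^sub>\<infinity>y\<in>int_dual_coset B b. of_real (1 / sqrt (t * uu)) * (\<Sum>\<^sub>\<infinity>k::int. ?G (y + ((of_int k - v \<bullet> (y + b)) / uu) *\<^sub>R u)))"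
      by (intro infsum_cong inner)
    also have "\<dots> = of_real (1 / sqrt (t * uu)) * (\<Sum>\<^sub>\<infinity>y\<in>int_dual_coset B b. \<Sum>\<^sub>\<infinity>k::int. ?G (y + ((of_int k - v \<bullet> (y + b)) / uu) *\<^sub>R u))"
      by (rule infsum_cmult_right')
    also have "(\<Sum>\<^sub>\<infinity>y\<in>int_dual_coset B b. \<Sum>\<^sub>\<infinity>k::int. ?G (y + ((of_int k - v \<bullet> (y + b)) / uu) *\<^sub>R u)) =
       (\<Sum>\<^sub>\<infinity>(y, k::int)\<in>int_dual_coset B b \<times> UNIV. ?G (y + ((of_int k - v \<bullet> (y + b)) / uu) *\<^sub>R u))"
      by (rule infsum_Sigma'_banach [OF sumG])
    also have "\<dots> = infsum ?G (int_dual_coset (insert v B) b)"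
      by (subst infsum_reindex_bij_betw [OF bij2, symmetric]) (simp only: case_prod_unfold)
    finally have fin: "infsum ?F (int_span (insert v B)) = of_real (C * (1 / sqrt t) ^ card B) *
       (of_real (1 / sqrt (t * uu)) * infsum ?G (int_dual_coset (insert v B) b))" .
    have const: "of_real (C * (1 / sqrt t) ^ card B) * complex_of_real (1 / sqrt (t * uu)) = of_real (C / sqrt uu * (1 / sqrt t) ^ card (insert v B))"
      using insert.hyps by (simp add: real_sqrt_mult)
    show ?thesis
      unfolding fin const [symmetric] by (intro conjI sum1' mult.assoc [symmetric])
  qed
  note main = this
  show ?case
  proof (intro exI [of _ "C / sqrt uu"] conjI allI impI ballI)
    show "C / sqrt uu > 0" using C uu by simp
  qed (use main S2 in \<open>simp_all only:\<close>)
qed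

section \<open>Cusp forms of weight 14\<close>

lemma holomorphic_factor_out_zero:
  assumes "f holomorphic_on S" "open S" "a \<in> S" "f a = 0"
  obtains g where "g holomorphic_on S" "\<And>z. z \<in> S \<Longrightarrow> f z = (z - a) * g z"
proof
  show "(\<lambda>z. if z = a then deriv f a else (f z - f a) / (z - a)) holomorphic_on S"
    using assms by (intro pole_lemma) (auto simp: interior_open)
qed (use assms in auto)

text \<open>The exponent 7 is half of the weight 14. The inequality
  \<open>exp z \<ge> z * exp 1\<close> at \<open>z = 2 * pi * y / 7\<close>, with pi at least 3 and
  e at least 27/10, gives the base 23/10, and 340 lies just below the seventh power of
  23/10.\<close>

lemma gaussian_weight_bound:
  fixes y :: real
  assumes "y \<ge> 1"
  shows "exp (- 2 * pi * y) * y ^ 7 \<le> 1 / 340"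
proof -
  have "1 + (2 * pi * y / 7 - 1) \<le> exp (2 * pi * y / 7 - 1)" by (rule exp_ge_add_one_self)
  then have *: "2 * pi * y / 7 * exp 1 \<le> exp (2 * pi * y / 7)" 
    unfolding exp_diff by (simp add: field_simps)
  have e: "exp 1 \<ge> (27 / 10 :: real)" using e_approx_32 by (simp add: abs_if split: if_splits)
  have "23 / 10 * y \<le> 2 * 3 * y / 7 * (27 / 10)" using assms by simp
  also have "\<dots> \<le> 2 * pi * y / 7 * exp 1"
    using assms pi_gt3 e by (intro mult_mono divide_right_mono) auto
  also note *
  finally have "(23 / 10 * y) ^ 7 \<le> exp (2 * pi * y / 7) ^ 7"
    using assms by (intro power_mono) auto
  also have "\<dots> = exp (2 * pi * y)" by (simp add: exp_of_nat_mult [symmetric])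
  finally have "(23 / 10) ^ 7 * y ^ 7 \<le> exp (2 * pi * y)" by (simp only: power_mult_distrib)
  moreover have "340 * y ^ 7 \<le> (23 / 10) ^ 7 * y ^ 7"
    using assms by (intro mult_right_mono) (auto simp: power_numeral_even power_numeral_odd field_simps)
  ultimately have "340 * y ^ 7 \<le> exp (2 * pi * y)" by (rule order_trans [rotated])
  then show ?thesis by (simp add: exp_minus field_simps)
qed

text \<open>A cusp form \<open>F\<close> of weight 14 vanishes at \<open>\<i>\<close>, so it is divisible by \<open>q (q - exp (- 2 \<pi>))\<close> for
  \<open>q = w\<^sup>2\<close>. The maximum principle on \<open>\<bar>q\<bar> \<le> exp (- \<pi>)\<close>, whose boundary circle comes from
  the line \<open>Im \<tau> = 1/2\<close> that inversion and translation carry into \<open>Im \<tau> \<ge> 1\<close>, shows that the supremum of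
  \<open>\<bar>F \<tau>\<bar> (Im \<tau>)\<^sup>7\<close> over \<open>Im \<tau> \<ge> 1\<close> is at most \<open>256 / (340 (1 - exp (- \<pi>)))\<close> times itself.\<close>

theorem weight14_cusp_form_eq_0:
  fixes \<Phi> :: "complex \<Rightarrow> complex"
  assumes hol: "\<Phi> holomorphic_on ball 0 1" and zero: "\<Phi> 0 = 0"
    and even: "\<And>w. w \<in> ball 0 1 \<Longrightarrow> \<Phi> (- w) = \<Phi> w"
    and inv: "\<And>\<tau>. Im \<tau> > 0 \<Longrightarrow> \<Phi> (exp (pi * \<i> * (- 1 / \<tau>))) = \<tau> ^ 14 * \<Phi> (exp (pi * \<i> * \<tau>))"
    and w: "w \<in> ball 0 1"
  shows "\<Phi> w = 0"
proof -
  define F where "F \<tau> = \<Phi> (exp (pi * \<i> * \<tau>))" for \<tau>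
  have nq: "norm (exp (pi * \<i> * \<tau>)) = exp (- pi * Im \<tau>)" for \<tau> by (simp add: norm_exp_eq_Re)
  have qball: "exp (pi * \<i> * \<tau>) \<in> ball 0 1" if "Im \<tau> > 0" for \<tau>
    using that by (simp add: dist_norm nq)
  define \<kappa> :: real where "\<kappa> = exp (- pi)"
  have \<kappa>: "0 < \<kappa>" "\<kappa> < 1" by (auto simp: \<kappa>_def)
  \<comment> \<open>Numerical input for the last estimate: 256 / 340 / (1 - 1 / 19) is below 9 /
    10.\<close>
  have "19 \<le> (27 / 10 :: real) ^ 3" by (simp add: power3_eq_cube)
  also have "\<dots> \<le> exp 1 ^ 3"
    using e_approx_32 by (intro power_mono) (auto simp: abs_if split: if_splits)
  also have "\<dots> = exp (3::real)" by (simp add: exp_of_nat_mult [symmetric])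
  also have "\<dots> \<le> exp pi" using pi_gt3 by simp
  finally have \<kappa>19: "\<kappa> \<le> 1 / 19" by (simp add: \<kappa>_def exp_minus field_simps)
  have \<kappa>ball: "of_real \<kappa> \<in> ball (0::complex) 1" "- of_real \<kappa> \<in> ball (0::complex) 1"
    using \<kappa> by (auto simp: dist_norm)
  have "\<Phi> (of_real \<kappa>) = 0"
  proof -
    have "complex_of_real pi * \<i> * \<i> = of_real (- pi)" by (simp add: complex_eq_iff)
    then have e: "exp (pi * \<i> * \<i>) = complex_of_real \<kappa>" by (simp only: \<kappa>_def exp_of_real)
    have "\<Phi> (exp (pi * \<i> * (- 1 / \<i>))) = \<i> ^ 14 * \<Phi> (exp (pi * \<i> * \<i>))" by (rule inv) simp
    moreover have "- 1 / \<i> = \<i>" by (simp add: complex_eq_iff)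
    moreover have "\<i> ^ 14 = - 1" by (simp add: power_numeral_even power_numeral_odd)
    ultimately have "\<Phi> (of_real \<kappa>) = - \<Phi> (of_real \<kappa>)" by (simp only: e) simp
    then show ?thesis by simp
  qed
  obtain f1 where f1: "f1 holomorphic_on ball 0 1" "\<And>z. z \<in> ball 0 1 \<Longrightarrow> \<Phi> z = (z - 0) * f1 z"
    using holomorphic_factor_out_zero [OF hol open_ball _ zero] by auto
  \<comment> \<open>The quotient of the even function \<open>\<Phi>\<close> by \<open>z\<close> is
    odd, so it vanishes at 0 by continuity and a second factor \<open>z\<close> splits off.\<close>
  have f1odd: "f1 (- z) = - f1 z" if "z \<in> ball 0 1" "z \<noteq> 0" for z
  proof -
    have "- z \<in> ball 0 1" using that by simp
    then have "- z * f1 (- z) = z * f1 z" using f1(2) [of z] f1(2) [of "- z"] even [of z] that by simp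
    then show ?thesis using that by (metis minus_mult_minus minus_minus mult_left_cancel mult_minus_right)
  qed
  have "f1 0 = 0"
  proof -
    have c: "isCont f1 0"
      using f1(1) by (intro continuous_on_interior [of "ball 0 1"] holomorphic_on_imp_continuous_on) (auto simp: interior_open)
    have m: "((\<lambda>z. - z) \<longlongrightarrow> (0::complex)) (at 0)" using tendsto_minus [OF tendsto_ident_at, of 0] by simp
    have 1: "((\<lambda>z. f1 (- z)) \<longlongrightarrow> f1 0) (at 0)"
      using isCont_tendsto_compose [OF c m] .
    have "((\<lambda>z. - f1 z) \<longlongrightarrow> - f1 0) (at 0)" using c by (intro tendsto_minus) (simp add: isCont_def)
    moreover have "eventually (\<lambda>z. - f1 z = f1 (- z)) (at 0)"
      using f1odd by (auto simp: eventually_at intro!: exI [of _ 1])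
    ultimately have "((\<lambda>z. f1 (- z)) \<longlongrightarrow> - f1 0) (at 0)" by (rule Lim_transform_eventually)
    with 1 have "f1 0 = - f1 0" using LIM_unique by blast
    then show ?thesis by simp
  qed
  then obtain f2 where f2: "f2 holomorphic_on ball 0 1" "\<And>z. z \<in> ball 0 1 \<Longrightarrow> f1 z = (z - 0) * f2 z"
    using holomorphic_factor_out_zero [OF f1(1) open_ball, of 0] by auto
  have \<Phi>2: "\<Phi> z = z\<^sup>2 * f2 z" if "z \<in> ball 0 1" for z
    using f1(2) [OF that] f2(2) [OF that] by (simp add: power2_eq_square)
  have "f2 (of_real \<kappa>) = 0" using \<Phi>2 [OF \<kappa>ball(1)] \<open>\<Phi> (of_real \<kappa>) = 0\<close> \<kappa> by simp
  then obtain f3 where f3: "f3 holomorphic_on ball 0 1" "\<And>z. z \<in> ball 0 1 \<Longrightarrow> f2 z = (z - of_real \<kappa>) * f3 z"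
    using holomorphic_factor_out_zero [OF f2(1) open_ball \<kappa>ball(1)] by auto
  have "f3 (- of_real \<kappa>) = 0"
    using \<Phi>2 [OF \<kappa>ball(2)] f3(2) [OF \<kappa>ball(2)] even [OF \<kappa>ball(1)] \<open>\<Phi> (of_real \<kappa>) = 0\<close> \<kappa> by (simp add: complex_eq_iff)
  then obtain \<Psi> where \<Psi>: "\<Psi> holomorphic_on ball 0 1" "\<And>z. z \<in> ball 0 1 \<Longrightarrow> f3 z = (z - - of_real \<kappa>) * \<Psi> z"
    using holomorphic_factor_out_zero [OF f3(1) open_ball \<kappa>ball(2)] by auto
  have \<Phi>\<Psi>: "\<Phi> z = z\<^sup>2 * (z\<^sup>2 - of_real (\<kappa>\<^sup>2)) * \<Psi> z" if "z \<in> ball 0 1" for z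
    using \<Phi>2 [OF that] f3(2) [OF that] \<Psi>(2) [OF that] by (simp add: power2_eq_square algebra_simps)
  define U where "U = {\<tau>. Im \<tau> \<ge> 1}"
  define G where "G \<tau> = norm (F \<tau>) * Im \<tau> ^ 7" for \<tau>
  have "compact (f2 ` cball 0 \<kappa>)"
    using \<kappa> f2(1) by (intro compact_continuous_image holomorphic_on_imp_continuous_on holomorphic_on_subset [OF f2(1)]) (auto simp: subset_iff)
  then obtain B where B: "\<And>z. z \<in> cball 0 \<kappa> \<Longrightarrow> norm (f2 z) \<le> B"
    using compact_imp_bounded bounded_iff by (metis imageI)
  have qU: "norm (exp (pi * \<i> * \<tau>)) \<le> \<kappa>" if "\<tau> \<in> U" for \<tau>
    using that by (simp add: nq U_def \<kappa>_def)
  have normq2: "norm (exp (pi * \<i> * \<tau>)) ^ 2 = exp (- 2 * pi * Im \<tau>)" for \<tau>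
    unfolding nq by (simp add: exp_of_nat_mult [symmetric])
  have bdd: "bdd_above (G ` U)"
  proof (rule bdd_aboveI2)
    fix \<tau> assume \<tau>: "\<tau> \<in> U"
    have "G \<tau> = (exp (- 2 * pi * Im \<tau>) * Im \<tau> ^ 7) * norm (f2 (exp (pi * \<i> * \<tau>)))"
      using \<Phi>2 [OF qball] \<tau> unfolding G_def F_def by (simp add: U_def norm_mult norm_power normq2 del: norm_exp_eq_Re)
    also have "\<dots> \<le> (1 / 340) * B"
      using \<tau> qU [OF \<tau>] by (intro mult_mono gaussian_weight_bound B) (auto simp: U_def)
    finally show "G \<tau> \<le> (1 / 340) * B" .
  qed
  define M where "M = (SUP \<tau>\<in>U. G \<tau>)"
  have GM: "G \<tau> \<le> M" if "\<tau> \<in> U" for \<tau> unfolding M_def using that bdd by (rule cSUP_upper)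
  have "\<i> \<in> U" by (simp add: U_def)
  have "0 \<le> G \<i>" by (simp add: G_def)
  with GM [OF \<open>\<i> \<in> U\<close>] have M0: "M \<ge> 0" by linarith
  \<comment> \<open>Here the square of \<open>norm \<tau>\<close> is at most 1/2, so inversion leads
    into \<open>U\<close>. In \<open>G (- 1 / \<tau>)\<close> the powers
    \<open>norm \<tau> ^ 14\<close> cancel and \<open>(Im \<tau>) ^ 7 = 1 / 128\<close>
    remains.\<close>
  have half: "norm (F \<tau>) \<le> 128 * M" if "Im \<tau> = 1 / 2" "\<bar>Re \<tau>\<bar> \<le> 1 / 2" for \<tau>
  proof -
    have "\<tau> \<noteq> 0" using that by auto
    have "(Re \<tau>)\<^sup>2 \<le> (1 / 2)\<^sup>2" using that(2) by (metis abs_le_square_iff abs_of_nonneg zero_le_divide_1_iff zero_le_numeral)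
    then have n2: "(norm \<tau>)\<^sup>2 \<le> 1 / 2" unfolding cmod_power2 that(1) by (simp add: power2_eq_square)
    have Im': "Im (- 1 / \<tau>) = Im \<tau> / (norm \<tau>)\<^sup>2" by (simp add: Im_divide cmod_power2)
    have "(norm \<tau>)\<^sup>2 > 0" using \<open>\<tau> \<noteq> 0\<close> by simp
    then have "Im (- 1 / \<tau>) \<ge> 1" unfolding Im' that(1) using n2 by (simp add: field_simps)
    then have "G (- 1 / \<tau>) \<le> M" by (intro GM) (simp add: U_def)
    moreover have "norm (F (- 1 / \<tau>)) = norm \<tau> ^ 14 * norm (F \<tau>)"
      using inv [of \<tau>] that(1) by (simp add: F_def norm_mult norm_power)
    moreover have "norm \<tau> ^ 14 * norm (F \<tau>) * (Im \<tau> / (norm \<tau>)\<^sup>2) ^ 7 = norm (F \<tau>) / 128"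
      unfolding that(1) using \<open>\<tau> \<noteq> 0\<close> by (simp add: power_divide power_mult [symmetric])
    ultimately have "norm (F \<tau>) / 128 \<le> M" unfolding G_def Im' by (simp only:)
    then show ?thesis by simp
  qed
  have circle: "norm (\<Phi> z) \<le> 128 * M" if z: "norm z = exp (- pi / 2)" for z
  proof -
    have "z \<noteq> 0" using z by auto
    define \<tau> where "\<tau> = Ln z / (pi * \<i>)"
    have ez: "exp (pi * \<i> * \<tau>) = z" using \<open>z \<noteq> 0\<close> by (simp add: \<tau>_def)
    have Re: "Re \<tau> = Im (Ln z) / pi" and Im: "Im \<tau> = 1 / 2"
      using \<open>z \<noteq> 0\<close> z by (simp_all add: \<tau>_def Re_divide Im_divide power2_eq_square)
    \<comment> \<open>The logarithm only gives a real part in [-1, 1]. A translation by 1 brings it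
      into [-1/2, 1/2] at the price of replacing \<open>z\<close> by \<open>- z\<close>, which
      \<open>\<Phi>\<close> does not notice.\<close>
    have "\<bar>Re \<tau>\<bar> \<le> 1" using Im_Ln_le_pi [OF \<open>z \<noteq> 0\<close>] mpi_less_Im_Ln [OF \<open>z \<noteq> 0\<close>]
      unfolding Re by (simp add: abs_le_iff field_simps)
    then have "\<bar>Re \<tau>\<bar> \<le> 1 / 2 \<or> \<bar>Re (\<tau> - 1)\<bar> \<le> 1 / 2 \<or> \<bar>Re (\<tau> + 1)\<bar> \<le> 1 / 2"
      by (simp add: abs_if split: if_splits; arith)
    moreover have "Im (\<tau> - 1) = 1 / 2" "Im (\<tau> + 1) = 1 / 2" using Im by simp_all
    ultimately obtain \<sigma> where \<sigma>: "\<bar>Re \<sigma>\<bar> \<le> 1 / 2" "Im \<sigma> = 1 / 2" "\<sigma> = \<tau> \<or> \<sigma> = \<tau> - 1 \<or> \<sigma> = \<tau> + 1"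
      using Im by metis
    have "exp (pi * \<i> * (\<tau> - 1)) = - z" "exp (pi * \<i> * (\<tau> + 1)) = - z"
      using ez by (simp_all add: algebra_simps exp_add exp_diff)
    moreover have "z \<in> ball 0 1" using z by simp
    ultimately have "F \<sigma> = \<Phi> z" using \<sigma>(3) even [of z] ez by (auto simp: F_def)
    then show ?thesis using half [of \<sigma>] \<sigma> by simp
  qed
  have r\<kappa>: "exp (- pi / 2) ^ 2 = \<kappa>" by (simp add: \<kappa>_def exp_of_nat_mult [symmetric])
  have "norm (\<Psi> z) \<le> 128 * M / (\<kappa> * (\<kappa> - \<kappa>\<^sup>2))" if "z \<in> cball 0 (exp (- pi / 2))" for z
  proof (rule maximum_modulus_frontier [where f = \<Psi> and \<xi> = z and S = "cball 0 (exp (- pi / 2))"])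
    have "cball 0 (exp (- pi / 2)) \<subseteq> (ball 0 1 :: complex set)"
      by (intro subsetI) (simp, rule le_less_trans, assumption, simp)
    then have h: "\<Psi> holomorphic_on cball 0 (exp (- pi / 2))" by (rule holomorphic_on_subset [OF \<Psi>(1)])
    then show "\<Psi> holomorphic_on interior (cball 0 (exp (- pi / 2)))"
      using interior_subset by (rule holomorphic_on_subset)
    show "continuous_on (closure (cball 0 (exp (- pi / 2)))) \<Psi>"
      using holomorphic_on_imp_continuous_on [OF h] by simp
    fix z :: complex assume "z \<in> frontier (cball 0 (exp (- pi / 2)))"
    then have nz: "norm z = exp (- pi / 2)" by simp
    then have "z \<in> ball 0 1" by simp
    \<comment> \<open>On this circle the factors divided out of \<open>\<Phi>\<close> have modulus
      at least \<open>\<kappa> * (\<kappa> - \<kappa>\<^sup>2)\<close>.\<close>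
    have n2: "norm (z\<^sup>2) = \<kappa>" by (simp only: norm_power nz r\<kappa>)
    have \<kappa>pos: "\<kappa> * (\<kappa> - \<kappa>\<^sup>2) > 0" using \<kappa> by (simp add: power2_eq_square)
    have "\<kappa> - \<kappa>\<^sup>2 \<le> norm (z\<^sup>2 - of_real (\<kappa>\<^sup>2))"
      using norm_triangle_ineq2 [of "z\<^sup>2" "of_real (\<kappa>\<^sup>2)"] n2 by (simp add: norm_power)
    then have "\<kappa> * (\<kappa> - \<kappa>\<^sup>2) * norm (\<Psi> z) \<le> norm (z\<^sup>2) * norm (z\<^sup>2 - of_real (\<kappa>\<^sup>2)) * norm (\<Psi> z)"
      unfolding n2 using \<kappa> by (intro mult_right_mono mult_left_mono) auto
    also have "\<dots> = norm (\<Phi> z)" using \<Phi>\<Psi> [OF \<open>z \<in> ball 0 1\<close>] by (simp add: norm_mult)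
    also have "\<dots> \<le> 128 * M" by (rule circle [OF nz])
    finally show "norm (\<Psi> z) \<le> 128 * M / (\<kappa> * (\<kappa> - \<kappa>\<^sup>2))"
      using \<kappa>pos by (simp add: pos_le_divide_eq mult.commute)
  qed (use that in auto)
  note \<Psi>le = this
  have small: "G \<tau> \<le> 9 / 10 * M" if \<tau>: "\<tau> \<in> U" for \<tau>
  proof -
    let ?z = "exp (pi * \<i> * \<tau>)"
    have zb: "?z \<in> ball 0 1" using \<tau> by (intro qball) (simp add: U_def)
    have zn: "norm ?z \<le> \<kappa>" by (rule qU [OF \<tau>])
    also have "\<dots> \<le> exp (- pi / 2)" by (simp add: \<kappa>_def)
    finally have zc: "?z \<in> cball 0 (exp (- pi / 2))" by simp
    have "norm (?z\<^sup>2) \<le> \<kappa>\<^sup>2" unfolding norm_power using zn by (intro power_mono) auto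
    then have d: "norm (?z\<^sup>2 - of_real (\<kappa>\<^sup>2)) \<le> 2 * \<kappa>\<^sup>2"
      using norm_triangle_ineq4 [of "?z\<^sup>2" "of_real (\<kappa>\<^sup>2)"] by (simp add: norm_power)
    have "G \<tau> = norm ?z ^ 2 * norm (?z\<^sup>2 - of_real (\<kappa>\<^sup>2)) * norm (\<Psi> ?z) * Im \<tau> ^ 7"
      unfolding G_def F_def \<Phi>\<Psi> [OF zb] norm_mult norm_power ..
    also have "\<dots> = (exp (- 2 * pi * Im \<tau>) * Im \<tau> ^ 7) * (norm (?z\<^sup>2 - of_real (\<kappa>\<^sup>2)) * norm (\<Psi> ?z))"
      unfolding normq2 by (simp only: mult_ac)
    also have "\<dots> \<le> (1 / 340) * ((2 * \<kappa>\<^sup>2) * (128 * M / (\<kappa> * (\<kappa> - \<kappa>\<^sup>2))))"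
      using \<tau> \<kappa> M0 by (intro mult_mono gaussian_weight_bound d \<Psi>le zc) (auto simp: U_def)
    also have "\<dots> = 256 / 340 * M / (1 - \<kappa>)"
      using \<kappa> by (simp add: field_simps power2_eq_square)
    also have "\<dots> \<le> 256 / 340 * M / (1 - 1 / 19)"
      using \<kappa>19 M0 by (intro divide_left_mono) auto
    also have "\<dots> \<le> 9 / 10 * M" using M0 by simp
    finally show ?thesis .
  qed
  then have "M \<le> 9 / 10 * M" unfolding M_def using \<open>\<i> \<in> U\<close> by (intro cSUP_least) (auto simp: M_def)
  then have "M = 0" using M0 by simp
  \<comment> \<open>With \<open>M = 0\<close> the function vanishes on a whole circle, and the
    identity theorem applies at any of its points.\<close>
  have van: "\<Phi> z = 0" if z: "norm z = exp (- pi / 2)" for z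
    using circle [OF z] \<open>M = 0\<close> by simp
  show ?thesis
  proof (rule analytic_continuation [OF hol open_ball convex_connected [OF convex_ball], of "sphere 0 (exp (- pi / 2))" "of_real (exp (- pi / 2))"])
    show "sphere 0 (exp (- pi / 2)) \<subseteq> (ball 0 1 :: complex set)" by auto
    show "of_real (exp (- pi / 2)) islimpt (sphere 0 (exp (- pi / 2)) :: complex set)"
    proof (rule connected_imp_perfect)
      show "connected (sphere 0 (exp (- pi / 2)) :: complex set)" by (simp add: connected_sphere)
    next
      have "of_real (exp (- pi / 2)) \<in> (sphere 0 (exp (- pi / 2)) :: complex set)"
        "- of_real (exp (- pi / 2)) \<in> (sphere 0 (exp (- pi / 2)) :: complex set)" by auto
      moreover have "complex_of_real (exp (- pi / 2)) \<noteq> - of_real (exp (- pi / 2))" by (simp add: complex_eq_iff)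
      ultimately show "(sphere 0 (exp (- pi / 2)) :: complex set) \<noteq> {a}" for a by (metis singletonD)
    qed auto
  qed (use w van in auto)
qed

section \<open>Theta functions\<close>

text \<open>Norm function, coefficients and index set are separate arguments, so that lattices,
  shadows, harmonic coefficients and the Jacobi theta constants are all instances. An element with
  \<open>\<nu> x = 1\<close> contributes the first power of
  \<open>exp (pi * \<i> * \<tau>)\<close>.\<close>

definition theta :: "('a \<Rightarrow> real) \<Rightarrow> ('a \<Rightarrow> complex) \<Rightarrow> 'a set \<Rightarrow> complex \<Rightarrow> complex" where
  "theta \<nu> c X \<tau> = (\<Sum>\<^sub>\<infinity>x\<in>X. c x * exp (pi * \<i> * \<tau> * \<nu> x))"

text \<open>Absolute convergence on every line \<open>Im \<tau> = r\<close>. For nonnegative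
  \<open>\<nu>\<close> the line dominates the half-plane above it, which makes the convergence
  locally uniform.\<close>

definition theta_summable :: "('a \<Rightarrow> real) \<Rightarrow> ('a \<Rightarrow> complex) \<Rightarrow> 'a set \<Rightarrow> bool" where
  "theta_summable \<nu> c X \<longleftrightarrow> (\<forall>r>0. (\<lambda>x. norm (c x) * exp (- pi * r * \<nu> x)) summable_on X)"

lemma theta_summableD:
  assumes "theta_summable \<nu> c X" "r > 0"
  shows "(\<lambda>x. norm (c x) * exp (- pi * r * \<nu> x)) summable_on X"
  using assms by (simp add: theta_summable_def)

lemma norm_theta_term: "norm (c * exp (pi * \<i> * \<tau> * of_real v)) = norm c * exp (- pi * Im \<tau> * v)"
proof -
  have "Re (pi * \<i> * \<tau> * of_real v) = - pi * Im \<tau> * v" by simp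
  then show ?thesis by (simp only: norm_mult norm_exp_eq_Re)
qed

lemma theta_summable_imp_summable_on:
  assumes "theta_summable \<nu> c X" "Im \<tau> > 0"
  shows "(\<lambda>x. c x * exp (pi * \<i> * \<tau> * \<nu> x)) summable_on X"
proof (rule summable_on_norm_le)
  show "(\<lambda>x. norm (c x) * exp (- pi * Im \<tau> * \<nu> x)) summable_on X"
    using assms by (simp add: theta_summable_def)
qed (simp only: norm_theta_term order_refl)

lemma theta_summable_subset:
  assumes "theta_summable \<nu> c X" "Y \<subseteq> X" shows "theta_summable \<nu> c Y"
  using assms summable_on_subset unfolding theta_summable_def by blast

text \<open>Half of the exponential decay absorbs the factor \<open>1 + \<nu> x\<close>, by
  \<open>exp z \<ge> 1 + z\<close>. This admits coefficients that are quadratic in a lattice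
  vector.\<close>

lemma theta_summable_mono:
  assumes "theta_summable \<nu> (\<lambda>_. 1) X" and "\<And>x. x \<in> X \<Longrightarrow> \<nu> x \<ge> 0" and "\<And>x. x \<in> X \<Longrightarrow> norm (c x) \<le> K * (1 + \<nu> x)"
  shows "theta_summable \<nu> c X"
  unfolding theta_summable_def
proof (intro allI impI)
  fix r :: real assume r: "r > 0"
  \<comment> \<open>The least constant with \<open>1 \<le> A\<close> and
    \<open>1 \<le> A * (pi * r / 2)\<close>, hence
    \<open>1 + \<nu> x \<le> A * (1 + pi * (r / 2) * \<nu> x)\<close>.\<close>
  define A where "A = max 1 (2 / (pi * r))"
  have "2 / (pi * r) * (pi * r / 2) \<le> A * (pi * r / 2)"
    using r by (intro mult_right_mono) (auto simp: A_def)
  then have A: "1 \<le> A" "1 \<le> A * (pi * r / 2)" using r by (auto simp: A_def)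
  have sm: "(\<lambda>x. \<bar>K\<bar> * A * exp (- pi * (r / 2) * \<nu> x)) summable_on X"
    using theta_summableD [OF assms(1), of "r / 2"] r by (intro summable_on_cmult_right) simp
  show "(\<lambda>x. norm (c x) * exp (- pi * r * \<nu> x)) summable_on X"
  proof (rule summable_on_comparison_test [OF sm])
    fix x assume x: "x \<in> X"
    have "1 + \<nu> x \<le> A * 1 + (A * (pi * r / 2)) * \<nu> x"
      using mult_right_mono [OF A(2) assms(2) [OF x]] A(1) by linarith
    also have "\<dots> = A * (1 + pi * (r / 2) * \<nu> x)" by (simp add: algebra_simps)
    also have "\<dots> \<le> A * exp (pi * (r / 2) * \<nu> x)" using A by (intro mult_left_mono exp_ge_add_one_self) auto
    finally have 1: "1 + \<nu> x \<le> A * exp (pi * (r / 2) * \<nu> x)" .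
    have "norm (c x) \<le> \<bar>K\<bar> * (1 + \<nu> x)"
      using assms(2) [OF x] by (intro order_trans [OF assms(3) [OF x]] mult_right_mono) auto
    also have "\<dots> \<le> \<bar>K\<bar> * (A * exp (pi * (r / 2) * \<nu> x))" using 1 by (intro mult_left_mono) auto
    finally have "norm (c x) * exp (- pi * r * \<nu> x) \<le> \<bar>K\<bar> * (A * exp (pi * (r / 2) * \<nu> x)) * exp (- pi * r * \<nu> x)"
      by (rule mult_right_mono) simp
    also have "\<dots> = \<bar>K\<bar> * A * exp (- pi * (r / 2) * \<nu> x)"
    proof -
      have "exp (pi * (r / 2) * \<nu> x) * exp (- pi * r * \<nu> x) = exp (- pi * (r / 2) * \<nu> x)"
        unfolding exp_add [symmetric] by (simp add: field_simps)
      then show ?thesis by (simp only: mult.assoc)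
    qed
    finally show "norm (c x) * exp (- pi * r * \<nu> x) \<le> \<bar>K\<bar> * A * exp (- pi * (r / 2) * \<nu> x)" .
  qed auto
qed

lemma theta_holomorphic:
  assumes s: "theta_summable \<nu> c X" and \<nu>: "\<And>x. x \<in> X \<Longrightarrow> \<nu> x \<ge> 0"
  shows "theta \<nu> c X holomorphic_on {\<tau>. Im \<tau> > 0}"
proof -
  have "theta \<nu> c X field_differentiable at z" if z: "Im z > 0" for z
  proof -
    define r where "r = Im z / 2"
    have r: "r > 0" using z by (simp add: r_def)
    have Im: "Im \<tau> \<ge> r" if "\<tau> \<in> cball z r" for \<tau>
      using that abs_Im_le_cmod [of "z - \<tau>"] by (simp add: dist_norm r_def)
    have u: "uniform_limit (cball z r) (\<lambda>Y \<tau>. \<Sum>x\<in>Y. c x * exp (pi * \<i> * \<tau> * \<nu> x))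
        (\<lambda>\<tau>. \<Sum>\<^sub>\<infinity>x\<in>X. c x * exp (pi * \<i> * \<tau> * \<nu> x)) (finite_subsets_at_top X)"
    proof (rule Weierstrass_m_test_general)
      show "(\<lambda>x. norm (c x) * exp (- pi * r * \<nu> x)) summable_on X"
        using s r by (simp add: theta_summable_def)
      show "norm (c x * exp (pi * \<i> * \<tau> * \<nu> x)) \<le> norm (c x) * exp (- pi * r * \<nu> x)" if "x \<in> X" "\<tau> \<in> cball z r" for x \<tau>
        unfolding norm_theta_term using Im [OF that(2)] \<nu> [OF that(1)] by (intro mult_left_mono) (auto intro: mult_right_mono)
    qed
    have "(\<lambda>\<tau>. \<Sum>\<^sub>\<infinity>x\<in>X. c x * exp (pi * \<i> * \<tau> * \<nu> x)) holomorphic_on ball z r"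
      by (rule holomorphic_uniform_limit [OF _ u]) (auto intro!: always_eventually continuous_intros holomorphic_intros)
    then have "theta \<nu> c X holomorphic_on ball z r" unfolding theta_def [abs_def] .
    then show ?thesis using r holomorphic_on_imp_differentiable_at [of _ "ball z r" z] by simp
  qed
  then show ?thesis by (auto simp: holomorphic_on_def intro: field_differentiable_at_within)
qed

text \<open>The identity theorem along the imaginary axis, the only place that Poisson summation for
  real Gaussians reaches.\<close>

lemma upper_half_plane_eqI:
  assumes "f holomorphic_on {\<tau>. Im \<tau> > 0}" "g holomorphic_on {\<tau>. Im \<tau> > 0}"
    and eq: "\<And>t. t > 0 \<Longrightarrow> f (\<i> * of_real t) = g (\<i> * of_real t)" and \<tau>: "Im \<tau> > 0"
  shows "f \<tau> = g \<tau>"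
proof -
  let ?U = "(\<lambda>t. \<i> * complex_of_real t) ` {0<..}"
  have "(\<lambda>z. f z - g z) \<tau> = 0"
  proof (rule analytic_continuation [where f = "\<lambda>z. f z - g z" and S = "{\<tau>. Im \<tau> > 0}" and U = ?U and \<xi> = \<i>])
    show "(\<lambda>z. f z - g z) holomorphic_on {\<tau>. Im \<tau> > 0}" by (intro holomorphic_intros assms)
    show "open {\<tau>. Im \<tau> > 0}" by (rule open_halfspace_Im_gt)
    show "connected {\<tau>. Im \<tau> > 0}" by (intro convex_connected convex_halfspace_Im_gt)
    show "\<i> islimpt ?U"
    proof (rule connected_imp_perfect)
      show "connected ?U" by (intro connected_continuous_image continuous_intros) (simp add: connected_Ioi)
      show "\<i> \<in> ?U" by (rule image_eqI [of _ _ 1]) auto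
      have "\<i> * of_real 1 \<in> ?U" "\<i> * of_real 2 \<in> ?U" by (intro imageI; simp)+
      moreover have "\<i> * complex_of_real 1 \<noteq> \<i> * of_real 2" by simp
      ultimately show "?U \<noteq> {x}" for x by (metis (no_types) singletonD)
    qed
  qed (use eq \<tau> in auto)
  then show ?thesis by simp
qed

lemma Im_inversion_pos: "Im \<tau> > 0 \<Longrightarrow> Im (- 1 / \<tau>) > 0"
  by (auto simp: Im_divide sum_power2_gt_zero_iff intro!: divide_pos_pos)

text \<open>On the imaginary axis inversion is \<open>t \<mapsto> 1 / t\<close>, the substitution
  that Poisson summation provides; the factor \<open>(\<i> * of_real t) ^ n\<close> is the value of
  \<open>\<tau> ^ n\<close> there.\<close>

lemma theta_inversion_continuation:
  assumes f: "f holomorphic_on {\<tau>. Im \<tau> > 0}" and g: "g holomorphic_on {\<tau>. Im \<tau> > 0}"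
    and eq: "\<And>t. t > 0 \<Longrightarrow> g (\<i> * of_real (1 / t)) = k * (\<i> * of_real t) ^ n * f (\<i> * of_real t)" and \<tau>: "Im \<tau> > 0"
  shows "g (- 1 / \<tau>) = k * \<tau> ^ n * f \<tau>"
proof (rule upper_half_plane_eqI [where f = "\<lambda>\<tau>. g (- 1 / \<tau>)" and g = "\<lambda>\<tau>. k * \<tau> ^ n * f \<tau>"])
  show "(\<lambda>\<tau>. g (- 1 / \<tau>)) holomorphic_on {\<tau>. Im \<tau> > 0}"
    by (intro holomorphic_on_compose_gen [OF _ g, unfolded o_def] holomorphic_intros) (auto dest: Im_inversion_pos)
  show "g (- 1 / (\<i> * of_real t)) = k * (\<i> * of_real t) ^ n * f (\<i> * of_real t)" if "t > 0" for t
  proof -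
    have "- 1 / (\<i> * of_real t) = \<i> * of_real (1 / t)" using that by (simp add: complex_eq_iff Re_divide Im_divide power2_eq_square)
    then show ?thesis using eq [OF that] by (simp only:)
  qed
qed (use \<tau> in \<open>auto intro!: holomorphic_intros f\<close>)

lemma theta_imaginary_axis: "theta \<nu> c X (\<i> * of_real t) = (\<Sum>\<^sub>\<infinity>x\<in>X. c x * of_real (exp (- pi * t * \<nu> x)))"
proof -
  have "pi * \<i> * (\<i> * of_real t) * \<nu> x = complex_of_real (- pi * t * \<nu> x)" for x by (simp add: complex_eq_iff)
  then show ?thesis unfolding theta_def by (simp only: exp_of_real)
qed

section \<open>Power series of theta functions with norms in the natural numbers\<close>

definition theta_coeff :: "('a \<Rightarrow> nat) \<Rightarrow> ('a \<Rightarrow> complex) \<Rightarrow> 'a set \<Rightarrow> nat \<Rightarrow> complex" where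
  "theta_coeff n c X k = (\<Sum>\<^sub>\<infinity>x\<in>{x \<in> X. n x = k}. c x)"

text \<open>The theta function in the variable \<open>w = exp (pi * \<i> * \<tau>)\<close>, which is
  now also defined at \<open>w = 0\<close>, the cusp.\<close>

definition theta_series :: "('a \<Rightarrow> nat) \<Rightarrow> ('a \<Rightarrow> complex) \<Rightarrow> 'a set \<Rightarrow> complex \<Rightarrow> complex" where
  "theta_series n c X w = (\<Sum>\<^sub>\<infinity>x\<in>X. c x * w ^ n x)"

lemma theta_series_exp:
  assumes "\<And>x. x \<in> X \<Longrightarrow> \<nu> x = real (n x)"
  shows "theta_series n c X (exp (pi * \<i> * \<tau>)) = theta \<nu> c X \<tau>"
  unfolding theta_series_def theta_def using assms
  by (intro infsum_cong) (simp add: exp_of_nat_mult [symmetric] mult.commute)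

text \<open>Grouping the elements of \<open>X\<close> by \<open>n\<close> gives a power series. The
  radius \<open>r\<close> corresponds to the height \<open>- ln r / pi\<close> in the upper
  half-plane, where summability is known.\<close>

lemma theta_series_sums:
  assumes s: "theta_summable \<nu> c X" and \<nu>: "\<And>x. x \<in> X \<Longrightarrow> \<nu> x = real (n x)" and w: "norm w < 1"
  shows "(\<lambda>k. theta_coeff n c X k * w ^ k) sums theta_series n c X w"
proof -
  define r where "r = (norm w + 1) / 2"
  have r: "0 < r" "r < 1" "norm w \<le> r" using w by (auto simp: r_def add_nonneg_pos)
  have "(\<lambda>x. norm (c x) * exp (- pi * (- ln r / pi) * \<nu> x)) summable_on X"
    using r by (intro theta_summableD s) (simp add: divide_neg_pos)
  moreover have "exp (- pi * (- ln r / pi) * \<nu> x) = r ^ n x" if "x \<in> X" for x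
    using r \<nu> [OF that] by (simp add: powr_realpow [symmetric] powr_def mult.commute)
  ultimately have "(\<lambda>x. norm (c x) * r ^ n x) summable_on X"
    by (subst (asm) summable_on_cong [where g = "\<lambda>x. norm (c x) * r ^ n x"]) auto
  then have sm: "(\<lambda>x. c x * w ^ n x) summable_on X"
    by (rule summable_on_norm_le) (use r in \<open>auto simp: norm_mult norm_power intro!: mult_left_mono power_mono\<close>)
  have bij: "bij_betw snd (Sigma UNIV (\<lambda>k. {x \<in> X. n x = k})) X"
    by (auto simp: bij_betw_def inj_on_def image_iff)
  have "((\<lambda>x. c x * w ^ n x) has_sum theta_series n c X w) X"
    using sm by (simp add: theta_series_def)
  then have "((\<lambda>p. c (snd p) * w ^ n (snd p)) has_sum theta_series n c X w) (Sigma UNIV (\<lambda>k. {x \<in> X. n x = k}))"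
    by (subst has_sum_reindex_bij_betw [OF bij, where f = "\<lambda>x. c x * w ^ n x"])
  then have "((\<lambda>k. theta_coeff n c X k * w ^ k) has_sum theta_series n c X w) UNIV"
  proof (rule has_sum_Sigma')
    fix k
    have "((\<lambda>x. c x * w ^ n x) has_sum infsum (\<lambda>x. c x * w ^ n x) {x \<in> X. n x = k}) {x \<in> X. n x = k}"
      using sm by (intro has_sum_infsum) (rule summable_on_subset, auto)
    moreover have "infsum (\<lambda>x. c x * w ^ n x) {x \<in> X. n x = k} = infsum (\<lambda>x. c x * w ^ k) {x \<in> X. n x = k}"
      by (intro infsum_cong) auto
    ultimately show "((\<lambda>x. c (snd (k, x)) * w ^ n (snd (k, x))) has_sum theta_coeff n c X k * w ^ k) {x \<in> X. n x = k}"
      by (simp add: theta_coeff_def infsum_cmult_left')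
  qed
  then show ?thesis by (rule has_sum_imp_sums)
qed

lemma theta_series_fps:
  assumes s: "theta_summable \<nu> c X" and \<nu>: "\<And>x. x \<in> X \<Longrightarrow> \<nu> x = real (n x)"
  shows "theta_series n c X has_fps_expansion Abs_fps (theta_coeff n c X)"
    and "theta_series n c X holomorphic_on ball 0 1"
proof -
  let ?F = "Abs_fps (theta_coeff n c X)"
  have R: "fps_conv_radius ?F \<ge> 1"
    unfolding fps_conv_radius_def
  proof (rule conv_radius_geI_ex')
    fix r :: real assume "0 < r" "ereal r < 1"
    then show "summable (\<lambda>k. fps_nth ?F k * of_real r ^ k)"
      using theta_series_sums [OF s \<nu>, of "of_real r"] by (auto simp: sums_iff)
  qed
  have eq: "eval_fps ?F w = theta_series n c X w" if "w \<in> ball 0 1" for w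
    using theta_series_sums [OF s \<nu>, of w] that by (simp add: eval_fps_def sums_iff)
  have "eval_fps ?F holomorphic_on ball 0 1"
  proof (intro holomorphic_on_eval_fps subsetI)
    fix w :: complex assume "w \<in> ball 0 1"
    then have "ereal (norm w) < 1" by (simp add: one_ereal_def)
    from less_le_trans [OF this R] show "w \<in> eball 0 (fps_conv_radius ?F)" by (simp add: in_eball_iff)
  qed
  then show "theta_series n c X holomorphic_on ball 0 1"
    by (rule holomorphic_transform) (rule eq)
  have "eventually (\<lambda>w. w \<in> ball 0 1) (nhds (0::complex))" by (intro eventually_nhds_in_open) auto
  then show "theta_series n c X has_fps_expansion ?F"
    unfolding has_fps_expansion_def
    by (intro conjI less_le_trans [OF _ R]) (simp, erule eventually_mono, rule eq)
qed

text \<open>Every element of the shell contributes the same positive term to a convergent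
  series.\<close>

lemma theta_summable_finite_shell:
  assumes "theta_summable \<nu> (\<lambda>_. 1) X"
  shows "finite {x \<in> X. \<nu> x = k}"
proof (rule ccontr)
  assume inf: "infinite {x \<in> X. \<nu> x = k}"
  have "(\<lambda>x. norm (1::complex) * exp (- pi * 1 * \<nu> x)) summable_on {x \<in> X. \<nu> x = k}"
    by (rule summable_on_subset [OF theta_summableD [OF assms zero_less_one]]) blast
  moreover have "(\<lambda>x. norm (1::complex) * exp (- pi * 1 * \<nu> x)) summable_on {x \<in> X. \<nu> x = k} \<longleftrightarrow> (\<lambda>x. exp (- pi * k)) summable_on {x \<in> X. \<nu> x = k}"
    by (rule summable_on_cong) simp
  ultimately show False using infsum_diverge_constant [OF inf exp_not_eq_zero] by blast
qed

section \<open>Selfdual lattices\<close>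

lemma lattice24_int_span:
  assumes "lattice24 L"
  obtains B where "finite B" "independent B" "card B = 24" "span B = UNIV" "L = int_span B"
proof -
  obtain b :: "24 \<Rightarrow> vec24" where b: "inj b" "independent (range b)"
    and L: "L = {(\<Sum>i\<in>UNIV. of_int (c i) *\<^sub>R b i) | c :: 24 \<Rightarrow> int. True}"
    using assms unfolding lattice24_def by (elim exE conjE) (rule that)
  have card: "card (range b) = 24" using b(1) by (simp add: card_image)
  have "UNIV \<subseteq> span (range b)"
    by (rule card_ge_dim_independent) (use b(2) card in simp_all)
  then have sp: "span (range b) = UNIV" by (rule top.extremum_uniqueI)
  have "L = int_span (range b)"
  proof (intro equalityI subsetI)
    fix x assume "x \<in> L"
    then obtain c :: "24 \<Rightarrow> int" where "x = (\<Sum>i\<in>UNIV. of_int (c i) *\<^sub>R b i)" using L by blast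
    then have "x = (\<Sum>v\<in>range b. of_int (c (inv b v)) *\<^sub>R v)"
      using b(1) by (simp add: sum.reindex)
    then show "x \<in> int_span (range b)" unfolding int_span_def mem_Collect_eq by (intro exI conjI TrueI)
  next
    fix x assume "x \<in> int_span (range b)"
    then obtain c :: "vec24 \<Rightarrow> int" where "x = (\<Sum>v\<in>range b. of_int (c v) *\<^sub>R v)" unfolding int_span_def by blast
    then have "x = (\<Sum>i\<in>UNIV. of_int (c (b i)) *\<^sub>R b i)"
      using b(1) by (simp add: sum.reindex)
    then show "x \<in> L" unfolding L mem_Collect_eq by (intro exI conjI TrueI)
  qed
  then show thesis by (intro that [OF _ b(2) card sp]) simp_all
qed

lemma int_span_base:
  assumes "finite B" "b \<in> B" shows "b \<in> int_span B"
proof -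
  have "b = (\<Sum>v\<in>B. if v = b then v else 0)" using assms by (simp add: sum.delta)
  also have "\<dots> = (\<Sum>v\<in>B. of_int (if v = b then 1 else 0) *\<^sub>R v)" by (intro sum.cong) auto
  finally have "b = (\<Sum>v\<in>B. of_int (if v = b then 1 else 0) *\<^sub>R v)" .
  then show ?thesis unfolding int_span_def mem_Collect_eq by (intro exI conjI TrueI)
qed

text \<open>Integrality against a basis extends to its integer span, and the dual of that span is
  the lattice itself.\<close>

lemma selfdual_int_dual_coset:
  assumes "selfdual (int_span B)" "finite B" "span B = UNIV"
  shows "int_dual_coset B b = {y. y + b \<in> int_span B}"
proof -
  have d: "dual_set (int_span B) = int_span B" using assms by (simp add: selfdual_def)
  have "(\<forall>x\<in>B. (y + b) \<bullet> x \<in> \<int>) \<longleftrightarrow> y + b \<in> dual_set (int_span B)" for y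
  proof
    assume *: "\<forall>x\<in>B. (y + b) \<bullet> x \<in> \<int>"
    have "(\<Sum>v\<in>B. of_int (c v) *\<^sub>R v) \<bullet> (y + b) \<in> \<int>" for c :: "vec24 \<Rightarrow> int"
      unfolding inner_sum_left inner_scaleR_left using *
      by (intro Ints_sum Ints_mult Ints_of_int) (simp add: inner_commute)
    then show "y + b \<in> dual_set (int_span B)" by (auto simp: dual_set_def int_span_def)
  next
    assume "y + b \<in> dual_set (int_span B)"
    then show "\<forall>x\<in>B. (y + b) \<bullet> x \<in> \<int>" using int_span_base [OF assms(2)] by (auto simp: dual_set_def inner_commute)
  qed
  then show ?thesis using assms(3) d by (auto simp: int_dual_coset_def)
qed

text \<open>The constant \<open>C\<close> is found without computing a determinant: at
  \<open>t = 1\<close> with zero shifts both sides contain the same positive number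
  \<open>\<theta>\<close>, so \<open>C = 1\<close>. The exponent 12 comes from
  \<open>sqrt t ^ 24\<close>.\<close>

theorem poisson_selfdual:
  assumes L: "selfdual L" and t: "t > 0"
  shows "(\<lambda>x. exp (- pi * t * ((x + a) \<bullet> (x + a)))) summable_on L"
    and "(\<Sum>\<^sub>\<infinity>x\<in>L. exp (of_real (- pi * t * ((x + a) \<bullet> (x + a))) + 2 * pi * \<i> * of_real (x \<bullet> b))) =
       of_real (1 / t ^ 12) * (\<Sum>\<^sub>\<infinity>y\<in>L. exp (of_real (- pi * ((y - b) \<bullet> (y - b)) / t) + 2 * pi * \<i> * of_real ((y - b) \<bullet> a)))"
proof -
  have "lattice24 L" using L by (simp add: selfdual_def integral_lattice_def)
  then obtain B where B: "finite B" "independent B" "card B = 24" "span B = UNIV" "L = int_span B"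
    by (rule lattice24_int_span)
  note coset = selfdual_int_dual_coset [OF L [unfolded B(5)] B(1,4), folded B(5)]
  obtain C where C: "C > 0" and all: "\<forall>t>0.
    (\<forall>a\<in>UNIV. (\<lambda>x. exp (- pi * t * ((x + a) \<bullet> (x + a)))) summable_on L) \<and>
    (\<forall>b. (\<lambda>y. exp (- pi * t * (y \<bullet> y))) summable_on {y. y + b \<in> L}) \<and>
    (\<forall>a\<in>UNIV. \<forall>b. (\<Sum>\<^sub>\<infinity>x\<in>L. exp (of_real (- pi * t * ((x + a) \<bullet> (x + a))) + 2 * pi * \<i> * of_real (x \<bullet> b))) =
       of_real (C * (1 / sqrt t) ^ 24) *
       (\<Sum>\<^sub>\<infinity>y\<in>{y. y + b \<in> L}. exp (of_real (- pi * (y \<bullet> y) / t) + 2 * pi * \<i> * of_real (y \<bullet> a))))"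
    using poisson_gaussian_span [OF B(1,2)] unfolding B(3,4) B(5) [symmetric] coset by (elim exE conjE)
  have S: "(\<lambda>x. exp (- pi * t * ((x + a) \<bullet> (x + a)))) summable_on L" if "t > 0" for t a
    by (rule bspec [OF conjunct1 [OF all [THEN spec, THEN mp, OF that]] UNIV_I])
  have P: "(\<Sum>\<^sub>\<infinity>x\<in>L. exp (of_real (- pi * t * ((x + a) \<bullet> (x + a))) + 2 * pi * \<i> * of_real (x \<bullet> b))) =
       of_real (C * (1 / sqrt t) ^ 24) *
       (\<Sum>\<^sub>\<infinity>y\<in>{y. y + b \<in> L}. exp (of_real (- pi * (y \<bullet> y) / t) + 2 * pi * \<i> * of_real (y \<bullet> a)))" if "t > 0" for t a b
    by (rule spec [OF bspec [OF conjunct2 [OF conjunct2 [OF all [THEN spec, THEN mp, OF that]]] UNIV_I]])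
  have shift: "(\<Sum>\<^sub>\<infinity>y\<in>{y. y + b \<in> L}. f y) = (\<Sum>\<^sub>\<infinity>y\<in>L. f (y - b))" for f :: "vec24 \<Rightarrow> complex" and b
    by (rule infsum_reindex_bij_witness [of _ "\<lambda>y. y - b" "\<lambda>y. y + b"]) auto
  show "(\<lambda>x. exp (- pi * t * ((x + a) \<bullet> (x + a)))) summable_on L" by (rule S [OF t])
  have S0: "(\<lambda>x. exp (- pi * 1 * (x \<bullet> x))) summable_on L" using S [of 1 0] by simp
  define \<theta> where "\<theta> = (\<Sum>\<^sub>\<infinity>x\<in>L. exp (- pi * 1 * (x \<bullet> x)))"
  have c\<theta>: "complex_of_real \<theta> = (\<Sum>\<^sub>\<infinity>x\<in>L. exp (of_real (- pi * 1 * (x \<bullet> x))))"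
    unfolding \<theta>_def exp_of_real by (rule infsumI [OF has_sum_of_real [OF has_sum_infsum [OF S0]], symmetric])
  have "complex_of_real \<theta> = of_real C * of_real \<theta>"
    using P [of 1 0 0] unfolding c\<theta> by (simp only: add_0_right inner_zero_right of_real_0 mult_zero_right
        real_sqrt_one power_one div_by_1 mult_1_right Collect_mem_eq zero_less_one mult_minus_left)
  then have "\<theta> = C * \<theta>" by (metis of_real_eq_iff of_real_mult)
  moreover have "0 \<in> L" using L by (auto simp: selfdual_def dual_set_def)
  then have "\<theta> \<ge> exp (- pi * 1 * ((0::vec24) \<bullet> 0))"
    unfolding \<theta>_def using infsum_mono_neutral [of "\<lambda>x. exp (- pi * 1 * (x \<bullet> x))" "{0}" "\<lambda>x. exp (- pi * 1 * (x \<bullet> x))" L] S0 by auto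
  ultimately have "C = 1" by simp
  moreover have "(1 / sqrt t) ^ 24 = 1 / t ^ 12"
    using t power_mult [of "sqrt t" 2 12] by (simp add: power_divide)
  ultimately show "(\<Sum>\<^sub>\<infinity>x\<in>L. exp (of_real (- pi * t * ((x + a) \<bullet> (x + a))) + 2 * pi * \<i> * of_real (x \<bullet> b))) =
       of_real (1 / t ^ 12) * (\<Sum>\<^sub>\<infinity>y\<in>L. exp (of_real (- pi * ((y - b) \<bullet> (y - b)) / t) + 2 * pi * \<i> * of_real ((y - b) \<bullet> a)))"
    unfolding P [OF t] shift by simp
qed

lemma half_not_Ints: "(1 / 2 :: real) \<notin> \<int>"
proof
  assume "(1 / 2 :: real) \<in> \<int>"
  then obtain k where "1 / 2 = real_of_int k" by (auto elim: Ints_cases)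
  then have "real_of_int (2 * k) = real_of_int 1" by simp
  then have "2 * k = 1" by (simp only: of_int_eq_iff)
  then show False by presburger
qed

section \<open>Parity of norms in an odd selfdual lattice\<close>

locale odd_selfdual =
  fixes \<Lambda> :: "vec24 set"
  assumes selfdual: "selfdual \<Lambda>" and odd: "odd_lattice \<Lambda>"
begin

lemma dual: "y \<in> \<Lambda> \<longleftrightarrow> (\<forall>x\<in>\<Lambda>. x \<bullet> y \<in> \<int>)"
proof -
  have "y \<in> \<Lambda> \<longleftrightarrow> y \<in> dual_set \<Lambda>" using selfdual by (simp add: selfdual_def)
  then show ?thesis by (simp add: dual_set_def)
qed

lemma inner_Ints: "x \<in> \<Lambda> \<Longrightarrow> y \<in> \<Lambda> \<Longrightarrow> x \<bullet> y \<in> \<int>"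
  using dual [of y] by blast

lemma zero_mem: "0 \<in> \<Lambda>" by (subst dual) simp

lemma add_mem: "x \<in> \<Lambda> \<Longrightarrow> y \<in> \<Lambda> \<Longrightarrow> x + y \<in> \<Lambda>"
  by (subst dual) (auto simp: inner_add_right inner_Ints)

lemma scale_mem: "x \<in> \<Lambda> \<Longrightarrow> k \<in> \<int> \<Longrightarrow> k *\<^sub>R x \<in> \<Lambda>"
  by (subst dual) (auto simp: inner_Ints)

lemma uminus_mem: "x \<in> \<Lambda> \<Longrightarrow> - x \<in> \<Lambda>"
  using scale_mem [of x "-1"] by simp

lemma even_part_iff: "x \<in> even_part \<Lambda> \<longleftrightarrow> x \<in> \<Lambda> \<and> x \<bullet> x / 2 \<in> \<int>"
proof -
  have "(\<exists>k. x \<bullet> x = real_of_int k \<and> even k) \<longleftrightarrow> x \<bullet> x / 2 \<in> \<int>"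
  proof
    assume "\<exists>k. x \<bullet> x = real_of_int k \<and> even k"
    then obtain m where "x \<bullet> x = real_of_int (2 * m)" by (auto elim: evenE)
    then show "x \<bullet> x / 2 \<in> \<int>" by simp
  next
    assume "x \<bullet> x / 2 \<in> \<int>"
    then obtain m where "x \<bullet> x / 2 = of_int m" by (auto elim: Ints_cases)
    then show "\<exists>k. x \<bullet> x = real_of_int k \<and> even k" by (intro exI [of _ "2 * m"]) simp
  qed
  then show ?thesis by (auto simp: even_part_def)
qed

lemma odd_half_Ints:
  assumes "x \<in> \<Lambda>" "x \<notin> even_part \<Lambda>" shows "x \<bullet> x / 2 - 1 / 2 \<in> \<int>"
proof -
  obtain k where k: "x \<bullet> x = of_int k" using inner_Ints [OF assms(1) assms(1)] by (auto elim: Ints_cases)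
  then have "odd k" using assms by (auto simp: even_part_def)
  then obtain m where "k = 2 * m + 1" by (rule oddE)
  then have "x \<bullet> x / 2 - 1 / 2 = of_int m" using k by (simp add: field_simps)
  then show ?thesis by simp
qed

text \<open>Modulo 2 the norm is additive, because the mixed term \<open>2 * (x \<bullet> y)\<close>
  is even; the even part is the kernel of this character.\<close>

lemma even_part_add_iff:
  assumes "x \<in> \<Lambda>" "y \<in> \<Lambda>"
  shows "x + y \<in> even_part \<Lambda> \<longleftrightarrow> (x \<in> even_part \<Lambda> \<longleftrightarrow> y \<in> even_part \<Lambda>)"
proof -
  have eq: "(x + y) \<bullet> (x + y) / 2 = x \<bullet> x / 2 + y \<bullet> y / 2 + x \<bullet> y"
    by (simp add: inner_add_left inner_add_right inner_commute)
  have i: "x \<bullet> y \<in> \<int>" using assms by (rule inner_Ints)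
  consider "x \<in> even_part \<Lambda>" "y \<in> even_part \<Lambda>" | "x \<in> even_part \<Lambda>" "y \<notin> even_part \<Lambda>"
    | "x \<notin> even_part \<Lambda>" "y \<in> even_part \<Lambda>" | "x \<notin> even_part \<Lambda>" "y \<notin> even_part \<Lambda>" by blast
  then show ?thesis
  proof cases
    case 1
    then show ?thesis using assms i by (auto simp: even_part_iff eq add_mem)
  next
    case 2
    have "(x + y) \<bullet> (x + y) / 2 \<notin> \<int>"
    proof
      assume "(x + y) \<bullet> (x + y) / 2 \<in> \<int>"
      moreover have "x \<bullet> x / 2 \<in> \<int>" using 2 by (simp add: even_part_iff)
      ultimately have "(x + y) \<bullet> (x + y) / 2 - x \<bullet> x / 2 - (y \<bullet> y / 2 - 1 / 2) - x \<bullet> y \<in> \<int>"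
        by (intro Ints_diff [OF Ints_diff [OF Ints_diff]] odd_half_Ints assms 2 i)
      then show False using half_not_Ints by (simp add: eq)
    qed
    then show ?thesis using 2 by (auto simp: even_part_iff)
  next
    case 3
    have "(x + y) \<bullet> (x + y) / 2 \<notin> \<int>"
    proof
      assume "(x + y) \<bullet> (x + y) / 2 \<in> \<int>"
      moreover have "y \<bullet> y / 2 \<in> \<int>" using 3 by (simp add: even_part_iff)
      ultimately have "(x + y) \<bullet> (x + y) / 2 - y \<bullet> y / 2 - (x \<bullet> x / 2 - 1 / 2) - x \<bullet> y \<in> \<int>"
        by (intro Ints_diff [OF Ints_diff [OF Ints_diff]] odd_half_Ints assms 3 i)
      then show False using half_not_Ints by (simp add: eq)
    qed
    then show ?thesis using 3 by (auto simp: even_part_iff)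
  next
    case 4
    have "(x \<bullet> x / 2 - 1 / 2) + (y \<bullet> y / 2 - 1 / 2) + x \<bullet> y + 1 \<in> \<int>"
      by (intro Ints_add odd_half_Ints assms 4 i Ints_1)
    then have "(x + y) \<bullet> (x + y) / 2 \<in> \<int>" by (simp add: eq add.assoc)
    then show ?thesis using 4 assms by (auto simp: even_part_iff add_mem)
  qed
qed

end

section \<open>The shadow\<close>

lemma Ints_half_shift:
  fixes r :: real
  assumes "2 * r \<in> \<int>" "r \<notin> \<int>" shows "r - 1 / 2 \<in> \<int>"
proof -
  obtain k where k: "2 * r = of_int k" using assms(1) by (auto elim: Ints_cases)
  have "odd k"
  proof
    assume "even k"
    then obtain m where "k = 2 * m" by (rule evenE)
    then have "r = of_int m" using k by simp
    then show False using assms(2) by simp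
  qed
  then obtain m where "k = 2 * m + 1" by (rule oddE)
  then have "r - 1 / 2 = of_int m" using k by (simp add: field_simps)
  then show ?thesis by simp
qed

lemma exp_2pi_i_Ints:
  assumes "r \<in> \<int>" shows "exp (2 * pi * \<i> * of_real r) = 1"
proof -
  obtain k where "r = of_int k" using assms by (auto elim: Ints_cases)
  then show ?thesis by (auto simp: exp_eq_1 intro!: exI [of _ k])
qed

lemma exp_2pi_i_half: assumes "r - 1 / 2 \<in> \<int>" shows "exp (2 * pi * \<i> * of_real r) = - 1"
proof -
  have "2 * pi * \<i> * of_real r = 2 * pi * \<i> * of_real (r - 1 / 2) + of_real pi * \<i>" by (simp add: algebra_simps)
  then show ?thesis using exp_2pi_i_Ints [OF assms] by (simp only: exp_add) simp
qed

lemma i_times_power_12: "(\<i> * of_real t) ^ 12 = of_real (t ^ 12)"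
proof -
  have "\<i> ^ 12 = ((\<i>\<^sup>2)\<^sup>2) ^ 3" by (simp only: power_mult [symmetric]) simp
  then show ?thesis by (simp add: power_mult_distrib)
qed

lemma has_sum_minus:
  fixes f g :: "'a \<Rightarrow> 'b :: real_normed_field"
  assumes "(f has_sum a) A" "(g has_sum b) A" shows "((\<lambda>x. f x - g x) has_sum (a - b)) A"
  using has_sum_add [OF assms(1) has_sum_uminusI [OF assms(2)]] by simp

context odd_selfdual
begin

lemma odd_vector: obtains x where "x \<in> \<Lambda>" "x \<notin> even_part \<Lambda>"
proof -
  obtain x k where x: "x \<in> \<Lambda>" "x \<bullet> x = of_int k" "odd k" using odd unfolding odd_lattice_def by blast
  then have "x \<notin> even_part \<Lambda>" by (simp add: even_part_def)
  with x that show thesis by blast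
qed

lemma even_part_subset: "x \<in> even_part \<Lambda> \<Longrightarrow> x \<in> \<Lambda>" by (simp add: even_part_def)

lemma even_part_uminus: "x \<in> even_part \<Lambda> \<Longrightarrow> - x \<in> even_part \<Lambda>" 
  by (simp add: even_part_iff uminus_mem)

lemma even_part_add: "x \<in> even_part \<Lambda> \<Longrightarrow> y \<in> even_part \<Lambda> \<Longrightarrow> x + y \<in> even_part \<Lambda>"
  using even_part_add_iff even_part_subset by simp

lemma even_part_diff: "x \<in> even_part \<Lambda> \<Longrightarrow> y \<in> even_part \<Lambda> \<Longrightarrow> x - y \<in> even_part \<Lambda>"
  using even_part_add [of x "- y"] even_part_uminus by simp

lemma odd_diff_even:
  assumes "x \<in> \<Lambda>" "x \<notin> even_part \<Lambda>" "y \<in> \<Lambda>" "y \<notin> even_part \<Lambda>" shows "x - y \<in> even_part \<Lambda>"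
proof -
  have "- y \<notin> even_part \<Lambda>" using even_part_uminus [of "- y"] assms by auto
  then show ?thesis using even_part_add_iff [of x "- y"] assms uminus_mem by simp
qed

text \<open>This says that \<open>2 *\<^sub>R v\<close> is a characteristic vector of
  \<open>\<Lambda>\<close>. If \<open>v\<close> lies in the shadow, no odd \<open>x\<close> pairs
  integrally with it: odd vectors differ by even ones, so \<open>v\<close> would pair integrally
  with all of \<open>\<Lambda>\<close> and lie in it. As \<open>2 *\<^sub>R x\<close> is even, the
  pairing with an odd \<open>x\<close> is an integer plus 1/2.\<close>

lemma shadow_iff: "v \<in> shadow \<Lambda> \<longleftrightarrow> (\<forall>x\<in>\<Lambda>. x \<bullet> v - x \<bullet> x / 2 \<in> \<int>)"
proof
  assume v: "\<forall>x\<in>\<Lambda>. x \<bullet> v - x \<bullet> x / 2 \<in> \<int>"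
  have "x \<bullet> v \<in> \<int>" if "x \<in> even_part \<Lambda>" for x
  proof -
    have "(x \<bullet> v - x \<bullet> x / 2) + x \<bullet> x / 2 \<in> \<int>"
      using v that by (intro Ints_add) (auto simp: even_part_iff)
    then show ?thesis by simp
  qed
  moreover have "v \<notin> \<Lambda>"
  proof
    assume "v \<in> \<Lambda>"
    obtain x where x: "x \<in> \<Lambda>" "x \<notin> even_part \<Lambda>" by (rule odd_vector)
    have "x \<bullet> v - (x \<bullet> v - x \<bullet> x / 2) \<in> \<int>"
      using v x inner_Ints [OF x(1) \<open>v \<in> \<Lambda>\<close>] by (intro Ints_diff [of "x \<bullet> v"]) auto
    then show False using x by (simp add: even_part_iff)
  qed
  ultimately show "v \<in> shadow \<Lambda>" by (simp add: shadow_def dual_set_def)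
next
  assume "v \<in> shadow \<Lambda>"
  then have v: "\<And>x. x \<in> even_part \<Lambda> \<Longrightarrow> x \<bullet> v \<in> \<int>" "v \<notin> \<Lambda>" by (auto simp: shadow_def dual_set_def)
  show "\<forall>x\<in>\<Lambda>. x \<bullet> v - x \<bullet> x / 2 \<in> \<int>"
  proof
    fix x assume x: "x \<in> \<Lambda>"
    show "x \<bullet> v - x \<bullet> x / 2 \<in> \<int>"
    proof (cases "x \<in> even_part \<Lambda>")
      case True
      then show ?thesis using v by (simp add: even_part_iff)
    next
      case False
      have "x \<bullet> v \<notin> \<int>"
      proof
        assume xv: "x \<bullet> v \<in> \<int>"
        have "z \<bullet> v \<in> \<int>" if "z \<in> \<Lambda>" for z
        proof (cases "z \<in> even_part \<Lambda>")
          case False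
          then have "(z - x) \<bullet> v \<in> \<int>" using x \<open>x \<notin> even_part \<Lambda>\<close> that by (intro v odd_diff_even)
          then have "(z - x) \<bullet> v + x \<bullet> v \<in> \<int>" using xv by (rule Ints_add)
          then show ?thesis by (simp add: inner_diff_left)
        qed (rule v)
        then have "v \<in> \<Lambda>" by (subst dual) blast
        then show False using v by blast
      qed
      moreover have "2 *\<^sub>R x \<in> even_part \<Lambda>"
        using x even_part_add_iff [of x x] by (simp add: scaleR_2)
      then have "2 * (x \<bullet> v) \<in> \<int>" using v(1) [of "2 *\<^sub>R x"] by simp
      ultimately have "(x \<bullet> v - 1 / 2) - (x \<bullet> x / 2 - 1 / 2) \<in> \<int>"
        by (intro Ints_diff [of "x \<bullet> v - 1 / 2"] Ints_half_shift odd_half_Ints x False)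
      then show ?thesis by simp
    qed
  qed
qed

text \<open>Modulo integers \<open>x \<bullet> x / 2\<close> is additive on
  \<open>\<Lambda>\<close>. A linear functional with these values on a basis therefore has them
  modulo integers on all of \<open>\<Lambda>\<close>, and \<open>w\<close> is the vector that
  represents it.\<close>

lemma shadow_nonempty: obtains w where "w \<in> shadow \<Lambda>"
proof -
  have "lattice24 \<Lambda>" using selfdual by (simp add: selfdual_def integral_lattice_def)
  then obtain B where B: "finite B" "independent B" "\<Lambda> = int_span B" by (rule lattice24_int_span) (rule that)
  obtain g :: "vec24 \<Rightarrow> real" where g: "linear g" "\<forall>x\<in>B. g x = x \<bullet> x / 2"
    using linear_independent_extend [OF B(2), of "\<lambda>x. x \<bullet> x / 2"] by (elim exE conjE) (rule that)
  define w where "w = (\<Sum>e\<in>Basis. g e *\<^sub>R e)"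
  have gw: "x \<bullet> w = g x" for x
  proof -
    have "g x = g (\<Sum>e\<in>Basis. (x \<bullet> e) *\<^sub>R e)" by (simp add: euclidean_representation)
    also have "\<dots> = (\<Sum>e\<in>Basis. (x \<bullet> e) * g e)" using g(1) by (simp add: linear_sum linear_scale)
    finally show ?thesis by (simp add: w_def inner_sum_right mult.commute)
  qed
  define P where "P x \<longleftrightarrow> x \<in> \<Lambda> \<and> x \<bullet> w - x \<bullet> x / 2 \<in> \<int>" for x
  have Padd: "P (x + y)" if "P x" "P y" for x y
  proof -
    have "(x \<bullet> w - x \<bullet> x / 2) + (y \<bullet> w - y \<bullet> y / 2) - x \<bullet> y \<in> \<int>"
      using that inner_Ints by (intro Ints_diff [OF Ints_add]) (auto simp: P_def)
    moreover have "(x + y) \<bullet> w - (x + y) \<bullet> (x + y) / 2 = (x \<bullet> w - x \<bullet> x / 2) + (y \<bullet> w - y \<bullet> y / 2) - x \<bullet> y"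
      by (simp add: inner_add_left inner_add_right inner_commute add_divide_distrib)
    ultimately show ?thesis using that add_mem by (simp add: P_def)
  qed
  have Pscale: "P (of_int k *\<^sub>R x)" if "P x" for k x
  proof -
    have "x \<bullet> x \<in> \<int>" using inner_Ints [of x x] that by (simp add: P_def)
    then obtain m where "x \<bullet> x = of_int m" by (rule Ints_cases)
    \<comment> \<open>The discrepancy between \<open>k\<^sup>2 * (x \<bullet> x) / 2\<close> and
      \<open>k * (x \<bullet> x) / 2\<close> is an integer for this reason.\<close>
    moreover have "even (k * k - k)" by simp
    then obtain j where "k * k - k = 2 * j" by (rule evenE)
    then have "real_of_int (k * k - k) = real_of_int (2 * j)" by (simp only:)
    then have "real_of_int k * real_of_int k = of_int k + 2 * of_int j" by simp
    ultimately have "(of_int k *\<^sub>R x) \<bullet> w - (of_int k *\<^sub>R x) \<bullet> (of_int k *\<^sub>R x) / 2 = of_int k * (x \<bullet> w - x \<bullet> x / 2) - of_int (j * m)"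
      by (simp add: mult.assoc [symmetric]) (simp add: algebra_simps)
    moreover have "of_int k * (x \<bullet> w - x \<bullet> x / 2) - of_int (j * m) \<in> \<int>"
      using that by (intro Ints_diff [of "of_int k * (x \<bullet> w - x \<bullet> x / 2)"] Ints_mult Ints_of_int) (simp add: P_def)
    ultimately show ?thesis using that scale_mem [of x "of_int k"] by (simp add: P_def)
  qed
  have PB: "P b" if "b \<in> B" for b
    unfolding P_def gw bspec [OF g(2) that] using int_span_base [OF B(1) that] B(3) by simp
  have "P (\<Sum>b\<in>F. of_int (c b) *\<^sub>R b)" if "finite F" "F \<subseteq> B" for F and c :: "vec24 \<Rightarrow> int"
    using that
  proof (induction F rule: finite_induct)
    case empty
    then show ?case by (simp add: P_def zero_mem)
  next
    case (insert b F)
    then show ?case by (simp add: Padd Pscale PB)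
  qed
  then have "P x" if "x \<in> \<Lambda>" for x
    using that B(1) unfolding B(3) int_span_def by (elim CollectE exE) simp
  then have "w \<in> shadow \<Lambda>" by (simp add: shadow_iff P_def)
  then show thesis by (rule that)
qed

lemma shadow_add_mem:
  assumes "v \<in> shadow \<Lambda>" "x \<in> \<Lambda>" shows "v + x \<in> shadow \<Lambda>"
  unfolding shadow_iff
proof
  fix z assume z: "z \<in> \<Lambda>"
  have "(z \<bullet> v - z \<bullet> z / 2) + z \<bullet> x \<in> \<int>"
    using z assms inner_Ints by (intro Ints_add) (auto simp: shadow_iff)
  then show "z \<bullet> (v + x) - z \<bullet> z / 2 \<in> \<int>" by (simp add: inner_add_right algebra_simps)
qed

lemma shadow_diff:
  assumes "v \<in> shadow \<Lambda>" "w \<in> shadow \<Lambda>" shows "v - w \<in> \<Lambda>"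
proof (subst dual, intro ballI)
  fix z assume "z \<in> \<Lambda>"
  then have "(z \<bullet> v - z \<bullet> z / 2) - (z \<bullet> w - z \<bullet> z / 2) \<in> \<int>"
    using assms by (intro Ints_diff [of "z \<bullet> v - z \<bullet> z / 2"]) (auto simp: shadow_iff)
  then show "z \<bullet> (v - w) \<in> \<int>" by (simp add: inner_diff_right)
qed

lemma bij_betw_shadow: assumes "w \<in> shadow \<Lambda>" shows "bij_betw (\<lambda>x. x + w) \<Lambda> (shadow \<Lambda>)"
proof (rule bij_betwI [of _ _ _ "\<lambda>v. v - w"])
  show "(\<lambda>x. x + w) \<in> \<Lambda> \<rightarrow> shadow \<Lambda>" using shadow_add_mem [OF assms] by (simp add: add.commute)
  show "(\<lambda>v. v - w) \<in> shadow \<Lambda> \<rightarrow> \<Lambda>" using shadow_diff [OF _ assms] by simp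
qed auto

section \<open>Theta functions of the lattice and of its shadow, and their modular
  transformations\<close>

lemma theta_summable_lattice: "theta_summable (\<lambda>x. x \<bullet> x) (\<lambda>_. 1) \<Lambda>"
  using poisson_selfdual(1) [OF selfdual, of _ 0] by (simp add: theta_summable_def)

lemma theta_summable_shadow: "theta_summable (\<lambda>x. x \<bullet> x) (\<lambda>_. 1) (shadow \<Lambda>)"
proof -
  obtain w where w: "w \<in> shadow \<Lambda>" by (rule shadow_nonempty)
  have "(\<lambda>x. exp (- pi * r * (x \<bullet> x))) summable_on shadow \<Lambda>" if "r > 0" for r
    by (subst summable_on_reindex_bij_betw [OF bij_betw_shadow [OF w], symmetric]) (rule poisson_selfdual(1) [OF selfdual that])
  then show ?thesis by (simp add: theta_summable_def)
qed

text \<open>Turns the quadratic phase of the translation \<open>\<tau> \<mapsto> \<tau> + 1\<close>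
  into a linear character of \<open>x\<close>, which Poisson summation accepts.\<close>

lemma exp_inner_shadow:
  assumes "x \<in> \<Lambda>" "v \<in> shadow \<Lambda>"
  shows "exp (2 * pi * \<i> * of_real (x \<bullet> v)) = exp (pi * \<i> * of_real (x \<bullet> x))"
proof -
  have "2 * pi * \<i> * of_real (x \<bullet> v) = 2 * pi * \<i> * of_real (x \<bullet> v - x \<bullet> x / 2) + pi * \<i> * of_real (x \<bullet> x)"
    by (simp add: algebra_simps)
  moreover have "exp (2 * pi * \<i> * of_real (x \<bullet> v - x \<bullet> x / 2)) = 1"
    using assms by (intro exp_2pi_i_Ints) (simp add: shadow_iff)
  ultimately show ?thesis by (simp only: exp_add mult_1)
qed

abbreviation "theta_lattice \<equiv> theta (\<lambda>x. x \<bullet> x) (\<lambda>_. 1) \<Lambda>"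
abbreviation "theta_shadow \<equiv> theta (\<lambda>x. x \<bullet> x) (\<lambda>_. 1) (shadow \<Lambda>)"

lemma theta_lattice_holomorphic: "theta_lattice holomorphic_on {\<tau>. Im \<tau> > 0}"
  by (rule theta_holomorphic [OF theta_summable_lattice]) simp

lemma theta_shadow_holomorphic: "theta_shadow holomorphic_on {\<tau>. Im \<tau> > 0}"
  by (rule theta_holomorphic [OF theta_summable_shadow]) simp

lemma theta_lattice_inversion:
  assumes "Im \<tau> > 0" shows "theta_lattice (- 1 / \<tau>) = \<tau> ^ 12 * theta_lattice \<tau>"
proof -
  have "theta_lattice (- 1 / \<tau>) = 1 * \<tau> ^ 12 * theta_lattice \<tau>"
  proof (rule theta_inversion_continuation [OF theta_lattice_holomorphic theta_lattice_holomorphic _ assms])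
    fix t :: real assume t: "t > 0"
    have "theta_lattice (\<i> * of_real (1 / t)) = (\<Sum>\<^sub>\<infinity>x\<in>\<Lambda>. exp (of_real (- pi * (1 / t) * ((x + 0) \<bullet> (x + 0))) + 2 * pi * \<i> * of_real (x \<bullet> 0)))"
      unfolding theta_imaginary_axis by (simp only: exp_of_real add_0_right inner_zero_right of_real_0 mult_zero_right mult_1)
    also have "\<dots> = of_real (1 / (1 / t) ^ 12) * (\<Sum>\<^sub>\<infinity>y\<in>\<Lambda>. exp (of_real (- pi * ((y - 0) \<bullet> (y - 0)) / (1 / t)) + 2 * pi * \<i> * of_real ((y - 0) \<bullet> 0)))"
      using t by (intro poisson_selfdual(2) [OF selfdual]) simp
    also have "\<dots> = of_real (t ^ 12) * theta_lattice (\<i> * of_real t)"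
    proof -
      have "exp (of_real (- pi * ((y - 0) \<bullet> (y - 0)) / (1 / t)) + 2 * pi * \<i> * of_real ((y - 0) \<bullet> 0)) = 1 * complex_of_real (exp (- pi * t * (y \<bullet> y)))" for y :: vec24
        unfolding exp_of_real [symmetric] mult_1 by (intro arg_cong [where f = exp]) simp
      moreover have "1 / (1 / t) ^ 12 = t ^ 12" by (simp add: power_divide)
      ultimately show ?thesis unfolding theta_imaginary_axis by (simp only:)
    qed
    also have "of_real (t ^ 12) = 1 * (\<i> * of_real t) ^ 12"
      by (simp only: i_times_power_12 mult_1)
    finally show "theta_lattice (\<i> * of_real (1 / t)) = 1 * (\<i> * of_real t) ^ 12 * theta_lattice (\<i> * of_real t)" .
  qed
  then show ?thesis by simp
qed

lemma theta_lattice_add_1: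
  assumes w: "w \<in> shadow \<Lambda>"
  shows "theta_lattice (\<tau> + 1) = (\<Sum>\<^sub>\<infinity>x\<in>\<Lambda>. exp (pi * \<i> * \<tau> * (x \<bullet> x) + 2 * pi * \<i> * of_real (x \<bullet> w)))"
  unfolding theta_def
proof (rule infsum_cong)
  fix x assume "x \<in> \<Lambda>"
  then show "1 * exp (pi * \<i> * (\<tau> + 1) * (x \<bullet> x)) = exp (pi * \<i> * \<tau> * (x \<bullet> x) + 2 * pi * \<i> * of_real (x \<bullet> w))"
    using exp_inner_shadow [OF _ w, of x] by (simp add: exp_add ring_distribs)
qed

lemma theta_lattice_add_2: "theta_lattice (\<tau> + 2) = theta_lattice \<tau>"
  unfolding theta_def
proof (rule infsum_cong)
  fix x assume "x \<in> \<Lambda>"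
  then have "exp (2 * pi * \<i> * of_real (x \<bullet> x)) = 1" by (intro exp_2pi_i_Ints inner_Ints)
  moreover have "pi * \<i> * (\<tau> + 2) * (x \<bullet> x) = pi * \<i> * \<tau> * (x \<bullet> x) + 2 * pi * \<i> * of_real (x \<bullet> x)"
    by (simp add: ring_distribs)
  ultimately show "1 * exp (pi * \<i> * (\<tau> + 2) * (x \<bullet> x)) = 1 * exp (pi * \<i> * \<tau> * (x \<bullet> x))"
    by (simp only: exp_add mult_1_right)
qed

text \<open>The shift by \<open>w\<close> on one side of Poisson summation is the character
  \<open>x \<bullet> w\<close> on the other, that is, a translation of \<open>\<tau>\<close> by
  1.\<close>

lemma theta_shadow_inversion:
  assumes "Im \<tau> > 0" shows "theta_shadow (- 1 / \<tau>) = \<tau> ^ 12 * theta_lattice (\<tau> + 1)"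
proof -
  obtain w where w: "w \<in> shadow \<Lambda>" by (rule shadow_nonempty)
  have "theta_shadow (- 1 / \<tau>) = 1 * \<tau> ^ 12 * theta_lattice (\<tau> + 1)"
  proof (rule theta_inversion_continuation [OF _ theta_shadow_holomorphic _ assms])
    show "(\<lambda>\<tau>. theta_lattice (\<tau> + 1)) holomorphic_on {\<tau>. Im \<tau> > 0}"
      by (rule holomorphic_on_compose_gen [OF _ theta_lattice_holomorphic, unfolded o_def]) (auto intro!: holomorphic_intros)
    fix t :: real assume t: "t > 0"
    have "theta_shadow (\<i> * of_real (1 / t)) = (\<Sum>\<^sub>\<infinity>x\<in>\<Lambda>. of_real (exp (- pi * (1 / t) * ((x + w) \<bullet> (x + w)))))"
      unfolding theta_imaginary_axis by (subst infsum_reindex_bij_betw [OF bij_betw_shadow [OF w], symmetric]) simp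
    also have "\<dots> = (\<Sum>\<^sub>\<infinity>x\<in>\<Lambda>. exp (of_real (- pi * (1 / t) * ((x + w) \<bullet> (x + w))) + 2 * pi * \<i> * of_real (x \<bullet> 0)))"
      by (simp only: exp_of_real add_0_right inner_zero_right of_real_0 mult_zero_right)
    also have "\<dots> = of_real (1 / (1 / t) ^ 12) * (\<Sum>\<^sub>\<infinity>y\<in>\<Lambda>. exp (of_real (- pi * ((y - 0) \<bullet> (y - 0)) / (1 / t)) + 2 * pi * \<i> * of_real ((y - 0) \<bullet> w)))"
      using t by (intro poisson_selfdual(2) [OF selfdual]) simp
    also have "\<dots> = of_real (t ^ 12) * theta_lattice (\<i> * of_real t + 1)"
    proof -
      have "complex_of_real (- pi * ((y - 0) \<bullet> (y - 0)) / (1 / t)) = pi * \<i> * (\<i> * of_real t) * (y \<bullet> y)" for y :: vec24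
        by (simp add: complex_eq_iff)
      then show ?thesis unfolding theta_lattice_add_1 [OF w] by (simp add: power_divide)
    qed
    also have "of_real (t ^ 12) = 1 * (\<i> * of_real t) ^ 12"
      by (simp only: i_times_power_12 mult_1)
    finally show "theta_shadow (\<i> * of_real (1 / t)) = 1 * (\<i> * of_real t) ^ 12 * theta_lattice (\<i> * of_real t + 1)" .
  qed
  then show ?thesis by simp
qed

text \<open>With \<open>\<rho> = - 1 / \<sigma> - 1\<close> the point
  \<open>- 1 / (\<sigma> + 1) + 1\<close> equals \<open>- 1 / \<rho>\<close>, and
  \<open>\<rho>\<close> differs from \<open>- 1 / \<sigma> + 1\<close> by the period 2 of
  \<open>theta_lattice\<close>. The automorphy factors agree up to a sign that the even exponent 12
  removes.\<close>

lemma theta_shadow_add_1: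
  assumes \<sigma>: "Im \<sigma> > 0" shows "theta_shadow (\<sigma> + 1) = theta_shadow \<sigma>"
proof -
  have nz: "\<sigma> \<noteq> 0" "\<sigma> + 1 \<noteq> 0" using \<sigma> by (auto simp: complex_eq_iff)
  have sh: "theta_shadow z = (- 1 / z) ^ 12 * theta_lattice (- 1 / z + 1)" if "Im z > 0" for z
  proof -
    have "z \<noteq> 0" using that by auto
    then have "- 1 / (- 1 / z) = z" by simp
    then show ?thesis using theta_shadow_inversion [OF Im_inversion_pos [OF that]] by (simp only:)
  qed
  define \<rho> where "\<rho> = - 1 / \<sigma> - 1"
  have \<rho>: "Im \<rho> > 0" using Im_inversion_pos [OF \<sigma>] by (simp add: \<rho>_def)
  have \<rho>eq: "\<rho> = - ((\<sigma> + 1) / \<sigma>)" using nz by (simp add: \<rho>_def field_simps)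
  have "- 1 / (\<sigma> + 1) + 1 = \<sigma> / (\<sigma> + 1)" using nz by (simp add: field_simps)
  also have "\<dots> = - 1 / \<rho>"
  proof (subst nonzero_eq_divide_eq)
    show "\<rho> \<noteq> 0" using \<rho> by auto
    show "\<sigma> / (\<sigma> + 1) * \<rho> = - 1" unfolding \<rho>eq using nz by simp
  qed
  finally have "- 1 / (\<sigma> + 1) + 1 = - 1 / \<rho>" .
  then have "theta_shadow (\<sigma> + 1) = (- 1 / (\<sigma> + 1)) ^ 12 * (\<rho> ^ 12 * theta_lattice \<rho>)"
    using sh [of "\<sigma> + 1"] \<sigma> theta_lattice_inversion [OF \<rho>] by simp
  also have "theta_lattice \<rho> = theta_lattice (- 1 / \<sigma> + 1)"
    using theta_lattice_add_2 [of \<rho>] by (simp add: \<rho>_def)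
  also have "(- 1 / (\<sigma> + 1)) ^ 12 * (\<rho> ^ 12 * theta_lattice (- 1 / \<sigma> + 1)) = (- 1 / (\<sigma> + 1) * \<rho>) ^ 12 * theta_lattice (- 1 / \<sigma> + 1)"
    by (simp only: power_mult_distrib mult.assoc)
  also have "- 1 / (\<sigma> + 1) * \<rho> = - (- 1 / \<sigma>)" unfolding \<rho>eq using nz by simp
  also have "(- (- 1 / \<sigma>)) ^ 12 = (- 1 / \<sigma>) ^ 12" by (rule power_minus_even) simp
  also have "\<dots> * theta_lattice (- 1 / \<sigma> + 1) = theta_shadow \<sigma>" using sh [OF \<sigma>] by simp
  finally show ?thesis .
qed

text \<open>The values of \<open>theta_shadow\<close> at \<open>\<i>\<close> and
  \<open>\<i> + 1\<close> agree, and the real part of their difference is the sum of the nonnegative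
  terms \<open>f x\<close>. So each term vanishes and the cosine is 1 on every shadow norm.\<close>

lemma shadow_norm_even:
  assumes "v \<in> shadow \<Lambda>" shows "v \<bullet> v / 2 \<in> \<int>"
proof -
  define f where "f x = exp (- pi * (x \<bullet> x)) * (1 - cos (pi * (x \<bullet> x)))" for x :: vec24
  have 0: "(\<Sum>\<^sub>\<infinity>x\<in>shadow \<Lambda>. 1 * exp (pi * \<i> * \<i> * (x \<bullet> x)) - 1 * exp (pi * \<i> * (\<i> + 1) * (x \<bullet> x))) = 0"
    if "(\<lambda>x. 1 * exp (pi * \<i> * \<i> * (x \<bullet> x))) summable_on shadow \<Lambda>"
      "(\<lambda>x. 1 * exp (pi * \<i> * (\<i> + 1) * (x \<bullet> x))) summable_on shadow \<Lambda>"
  proof -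
    have "theta_shadow (\<i> + 1) = theta_shadow \<i>" by (rule theta_shadow_add_1) simp
    with has_sum_minus [OF has_sum_infsum [OF that(1)] has_sum_infsum [OF that(2)]]
    show ?thesis unfolding theta_def by (simp only: infsumI diff_self)
  qed
  have s1: "(\<lambda>x. 1 * exp (pi * \<i> * \<i> * (x \<bullet> x))) summable_on shadow \<Lambda>"
    and s2: "(\<lambda>x. 1 * exp (pi * \<i> * (\<i> + 1) * (x \<bullet> x))) summable_on shadow \<Lambda>"
    by (rule theta_summable_imp_summable_on [OF theta_summable_shadow], simp)+
  have sm: "(\<lambda>x. 1 * exp (pi * \<i> * \<i> * (x \<bullet> x)) - 1 * exp (pi * \<i> * (\<i> + 1) * (x \<bullet> x))) summable_on shadow \<Lambda>"
    using has_sum_imp_summable [OF has_sum_minus [OF has_sum_infsum [OF s1] has_sum_infsum [OF s2]]] .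
  have f: "Re (1 * exp (pi * \<i> * \<i> * (x \<bullet> x)) - 1 * exp (pi * \<i> * (\<i> + 1) * (x \<bullet> x))) = f x" for x
    by (simp add: f_def Re_exp algebra_simps)
  have "f v = 0"
  proof (rule nonneg_infsum_le_0D [where A = "shadow \<Lambda>"])
    show "infsum f (shadow \<Lambda>) \<le> 0" using infsum_Re [OF sm] 0 [OF s1 s2] unfolding f by (simp only: zero_complex.sel order_refl)
    show "f summable_on shadow \<Lambda>" using summable_on_Re [OF sm] unfolding f .
  qed (use assms in \<open>auto simp: f_def\<close>)
  then have "cos (pi * (v \<bullet> v)) = 1" by (simp add: f_def)
  then obtain n :: int where "pi * (v \<bullet> v) = of_int n * 2 * pi" by (auto simp: cos_one_2pi_int)
  then have "v \<bullet> v / 2 = of_int n" by simp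
  then show ?thesis by simp
qed

end

section \<open>Even neighbours\<close>

context odd_selfdual
begin

definition neighbour :: "vec24 \<Rightarrow> vec24 set" where
  "neighbour w = even_part \<Lambda> \<union> (\<lambda>x. x + w) ` even_part \<Lambda>"

lemma neighbour_iff: "y \<in> neighbour w \<longleftrightarrow> y \<in> even_part \<Lambda> \<or> y - w \<in> even_part \<Lambda>"
proof -
  have "y \<in> (\<lambda>x. x + w) ` even_part \<Lambda> \<longleftrightarrow> y - w \<in> even_part \<Lambda>"
    by (auto simp: image_iff intro!: bexI [of _ "y - w"])
  then show ?thesis by (simp add: neighbour_def)
qed

lemma even_part_inner_shadow:
  assumes "x \<in> even_part \<Lambda>" "w \<in> shadow \<Lambda>" shows "x \<bullet> w \<in> \<int>"
  using assms by (simp add: shadow_def dual_set_def)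

lemma shadow_inner_imp_even:
  assumes "x \<in> \<Lambda>" "w \<in> shadow \<Lambda>" "x \<bullet> w \<in> \<int>" shows "x \<in> even_part \<Lambda>"
proof -
  have "x \<bullet> w - (x \<bullet> w - x \<bullet> x / 2) \<in> \<int>"
    using assms by (intro Ints_diff [of "x \<bullet> w"]) (auto simp: shadow_iff)
  then show ?thesis using assms by (simp add: even_part_iff)
qed

lemma shadow_norm_Ints: assumes "w \<in> shadow \<Lambda>" shows "w \<bullet> w \<in> \<int>"
proof -
  have "2 * (w \<bullet> w / 2) \<in> \<int>" using shadow_norm_even [OF assms] by (intro Ints_mult) auto
  then show ?thesis by simp
qed

lemma double_shadow_even:
  assumes "w \<in> shadow \<Lambda>" shows "2 *\<^sub>R w \<in> even_part \<Lambda>"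
proof -
  have "2 *\<^sub>R w \<in> \<Lambda>"
  proof (subst dual, intro ballI)
    fix z assume z: "z \<in> \<Lambda>"
    have "2 * (z \<bullet> w - z \<bullet> z / 2) + z \<bullet> z \<in> \<int>"
      using assms z inner_Ints [OF z z] by (intro Ints_add Ints_mult) (auto simp: shadow_iff)
    then show "z \<bullet> (2 *\<^sub>R w) \<in> \<int>" by simp
  qed
  moreover have "2 * (w \<bullet> w) \<in> \<int>" using shadow_norm_Ints [OF assms] by (intro Ints_mult) auto
  ultimately show ?thesis by (simp add: even_part_iff)
qed

lemma neighbour_inner_Ints:
  assumes w: "w \<in> shadow \<Lambda>" and x: "x \<in> neighbour w" and y: "y \<in> neighbour w"
  shows "x \<bullet> y \<in> \<int>"
proof -
  have ee: "a \<bullet> b \<in> \<int>" if "a \<in> even_part \<Lambda>" "b \<in> even_part \<Lambda>" for a b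
    using that by (intro inner_Ints even_part_subset)
  have ew: "a \<bullet> b \<in> \<int>" if a: "a \<in> even_part \<Lambda>" and b: "b - w \<in> even_part \<Lambda>" for a b
  proof -
    have "a \<bullet> (b - w) + a \<bullet> w \<in> \<int>" using a b w by (intro Ints_add ee even_part_inner_shadow)
    then show ?thesis by (simp add: inner_diff_right)
  qed
  have ww: "a \<bullet> b \<in> \<int>" if a: "a - w \<in> even_part \<Lambda>" and b: "b - w \<in> even_part \<Lambda>" for a b
  proof -
    have "(a - w) \<bullet> b + (b - w) \<bullet> w + w \<bullet> w \<in> \<int>"
      using a b w by (intro Ints_add ew even_part_inner_shadow shadow_norm_Ints)
    moreover have "(a - w) \<bullet> b + (b - w) \<bullet> w + w \<bullet> w = a \<bullet> b"
      by (simp add: inner_diff_left inner_commute [of b w])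
    ultimately show ?thesis by simp
  qed
  show ?thesis using x y ee ew [of x y] ew [of y x] ww unfolding neighbour_iff by (auto simp: inner_commute)
qed

text \<open>A vector that is integral on the even part lies in \<open>\<Lambda>\<close> or in the
  shadow. Its integral pairing with \<open>w\<close> decides: in \<open>\<Lambda>\<close> it makes
  the vector even, and in the shadow the same argument applies to \<open>y - w\<close>.\<close>

lemma neighbour_dual:
  assumes w: "w \<in> shadow \<Lambda>"
  shows "y \<in> neighbour w \<longleftrightarrow> (\<forall>x\<in>neighbour w. x \<bullet> y \<in> \<int>)"
proof
  assume "y \<in> neighbour w"
  then show "\<forall>x\<in>neighbour w. x \<bullet> y \<in> \<int>" using neighbour_inner_Ints [OF w] by simp
next
  assume y: "\<forall>x\<in>neighbour w. x \<bullet> y \<in> \<int>"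
  have "0 \<in> even_part \<Lambda>" by (simp add: even_part_iff zero_mem)
  then have "w \<in> neighbour w" by (simp add: neighbour_iff)
  with y have yw: "y \<bullet> w \<in> \<int>" by (simp add: inner_commute)
  have "y \<in> dual_set (even_part \<Lambda>)" using y by (simp add: dual_set_def neighbour_iff)
  then consider "y \<in> \<Lambda>" | "y \<in> shadow \<Lambda>" unfolding shadow_def by blast
  then show "y \<in> neighbour w"
  proof cases
    case 1
    then show ?thesis using shadow_inner_imp_even [OF _ w yw] by (simp add: neighbour_iff)
  next
    case 2
    then have "y - w \<in> \<Lambda>" using w by (rule shadow_diff)
    moreover have "(y - w) \<bullet> w \<in> \<int>"
      unfolding inner_diff_left using yw shadow_norm_Ints [OF w] by (rule Ints_diff)
    ultimately show ?thesis using shadow_inner_imp_even [OF _ w] by (simp add: neighbour_iff)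
  qed
qed

text \<open>Closure under reflection is read off from selfduality, since the reflected vector pairs
  integrally with the whole neighbour.\<close>

lemma neighbour_reflect:
  assumes w: "w \<in> shadow \<Lambda>" and r: "r \<in> neighbour w" and s: "s \<in> neighbour w"
  shows "s - (s \<bullet> r) *\<^sub>R r \<in> neighbour w"
proof (subst neighbour_dual [OF w], intro ballI)
  fix x assume x: "x \<in> neighbour w"
  have "x \<bullet> s - (s \<bullet> r) * (x \<bullet> r) \<in> \<int>"
    using neighbour_inner_Ints [OF w] x r s by (intro Ints_diff Ints_mult)
  then show "x \<bullet> (s - (s \<bullet> r) *\<^sub>R r) \<in> \<int>" by (simp add: inner_diff_right)
qed

lemma neighbour_norm_even:
  assumes w: "w \<in> shadow \<Lambda>" and x: "x \<in> neighbour w"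
  shows "x \<bullet> x / 2 \<in> \<int>"
proof (cases "x \<in> even_part \<Lambda>")
  case True
  then show ?thesis by (simp add: even_part_iff)
next
  case False
  then have "x - w \<in> \<Lambda>" using x even_part_subset by (auto simp: neighbour_iff)
  then have "w + (x - w) \<in> shadow \<Lambda>" by (rule shadow_add_mem [OF w])
  then show ?thesis using shadow_norm_even by simp
qed

section \<open>Convergence and Poisson summation for an even neighbour\<close>

lemma theta_summable_neighbour:
  assumes w: "w \<in> shadow \<Lambda>" shows "theta_summable (\<lambda>x. x \<bullet> x) (\<lambda>_. 1) (neighbour w)"
proof -
  have "neighbour w \<subseteq> \<Lambda> \<union> shadow \<Lambda>"
  proof
    fix x assume x: "x \<in> neighbour w"
    show "x \<in> \<Lambda> \<union> shadow \<Lambda>"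
    proof (cases "x \<in> even_part \<Lambda>")
      case False
      then have "w + (x - w) \<in> shadow \<Lambda>" using x by (intro shadow_add_mem [OF w] even_part_subset) (simp add: neighbour_iff)
      then show ?thesis by simp
    qed (simp add: even_part_subset)
  qed
  moreover have "theta_summable (\<lambda>x. x \<bullet> x) (\<lambda>_. 1) (\<Lambda> \<union> shadow \<Lambda>)"
    unfolding theta_summable_def
    by (intro allI impI summable_on_union theta_summableD theta_summable_lattice theta_summable_shadow)
  ultimately show ?thesis by (rule theta_summable_subset [rotated])
qed

text \<open>The character \<open>exp (2 * pi * \<i> * of_real (x \<bullet> w))\<close> is 1 on the
  even part and -1 on the rest of \<open>\<Lambda>\<close>, so averaging with it isolates the even
  part.\<close>

lemma infsum_even_part:
  fixes g :: "vec24 \<Rightarrow> complex"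
  assumes w: "w \<in> shadow \<Lambda>" and g: "g summable_on \<Lambda>" "(\<lambda>x. exp (2 * pi * \<i> * of_real (x \<bullet> w)) * g x) summable_on \<Lambda>"
  shows "2 * (\<Sum>\<^sub>\<infinity>x\<in>even_part \<Lambda>. g x) = (\<Sum>\<^sub>\<infinity>x\<in>\<Lambda>. g x) + (\<Sum>\<^sub>\<infinity>x\<in>\<Lambda>. exp (2 * pi * \<i> * of_real (x \<bullet> w)) * g x)"
proof -
  have e: "exp (2 * pi * \<i> * of_real (x \<bullet> w)) = 1" if "x \<in> even_part \<Lambda>" for x
    using that w by (intro exp_2pi_i_Ints even_part_inner_shadow)
  have o: "exp (2 * pi * \<i> * of_real (x \<bullet> w)) = - 1" if "x \<in> \<Lambda>" "x \<notin> even_part \<Lambda>" for x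
  proof (rule exp_2pi_i_half)
    have "(x \<bullet> w - x \<bullet> x / 2) + (x \<bullet> x / 2 - 1 / 2) \<in> \<int>"
      using w that by (intro Ints_add [of "x \<bullet> w - x \<bullet> x / 2"] odd_half_Ints) (auto simp: shadow_iff)
    then show "x \<bullet> w - 1 / 2 \<in> \<int>" by simp
  qed
  have "(\<Sum>\<^sub>\<infinity>x\<in>\<Lambda>. g x) + (\<Sum>\<^sub>\<infinity>x\<in>\<Lambda>. exp (2 * pi * \<i> * of_real (x \<bullet> w)) * g x) =
     (\<Sum>\<^sub>\<infinity>x\<in>\<Lambda>. g x + exp (2 * pi * \<i> * of_real (x \<bullet> w)) * g x)"
    using g by (rule infsum_add [symmetric])
  also have "\<dots> = (\<Sum>\<^sub>\<infinity>x\<in>even_part \<Lambda>. 2 * g x)"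
  proof (rule infsum_cong_neutral)
    fix x
    show "2 * g x = 0" if "x \<in> even_part \<Lambda> - \<Lambda>" using that even_part_subset by blast
    show "g x + exp (2 * pi * \<i> * of_real (x \<bullet> w)) * g x = 0" if "x \<in> \<Lambda> - even_part \<Lambda>"
      using that o [of x] by (simp only: Diff_iff simp_thms) simp
    show "g x + exp (2 * pi * \<i> * of_real (x \<bullet> w)) * g x = 2 * g x" if "x \<in> \<Lambda> \<inter> even_part \<Lambda>"
      using that e [of x] by (simp only: Int_iff) simp
  qed
  also have "\<dots> = 2 * (\<Sum>\<^sub>\<infinity>x\<in>even_part \<Lambda>. g x)" by (rule infsum_cmult_right')
  finally show ?thesis by (rule sym)
qed

text \<open>Deduced from Poisson summation for \<open>\<Lambda>\<close>, without a basis of the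
  neighbour: twice either side is a sum of four sums over \<open>\<Lambda>\<close>, one for each
  choice of adding \<open>w\<close> to the shift and to the character, and Poisson summation
  exchanges these two roles.\<close>

theorem poisson_neighbour:
  assumes w: "w \<in> shadow \<Lambda>" and t: "t > 0"
  shows "(\<Sum>\<^sub>\<infinity>x\<in>neighbour w. complex_of_real (exp (- pi * t * ((x + a) \<bullet> (x + a))))) =
     of_real (1 / t ^ 12) * (\<Sum>\<^sub>\<infinity>y\<in>neighbour w. of_real (exp (- pi * (y \<bullet> y) / t)) * exp (2 * pi * \<i> * of_real (y \<bullet> a)))"
proof -
  define E where "E x = complex_of_real (exp (- pi * t * (x \<bullet> x)))" for x :: vec24
  define G where "G y = of_real (exp (- pi * (y \<bullet> y) / t)) * exp (2 * pi * \<i> * of_real (y \<bullet> a))" for y :: vec24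
  define P where "P a b = (\<Sum>\<^sub>\<infinity>x\<in>\<Lambda>. exp (of_real (- pi * t * ((x + a) \<bullet> (x + a))) + 2 * pi * \<i> * of_real (x \<bullet> b)))" for a b :: vec24
  define Q where "Q a b = (\<Sum>\<^sub>\<infinity>y\<in>\<Lambda>. exp (of_real (- pi * ((y - b) \<bullet> (y - b)) / t) + 2 * pi * \<i> * of_real ((y - b) \<bullet> a)))" for a b :: vec24
  have PQ: "P a b = of_real (1 / t ^ 12) * Q a b" for a b
    unfolding P_def Q_def by (rule poisson_selfdual(2) [OF selfdual t])
  have sE: "(\<lambda>x. E (x + b)) summable_on \<Lambda>" "(\<lambda>x. exp (2 * pi * \<i> * of_real (x \<bullet> w)) * E (x + b)) summable_on \<Lambda>" for b
    by (rule summable_on_norm_le [OF poisson_selfdual(1) [OF selfdual t, of b]]; simp add: E_def norm_mult)+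
  have sG: "(\<lambda>x. G (x - b)) summable_on \<Lambda>" "(\<lambda>x. exp (2 * pi * \<i> * of_real (x \<bullet> w)) * G (x - b)) summable_on \<Lambda>" for b
  proof -
    have s: "(\<lambda>x. exp (- pi * (1 / t) * ((x + - b) \<bullet> (x + - b)))) summable_on \<Lambda>"
      using t by (intro poisson_selfdual(1) [OF selfdual]) simp
    show "(\<lambda>x. G (x - b)) summable_on \<Lambda>" "(\<lambda>x. exp (2 * pi * \<i> * of_real (x \<bullet> w)) * G (x - b)) summable_on \<Lambda>"
      by (rule summable_on_norm_le [OF s]; simp add: G_def norm_mult)+
  qed
  have Eexp: "E (x + b) = exp (of_real (- pi * t * ((x + b) \<bullet> (x + b))) + 2 * pi * \<i> * of_real (x \<bullet> 0))"
    "exp (2 * pi * \<i> * of_real (x \<bullet> w)) * E (x + b) = exp (of_real (- pi * t * ((x + b) \<bullet> (x + b))) + 2 * pi * \<i> * of_real (x \<bullet> w))" for x b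
    unfolding E_def exp_of_real [symmetric] exp_add by (simp only: inner_zero_right of_real_0 mult_zero_right exp_zero mult_1_right, rule mult.commute)
  have Psum: "2 * (\<Sum>\<^sub>\<infinity>x\<in>even_part \<Lambda>. E (x + b)) = P b 0 + P b w" for b
    unfolding P_def Eexp [symmetric] by (rule infsum_even_part [OF w sE])
  have ew: "exp (2 * pi * \<i> * of_real (w \<bullet> w)) = 1" by (intro exp_2pi_i_Ints shadow_norm_Ints w)
  have Gexp: "G (x - b) = exp (of_real (- pi * ((x - b) \<bullet> (x - b)) / t) + 2 * pi * \<i> * of_real ((x - b) \<bullet> a))" for x b
    unfolding G_def exp_of_real [symmetric] exp_add ..
  \<comment> \<open>For \<open>b = w\<close> the phases of \<open>x - b\<close> and of
    \<open>x\<close> differ by \<open>w \<bullet> w\<close>, which is an integer.\<close>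
  have Gexp2: "exp (2 * pi * \<i> * of_real (x \<bullet> w)) * G (x - b) = exp (of_real (- pi * ((x - b) \<bullet> (x - b)) / t) + 2 * pi * \<i> * of_real ((x - b) \<bullet> (w + a)))"
    if "b = 0 \<or> b = w" for x b
  proof -
    have "exp (2 * pi * \<i> * of_real ((x - b) \<bullet> w)) = exp (2 * pi * \<i> * of_real (x \<bullet> w))"
    proof (cases "b = 0")
      case False
      then have "b = w" using that by simp
      moreover have "2 * pi * \<i> * of_real ((x - w) \<bullet> w) + 2 * pi * \<i> * of_real (w \<bullet> w) = 2 * pi * \<i> * of_real (x \<bullet> w)"
        by (simp add: inner_diff_left ring_distribs)
      then have "exp (2 * pi * \<i> * of_real ((x - w) \<bullet> w)) * exp (2 * pi * \<i> * of_real (w \<bullet> w)) = exp (2 * pi * \<i> * of_real (x \<bullet> w))"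
        by (simp only: exp_add [symmetric])
      ultimately show ?thesis by (simp only: ew mult_1_right)
    qed simp
    moreover have "2 * pi * \<i> * of_real ((x - b) \<bullet> (w + a)) = 2 * pi * \<i> * of_real ((x - b) \<bullet> w) + 2 * pi * \<i> * of_real ((x - b) \<bullet> a)"
      by (simp add: inner_add_right ring_distribs)
    ultimately show ?thesis unfolding Gexp by (simp only: exp_add mult_ac)
  qed
  have Qsum: "2 * (\<Sum>\<^sub>\<infinity>x\<in>even_part \<Lambda>. G (x - b)) = Q a b + Q (w + a) b" if "b = 0 \<or> b = w" for b
    unfolding Q_def Gexp [symmetric] Gexp2 [OF that, symmetric] by (rule infsum_even_part [OF w sG])
  have disj: "even_part \<Lambda> \<inter> (\<lambda>x. x + w) ` even_part \<Lambda> = {}"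
  proof -
    have "x + w \<notin> \<Lambda>" if "x \<in> even_part \<Lambda>" for x
      using shadow_add_mem [OF w even_part_subset [OF that]] by (simp add: shadow_def add.commute)
    then show ?thesis using even_part_subset by blast
  qed
  have bij: "bij_betw (\<lambda>x. x + w) (even_part \<Lambda>) ((\<lambda>x. x + w) ` even_part \<Lambda>)"
    by (rule bij_betw_imageI) auto
  \<comment> \<open>As \<open>2 *\<^sub>R w\<close> is even, the coset of \<open>w\<close> is also
    the coset of \<open>- w\<close>, the form in which the dual side produces it.\<close>
  have bij': "bij_betw (\<lambda>x. x - w) (even_part \<Lambda>) ((\<lambda>x. x + w) ` even_part \<Lambda>)"
  proof (rule bij_betwI [of _ _ _ "\<lambda>x. x + w"])
    show "(\<lambda>x. x - w) \<in> even_part \<Lambda> \<rightarrow> (\<lambda>x. x + w) ` even_part \<Lambda>"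
    proof
      fix x assume "x \<in> even_part \<Lambda>"
      then have "x - 2 *\<^sub>R w \<in> even_part \<Lambda>" using double_shadow_even [OF w] by (rule even_part_diff)
      then show "x - w \<in> (\<lambda>x. x + w) ` even_part \<Lambda>" by (rule rev_image_eqI) (simp add: scaleR_2)
    qed
    show "(\<lambda>x. x + w) \<in> (\<lambda>x. x + w) ` even_part \<Lambda> \<rightarrow> even_part \<Lambda>"
    proof
      fix y assume "y \<in> (\<lambda>x. x + w) ` even_part \<Lambda>"
      then obtain x where x: "x \<in> even_part \<Lambda>" "y = x + w" by blast
      then have "x + 2 *\<^sub>R w \<in> even_part \<Lambda>" using double_shadow_even [OF w] by (intro even_part_add)
      then show "y + w \<in> even_part \<Lambda>" using x by (simp add: scaleR_2 add.assoc)
    qed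
  qed auto
  have subE: "(\<lambda>x. E (x + b)) summable_on even_part \<Lambda>" and subG: "(\<lambda>x. G (x - b)) summable_on even_part \<Lambda>" for b
    using sE(1) [of b] sG(1) [of b] even_part_subset by (auto intro: summable_on_subset)
  have "(\<Sum>\<^sub>\<infinity>x\<in>neighbour w. E (x + a)) = (\<Sum>\<^sub>\<infinity>x\<in>even_part \<Lambda>. E (x + a)) + (\<Sum>\<^sub>\<infinity>x\<in>(\<lambda>x. x + w) ` even_part \<Lambda>. E (x + a))"
    unfolding neighbour_def
  proof (rule infsum_Un_disjoint [OF _ _ disj])
    show "(\<lambda>x. E (x + a)) summable_on (\<lambda>x. x + w) ` even_part \<Lambda>"
      using subE [of "w + a"] by (subst summable_on_reindex_bij_betw [OF bij, symmetric]) (simp add: add.assoc)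
  qed (rule subE)
  also have "(\<Sum>\<^sub>\<infinity>x\<in>(\<lambda>x. x + w) ` even_part \<Lambda>. E (x + a)) = (\<Sum>\<^sub>\<infinity>x\<in>even_part \<Lambda>. E (x + (w + a)))"
    by (subst infsum_reindex_bij_betw [OF bij, symmetric]) (simp add: add.assoc)
  finally have lhs: "2 * (\<Sum>\<^sub>\<infinity>x\<in>neighbour w. E (x + a)) = (P a 0 + P a w) + (P (w + a) 0 + P (w + a) w)"
    by (simp only: distrib_left Psum)
  have "(\<Sum>\<^sub>\<infinity>x\<in>neighbour w. G x) = (\<Sum>\<^sub>\<infinity>x\<in>even_part \<Lambda>. G x) + (\<Sum>\<^sub>\<infinity>x\<in>(\<lambda>x. x + w) ` even_part \<Lambda>. G x)"
    unfolding neighbour_def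
  proof (rule infsum_Un_disjoint [OF _ _ disj])
    show "G summable_on (\<lambda>x. x + w) ` even_part \<Lambda>"
      using subG [of w] by (subst summable_on_reindex_bij_betw [OF bij', symmetric])
    show "G summable_on even_part \<Lambda>" using subG [of 0] by simp
  qed
  also have "(\<Sum>\<^sub>\<infinity>x\<in>(\<lambda>x. x + w) ` even_part \<Lambda>. G x) = (\<Sum>\<^sub>\<infinity>x\<in>even_part \<Lambda>. G (x - w))"
    by (subst infsum_reindex_bij_betw [OF bij', symmetric]) (rule refl)
  finally have rhs: "2 * (\<Sum>\<^sub>\<infinity>x\<in>neighbour w. G x) = (Q a 0 + Q (w + a) 0) + (Q a w + Q (w + a) w)"
    using Qsum [of 0] Qsum [of w] by (simp only: distrib_left diff_0_right simp_thms)
  have "2 * (\<Sum>\<^sub>\<infinity>x\<in>neighbour w. E (x + a)) = of_real (1 / t ^ 12) * (2 * (\<Sum>\<^sub>\<infinity>x\<in>neighbour w. G x))"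
    unfolding lhs rhs PQ by (simp only: distrib_left add_ac)
  then have "(\<Sum>\<^sub>\<infinity>x\<in>neighbour w. E (x + a)) = of_real (1 / t ^ 12) * (\<Sum>\<^sub>\<infinity>x\<in>neighbour w. G x)"
    by (simp only: mult.left_commute [of _ 2] mult_cancel_left) simp
  then show ?thesis by (simp only: E_def G_def)
qed

end

section \<open>Eutactic root systems\<close>

lemma sum_Basis_inner_squared: "(\<Sum>e\<in>Basis. (x \<bullet> e)\<^sup>2) = x \<bullet> x"
  unfolding power2_eq_square by (rule euclidean_inner [symmetric])

lemma component_subset: "component S r \<subseteq> S"
  by (auto simp: component_def)

lemma mem_component: "r \<in> S \<Longrightarrow> r \<in> component S r"
  by (simp add: component_def)

lemma component_orthogonal:
  assumes "s \<in> S" "s \<notin> component S r" "c \<in> component S r"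
  shows "s \<bullet> c = 0"
proof (rule ccontr)
  assume "s \<bullet> c \<noteq> 0"
  then have "(c, s) \<in> {(a, b). a \<in> S \<and> b \<in> S \<and> a \<bullet> b \<noteq> 0}"
    using assms by (simp add: component_def inner_commute)
  then have "s \<in> component S r" using assms unfolding component_def by (auto intro: rtrancl_into_rtrancl)
  then show False using assms by simp
qed

lemma parseval_orthonormal:
  fixes E :: "'a::euclidean_space set"
  assumes "pairwise orthogonal E" "\<And>e. e \<in> E \<Longrightarrow> norm e = 1" "finite E" "s \<in> span E"
  shows "(\<Sum>e\<in>E. (s \<bullet> e)\<^sup>2) = s \<bullet> s"
proof -
  have "s = (\<Sum>e\<in>E. (s \<bullet> e) *\<^sub>R e)"
    using orthonormal_basis_expand [OF assms(1,2,4,3)] by simp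
  then have "s \<bullet> s = s \<bullet> (\<Sum>e\<in>E. (s \<bullet> e) *\<^sub>R e)" by simp
  then show ?thesis by (simp add: inner_sum_right power2_eq_square)
qed

text \<open>Vectors of \<open>S\<close> inside the component lie in its span and contribute their
  norm 2 by Parseval; those outside are orthogonal to the span and contribute nothing.\<close>

lemma component_trace:
  fixes S :: "vec24 set"
  assumes S: "finite S" "\<And>s. s \<in> S \<Longrightarrow> s \<bullet> s = 2"
  obtains E where "finite E" "card E = dim (span (component S r))" "\<And>e. e \<in> E \<Longrightarrow> e \<bullet> e = 1" "E \<subseteq> span (component S r)"
    "(\<Sum>e\<in>E. \<Sum>s\<in>S. (s \<bullet> e)\<^sup>2) = 2 * real (card (component S r))"
proof -
  let ?C = "component S r"
  obtain E where E: "E \<subseteq> span ?C" "pairwise orthogonal E" "\<And>x. x \<in> E \<Longrightarrow> norm x = 1" "independent E"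
    "card E = dim (span ?C)" "span E = span ?C"
    by (rule orthonormal_basis_subspace [OF subspace_span, of ?C]) (rule that)
  have fE: "finite E" using E(4) by (rule independent_imp_finite)
  have in_C: "(\<Sum>e\<in>E. (s \<bullet> e)\<^sup>2) = 2" if "s \<in> ?C" for s
  proof -
    have "s \<in> span E" unfolding E(6) using that by (rule span_base)
    then have "(\<Sum>e\<in>E. (s \<bullet> e)\<^sup>2) = s \<bullet> s" by (intro parseval_orthonormal E fE)
    then show ?thesis using S(2) [OF subsetD [OF component_subset that]] by simp
  qed
  have out_C: "(\<Sum>e\<in>E. (s \<bullet> e)\<^sup>2) = 0" if "s \<in> S - ?C" for s
  proof -
    have "s \<bullet> e = 0" if "e \<in> span ?C" for e
      using that
    proof (induction rule: span_induct_alt)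
      case (step c x y)
      then show ?case using component_orthogonal [of s S r x] \<open>s \<in> S - ?C\<close> by (simp add: inner_add_right)
    qed simp
    then show ?thesis using E(1) by (intro sum.neutral) auto
  qed
  have "(\<Sum>e\<in>E. \<Sum>s\<in>S. (s \<bullet> e)\<^sup>2) = (\<Sum>s\<in>S. \<Sum>e\<in>E. (s \<bullet> e)\<^sup>2)" by (rule sum.swap)
  also have "\<dots> = (\<Sum>s\<in>?C. \<Sum>e\<in>E. (s \<bullet> e)\<^sup>2)"
    by (rule sum.mono_neutral_right [OF S(1) component_subset ballI [OF out_C]])
  also have "\<dots> = 2 * real (card ?C)" using in_C by simp
  finally have tr: "(\<Sum>e\<in>E. \<Sum>s\<in>S. (s \<bullet> e)\<^sup>2) = 2 * real (card ?C)" .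
  have "e \<bullet> e = 1" if "e \<in> E" for e using E(3) [OF that] by (simp add: norm_eq_1)
  then show thesis by (rule that [OF fE E(5) _ E(1) tr])
qed

text \<open>By \<open>component_trace\<close>, the trace over the span of a component is twice the
  size of the component; by hypothesis it is the dimension times \<open>card S / 12\<close>. So all
  components have Coxeter number \<open>card S / 24\<close>. If \<open>S\<close> does not span, a
  nonzero vector orthogonal to it forces \<open>card S = 0\<close>.\<close>

lemma eutactic_imp_strongly_eutactic:
  fixes S :: "vec24 set"
  assumes S: "finite S" "\<And>s. s \<in> S \<Longrightarrow> s \<bullet> s = 2"
    and eu: "\<And>u. (\<Sum>s\<in>S. (s \<bullet> u)\<^sup>2) = real (card S) / 12 * (u \<bullet> u)"
  shows "strongly_eutactic S"
  unfolding strongly_eutactic_def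
proof (intro exI [of _ "real (card S) / 24"] conjI ballI impI)
  fix r
  obtain E where E: "finite E" "card E = dim (span (component S r))" "\<And>e. e \<in> E \<Longrightarrow> e \<bullet> e = 1" "E \<subseteq> span (component S r)"
    "(\<Sum>e\<in>E. \<Sum>s\<in>S. (s \<bullet> e)\<^sup>2) = 2 * real (card (component S r))"
    by (rule component_trace [OF S, of r]) (assumption, rule that)
  have "(\<Sum>e\<in>E. \<Sum>s\<in>S. (s \<bullet> e)\<^sup>2) = real (card E) * (real (card S) / 12)" using E(3) by (simp add: eu)
  then show "real (card (component S r)) = real (card S) / 24 * real (dim (span (component S r)))"
    using E(2,5) by (simp add: mult.commute)
next
  assume "span S \<noteq> UNIV"
  then have "dim S < DIM(vec24)"
    using dim_eq_full [of S] dim_subset_UNIV [of S] by linarith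
  then obtain u where u: "u \<noteq> 0" "\<And>y. y \<in> span S \<Longrightarrow> orthogonal u y"
    by (rule orthogonal_to_subspace_exists) (rule that)
  have "(\<Sum>s\<in>S. (s \<bullet> u)\<^sup>2) = 0"
    using u(2) by (intro sum.neutral) (auto simp: orthogonal_def inner_commute span_base)
  then show "real (card S) / 24 = 0" using eu [of u] u(1) by simp
qed

text \<open>\<open>A\<close> is the symmetric operator of the quadratic form. Reflection in a root
  permutes \<open>R\<close>, so every root is an eigenvector; roots that are not orthogonal share
  their eigenvalue, which is therefore constant on a component, and the trace gives
  \<open>2 * h\<close>. A nonempty \<open>R\<close> has \<open>h \<noteq> 0\<close>, so it spans and
  \<open>A\<close> is a scalar.\<close>

lemma strongly_eutactic_imp_eutactic:
  fixes R :: "vec24 set"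
  assumes R: "root_system_norm2 R" "R \<noteq> {}" and se: "strongly_eutactic R"
  shows "(\<Sum>r\<in>R. (r \<bullet> u)\<^sup>2) = real (card R) / 12 * (u \<bullet> u)"
proof -
  have fin: "finite R" and n2: "\<And>r. r \<in> R \<Longrightarrow> r \<bullet> r = 2"
    and refl: "\<And>r s. r \<in> R \<Longrightarrow> s \<in> R \<Longrightarrow> s - (s \<bullet> r) *\<^sub>R r \<in> R"
    using R(1) unfolding root_system_norm2_def by blast+
  obtain h where h: "\<And>r. r \<in> R \<Longrightarrow> real (card (component R r)) = h * real (dim (span (component R r)))"
    and h0: "span R \<noteq> UNIV \<Longrightarrow> h = 0"
    using se unfolding strongly_eutactic_def by blast
  have card_pos: "card (component R r) > 0" if "r \<in> R" for r
    using mem_component [OF that] finite_subset [OF component_subset fin] by (auto simp: card_gt_0_iff)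
  obtain r0 where r0: "r0 \<in> R" using R(2) by blast
  have "h \<noteq> 0" using h [OF r0] card_pos [OF r0] by auto
  then have sp: "span R = UNIV" using h0 by blast
  define A where "A x = (\<Sum>s\<in>R. (s \<bullet> x) *\<^sub>R s)" for x
  have lin: "linear A" unfolding A_def
    by (intro linearI) (simp_all add: inner_add_right scaleR_add_left sum.distrib scaleR_sum_right)
  have Ainner: "A x \<bullet> y = (\<Sum>s\<in>R. (s \<bullet> x) * (s \<bullet> y))" for x y by (simp add: A_def inner_sum_left)
  define l where "l r = (\<Sum>s\<in>R. (s \<bullet> r)\<^sup>2) / 2" for r
  have Ar: "A r = l r *\<^sub>R r" if r: "r \<in> R" for r
  proof -
    let ?\<sigma> = "\<lambda>s. s - (s \<bullet> r) *\<^sub>R r"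
    have inv: "?\<sigma> (?\<sigma> s) = s" for s using n2 [OF r] by (simp add: inner_diff_left scaleR_diff_left)
    have bij: "bij_betw ?\<sigma> R R"
    proof (rule bij_betwI [of _ _ _ ?\<sigma>])
      show "?\<sigma> \<in> R \<rightarrow> R" using refl [OF r] by (rule Pi_I)
      then show "?\<sigma> \<in> R \<rightarrow> R" .
    qed (rule inv)+
    have "A r = (\<Sum>s\<in>R. (?\<sigma> s \<bullet> r) *\<^sub>R ?\<sigma> s)"
      unfolding A_def by (rule sum.reindex_bij_betw [OF bij, symmetric])
    also have "\<dots> = (\<Sum>s\<in>R. (s \<bullet> r)\<^sup>2 *\<^sub>R r - (s \<bullet> r) *\<^sub>R s)"
      using n2 [OF r] by (intro sum.cong) (auto simp: inner_diff_left algebra_simps power2_eq_square)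
    also have "\<dots> = (\<Sum>s\<in>R. (s \<bullet> r)\<^sup>2) *\<^sub>R r - A r"
      by (simp add: sum_subtractf A_def scaleR_sum_left)
    finally have "2 *\<^sub>R A r = (\<Sum>s\<in>R. (s \<bullet> r)\<^sup>2) *\<^sub>R r" by (simp add: scaleR_2 eq_diff_eq)
    then have "(1 / 2) *\<^sub>R (2 *\<^sub>R A r) = (1 / 2) *\<^sub>R ((\<Sum>s\<in>R. (s \<bullet> r)\<^sup>2) *\<^sub>R r)" by (simp only:)
    then show ?thesis by (simp add: l_def)
  qed
  have l_eq: "l r = l s" if "r \<in> R" "s \<in> R" "r \<bullet> s \<noteq> 0" for r s
  proof -
    have "A r \<bullet> s = A s \<bullet> r" unfolding Ainner by (simp add: mult.commute)
    then show ?thesis using that by (simp add: Ar inner_commute)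
  qed
  have l_comp: "l s = l r" if r: "r \<in> R" and s: "s \<in> component R r" for r s
  proof -
    have "(r, s) \<in> {(a, b). a \<in> R \<and> b \<in> R \<and> a \<bullet> b \<noteq> 0}\<^sup>*" using s by (simp add: component_def)
    then show ?thesis by (induction rule: rtrancl_induct) (use l_eq in auto)
  qed
  have l2h: "l r = 2 * h" if r: "r \<in> R" for r
  proof -
    obtain E where E: "finite E" "card E = dim (span (component R r))" "\<And>e. e \<in> E \<Longrightarrow> e \<bullet> e = 1" "E \<subseteq> span (component R r)"
      "(\<Sum>e\<in>E. \<Sum>s\<in>R. (s \<bullet> e)\<^sup>2) = 2 * real (card (component R r))"
      by (rule component_trace [OF fin n2, of r]) (assumption, rule that)
    have Ae: "A x = l r *\<^sub>R x" if "x \<in> span (component R r)" for x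
      using that
    proof (induction rule: span_induct_alt)
      case base
      then show ?case using lin by (simp add: linear_0)
    next
      case (step c x y)
      then have "x \<in> R" using component_subset by blast
      then show ?case using step l_comp [OF r] lin Ar
        by (simp add: linear_add linear_scale scaleR_add_right)
    qed
    have "(\<Sum>s\<in>R. (s \<bullet> e)\<^sup>2) = l r" if "e \<in> E" for e
    proof -
      have "(\<Sum>s\<in>R. (s \<bullet> e)\<^sup>2) = A e \<bullet> e" by (simp add: Ainner power2_eq_square)
      then show ?thesis using Ae [of e] E(3) [OF that] E(4) that by auto
    qed
    then have "real (card E) * l r = 2 * (h * real (card E))" using E(5) h [OF r] E(2) by simp
    moreover have "card E \<noteq> 0"
    proof
      assume "card E = 0"
      then show False using h [OF r] card_pos [OF r] unfolding E(2) [symmetric] by simp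
    qed
    ultimately show ?thesis by simp
  qed
  have A2h: "A x = (2 * h) *\<^sub>R x" for x
  proof -
    have "x \<in> span R" by (simp add: sp)
    then show ?thesis
    proof (induction rule: span_induct_alt)
      case base
      then show ?case using lin by (simp add: linear_0)
    next
      case (step c x y)
      then show ?case using lin Ar l2h by (simp add: linear_add linear_scale scaleR_add_right)
    qed
  qed
  have eu: "(\<Sum>r\<in>R. (r \<bullet> x)\<^sup>2) = 2 * h * (x \<bullet> x)" for x
  proof -
    have "(\<Sum>r\<in>R. (r \<bullet> x)\<^sup>2) = A x \<bullet> x" by (simp add: Ainner power2_eq_square)
    then show ?thesis by (simp add: A2h)
  qed
  \<comment> \<open>The trace over the whole space expresses \<open>h\<close> by the number of
    roots.\<close>
  have "(\<Sum>e\<in>(Basis :: vec24 set). \<Sum>r\<in>R. (r \<bullet> e)\<^sup>2) = (\<Sum>r\<in>R. \<Sum>e\<in>Basis. (r \<bullet> e)\<^sup>2)" by (rule sum.swap)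
  also have "\<dots> = (\<Sum>r\<in>R. r \<bullet> r)" by (simp only: sum_Basis_inner_squared)
  also have "\<dots> = 2 * real (card R)" by (simp add: n2)
  finally have "2 * h * 24 = 2 * real (card R)" by (simp add: eu)
  then have "2 * h = real (card R) / 12" by simp
  then show ?thesis using eu by simp
qed

section \<open>Harmonic theta functions of even neighbours\<close>

text \<open>The linear terms cancel, and the Taylor remainders of the two exponentials, each of
  third order, add up.\<close>

lemma exp_plus_exp_minus_bound:
  fixes w :: complex
  shows "norm (exp w + exp (- w) - 2 - w\<^sup>2) \<le> norm w ^ 3 * exp (norm w)"
proof -
  have *: "norm (exp z - (1 + z + z\<^sup>2 / 2)) \<le> exp (norm z) * norm z ^ 3 / 2" for z :: complex
  proof -
    have "norm (exp z - (\<Sum>k\<le>2. z ^ k / fact k)) \<le> exp \<bar>Re z\<bar> * norm z ^ Suc 2 / fact 2" by (rule Taylor_exp)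
    also have "(\<Sum>k\<le>2. z ^ k / fact k) = 1 + z + z\<^sup>2 / 2" by (simp add: numeral_2_eq_2)
    also have "exp \<bar>Re z\<bar> * norm z ^ Suc 2 / fact 2 \<le> exp (norm z) * norm z ^ 3 / 2"
      using abs_Re_le_cmod [of z] by (simp add: numeral_3_eq_3 numeral_2_eq_2 mult_right_mono)
    finally show ?thesis .
  qed
  have "exp w + exp (- w) - 2 - w\<^sup>2 = (exp w - (1 + w + w\<^sup>2 / 2)) + (exp (- w) - (1 + - w + (- w)\<^sup>2 / 2))"
    by simp
  then have "norm (exp w + exp (- w) - 2 - w\<^sup>2) \<le> exp (norm w) * norm w ^ 3 / 2 + exp (norm (- w)) * norm (- w) ^ 3 / 2"
    by (simp only:) (intro norm_triangle_mono *)
  then show ?thesis by (simp add: mult.commute)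
qed

lemma power_le_fact_exp:
  fixes r :: real
  assumes "r \<ge> 0" shows "r ^ n \<le> fact n * exp r"
proof -
  have "(\<lambda>k. r ^ k / fact k) sums exp r" using exp_converges [of r] by (simp add: divide_inverse mult.commute)
  then have "(\<Sum>k\<in>{n}. r ^ k / fact k) \<le> exp r"
    using assms by (metis (no_types, lifting) sum_le_suminf sums_iff finite.emptyI finite.insertI divide_nonneg_nonneg zero_le_power fact_ge_zero)
  then show ?thesis by (simp add: field_simps)
qed

text \<open>Replaces differentiating the Poisson formula twice with respect to the shift.\<close>

lemma gaussian_second_difference:
  fixes g :: "'a \<Rightarrow> real" and z :: "'a \<Rightarrow> complex"
  assumes g: "\<And>x. x \<in> X \<Longrightarrow> g x \<ge> 0" and s: "(\<lambda>x. g x * exp (2 * norm (z x))) summable_on X"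
  shows "((\<lambda>\<epsilon>. ((\<Sum>\<^sub>\<infinity>x\<in>X. of_real (g x) * exp (of_real \<epsilon> * z x)) + (\<Sum>\<^sub>\<infinity>x\<in>X. of_real (g x) * exp (- (of_real \<epsilon> * z x)))
            - 2 * (\<Sum>\<^sub>\<infinity>x\<in>X. of_real (g x))) / of_real (\<epsilon>\<^sup>2)) \<longlongrightarrow> (\<Sum>\<^sub>\<infinity>x\<in>X. of_real (g x) * (z x)\<^sup>2)) (at_right 0)"
proof -
  \<comment> \<open>The cube of \<open>norm (z x)\<close> in the remainder costs
    \<open>fact 3 = 6\<close> and one factor \<open>exp (norm (z x))\<close>; the exponential of the
    remainder itself is the second such factor.\<close>
  define K where "K = (\<Sum>\<^sub>\<infinity>x\<in>X. 6 * (g x * exp (2 * norm (z x))))"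
  have s2: "(\<lambda>x. 2 * (g x * exp (2 * norm (z x)))) summable_on X" "(\<lambda>x. 6 * (g x * exp (2 * norm (z x)))) summable_on X"
    by (rule summable_on_cmult_right [OF s])+
  let ?L = "\<lambda>\<epsilon>. \<Sum>\<^sub>\<infinity>x\<in>X. of_real (g x) * exp (of_real \<epsilon> * z x)"
  let ?L' = "\<lambda>\<epsilon>. \<Sum>\<^sub>\<infinity>x\<in>X. of_real (g x) * exp (- (of_real \<epsilon> * z x))"
  let ?G0 = "\<Sum>\<^sub>\<infinity>x\<in>X. complex_of_real (g x)"
  let ?G2 = "\<Sum>\<^sub>\<infinity>x\<in>X. of_real (g x) * (z x)\<^sup>2"
  have G0: "(\<lambda>x. complex_of_real (g x)) summable_on X"
  proof (rule summable_on_norm_le [OF s])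
    fix x assume x: "x \<in> X"
    have "g x * 1 \<le> g x * exp (2 * norm (z x))" using g [OF x] by (intro mult_left_mono) auto
    then show "norm (complex_of_real (g x)) \<le> g x * exp (2 * norm (z x))" using g [OF x] by simp
  qed
  have G2: "(\<lambda>x. of_real (g x) * (z x)\<^sup>2) summable_on X"
  proof (rule summable_on_norm_le [OF s2(1)])
    fix x assume x: "x \<in> X"
    have "norm (z x) ^ 2 \<le> fact 2 * exp (norm (z x))" by (rule power_le_fact_exp) simp
    also have "\<dots> \<le> 2 * exp (2 * norm (z x))" by simp
    finally have "g x * norm (z x) ^ 2 \<le> g x * (2 * exp (2 * norm (z x)))" using g [OF x] by (rule mult_left_mono)
    then show "norm (of_real (g x) * (z x)\<^sup>2) \<le> 2 * (g x * exp (2 * norm (z x)))"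
      using g [OF x] by (simp add: norm_mult norm_power)
  qed
  have L: "(\<lambda>x. of_real (g x) * exp (c * z x)) summable_on X" if c: "norm c \<le> 1" for c
  proof (rule summable_on_norm_le [OF s])
    fix x assume x: "x \<in> X"
    have "norm (c * z x) \<le> 1 * norm (z x)" unfolding norm_mult using c by (intro mult_right_mono) auto
    then have "norm (c * z x) \<le> 2 * norm (z x)" using norm_ge_zero [of "z x"] by linarith
    then have "exp (norm (c * z x)) \<le> exp (2 * norm (z x))" by (simp only: exp_le_cancel_iff)
    with norm_exp [of "c * z x"] have "norm (exp (c * z x)) \<le> exp (2 * norm (z x))" by (rule order_trans)
    then have "g x * norm (exp (c * z x)) \<le> g x * exp (2 * norm (z x))" using g [OF x] by (rule mult_left_mono)
    then show "norm (of_real (g x) * exp (c * z x)) \<le> g x * exp (2 * norm (z x))"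
      using g [OF x] by (simp only: norm_mult norm_of_real abs_of_nonneg)
  qed
  have bound: "norm ((?L \<epsilon> + ?L' \<epsilon> - 2 * ?G0) / of_real (\<epsilon>\<^sup>2) - ?G2) \<le> \<epsilon> * K" if \<epsilon>: "0 < \<epsilon>" "\<epsilon> < 1" for \<epsilon>
  proof -
    have 1: "((\<lambda>x. of_real (g x) * exp (of_real \<epsilon> * z x)) has_sum ?L \<epsilon>) X"
      using \<epsilon> by (intro has_sum_infsum L) simp
    have 2: "((\<lambda>x. of_real (g x) * exp (- (of_real \<epsilon> * z x))) has_sum ?L' \<epsilon>) X"
      using L [of "- of_real \<epsilon>"] \<epsilon> by (intro has_sum_infsum) (simp only: norm_minus_cancel norm_of_real mult_minus_left)
    have 3: "((\<lambda>x. 2 * complex_of_real (g x)) has_sum 2 * ?G0) X"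
      by (intro has_sum_cmult_right has_sum_infsum G0)
    have 4: "((\<lambda>x. of_real (\<epsilon>\<^sup>2) * (of_real (g x) * (z x)\<^sup>2)) has_sum of_real (\<epsilon>\<^sup>2) * ?G2) X"
      by (intro has_sum_cmult_right has_sum_infsum G2)
    have 5: "((\<lambda>x. \<epsilon> ^ 3 * (6 * (g x * exp (2 * norm (z x))))) has_sum \<epsilon> ^ 3 * K) X"
      unfolding K_def by (intro has_sum_cmult_right has_sum_infsum s2)
    have "norm ((?L \<epsilon> + ?L' \<epsilon> - 2 * ?G0) - of_real (\<epsilon>\<^sup>2) * ?G2) \<le> \<epsilon> ^ 3 * K"
    proof (rule norm_infsum_le [OF has_sum_minus [OF has_sum_minus [OF has_sum_add [OF 1 2] 3] 4] 5])
      fix x assume x: "x \<in> X"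
      let ?w = "of_real \<epsilon> * z x"
      have nw: "norm ?w = \<epsilon> * norm (z x)" using \<epsilon> by (simp add: norm_mult)
      have "norm (exp ?w + exp (- ?w) - 2 - ?w\<^sup>2) \<le> norm ?w ^ 3 * exp (norm ?w)" by (rule exp_plus_exp_minus_bound)
      also have "\<dots> \<le> (\<epsilon> ^ 3 * (fact 3 * exp (norm (z x)))) * exp (norm (z x))"
      proof (rule mult_mono)
        show "norm ?w ^ 3 \<le> \<epsilon> ^ 3 * (fact 3 * exp (norm (z x)))"
          unfolding nw power_mult_distrib using \<epsilon> by (intro mult_left_mono power_le_fact_exp) auto
        have "\<epsilon> * norm (z x) \<le> 1 * norm (z x)" using \<epsilon> by (intro mult_right_mono) auto
        then show "exp (norm ?w) \<le> exp (norm (z x))" unfolding nw by simp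
      qed (use \<epsilon> in auto)
      also have "\<dots> = \<epsilon> ^ 3 * (6 * exp (2 * norm (z x)))"
      proof -
        have "exp (norm (z x)) * exp (norm (z x)) = exp (2 * norm (z x))" by (simp only: exp_add [symmetric] mult_2)
        moreover have "fact 3 = (6 :: real)" by (simp add: fact_numeral)
        ultimately show ?thesis by (simp only: mult.assoc)
      qed
      finally have "g x * norm (exp ?w + exp (- ?w) - 2 - ?w\<^sup>2) \<le> g x * (\<epsilon> ^ 3 * (6 * exp (2 * norm (z x))))"
        using g [OF x] by (rule mult_left_mono)
      moreover have "of_real (g x) * exp ?w + of_real (g x) * exp (- ?w) - 2 * of_real (g x) - of_real (\<epsilon>\<^sup>2) * (of_real (g x) * (z x)\<^sup>2)
         = of_real (g x) * (exp ?w + exp (- ?w) - 2 - ?w\<^sup>2)" by (simp add: power_mult_distrib algebra_simps)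
      ultimately show "norm (of_real (g x) * exp ?w + of_real (g x) * exp (- ?w) - 2 * of_real (g x) - of_real (\<epsilon>\<^sup>2) * (of_real (g x) * (z x)\<^sup>2))
         \<le> \<epsilon> ^ 3 * (6 * (g x * exp (2 * norm (z x))))"
        using g [OF x] by (simp only: norm_mult norm_of_real abs_of_nonneg mult_ac)
    qed
    then have "norm ((?L \<epsilon> + ?L' \<epsilon> - 2 * ?G0) - of_real (\<epsilon>\<^sup>2) * ?G2) / \<epsilon>\<^sup>2 \<le> \<epsilon> ^ 3 * K / \<epsilon>\<^sup>2"
      using \<epsilon> by (intro divide_right_mono) auto
    also have "\<epsilon> ^ 3 * K / \<epsilon>\<^sup>2 = \<epsilon> * K" using \<epsilon> by (simp add: power2_eq_square power3_eq_cube)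
    also have "norm ((?L \<epsilon> + ?L' \<epsilon> - 2 * ?G0) - of_real (\<epsilon>\<^sup>2) * ?G2) / \<epsilon>\<^sup>2
        = norm (((?L \<epsilon> + ?L' \<epsilon> - 2 * ?G0) - of_real (\<epsilon>\<^sup>2) * ?G2) / of_real (\<epsilon>\<^sup>2))"
      by (simp only: norm_divide norm_of_real abs_power2)
    also have "((?L \<epsilon> + ?L' \<epsilon> - 2 * ?G0) - of_real (\<epsilon>\<^sup>2) * ?G2) / of_real (\<epsilon>\<^sup>2) = (?L \<epsilon> + ?L' \<epsilon> - 2 * ?G0) / of_real (\<epsilon>\<^sup>2) - ?G2"
    proof -
      have "(p - c * q) / c = p / c - q" if "c \<noteq> 0" for p q c :: complex
        using that by (simp add: diff_divide_distrib)
      then show ?thesis using \<epsilon> by simp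
    qed
    finally show ?thesis .
  qed
  show ?thesis
  proof (rule Lim_transform [OF tendsto_const])
    show "((\<lambda>\<epsilon>. (?L \<epsilon> + ?L' \<epsilon> - 2 * ?G0) / of_real (\<epsilon>\<^sup>2) - ?G2) \<longlongrightarrow> 0) (at_right 0)"
    proof (rule Lim_null_comparison [where g = "\<lambda>\<epsilon>. \<epsilon> * K"])
      have "eventually (\<lambda>\<epsilon>::real. \<epsilon> \<in> {0<..<1}) (at_right 0)" by (rule eventually_at_right_real) simp
      then show "\<forall>\<^sub>F \<epsilon> in at_right 0. norm ((?L \<epsilon> + ?L' \<epsilon> - 2 * ?G0) / of_real (\<epsilon>\<^sup>2) - ?G2) \<le> \<epsilon> * K"
      proof eventually_elim
        case (elim \<epsilon>)
        then show ?case using bound [of \<epsilon>] by (simp only: greaterThanLessThan_iff)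
      qed
      show "((\<lambda>\<epsilon>. \<epsilon> * K) \<longlongrightarrow> 0) (at_right 0)"
        by (rule tendsto_mult_left_zero) (rule tendsto_ident_at)
    qed
  qed
qed

text \<open>Cauchy-Schwarz and a completed square. It lets half of the decay of a Gaussian absorb
  the exponential of a linear form, on both sides of Poisson summation through
  \<open>\<kappa> = 1\<close> and \<open>\<kappa> = t\<close>.\<close>

lemma inner_le_weighted_squares:
  fixes x u :: "'a::euclidean_space"
  assumes "\<kappa> > 0" shows "4 * \<bar>x \<bullet> u\<bar> \<le> x \<bullet> x / (2 * \<kappa>) + 8 * \<kappa> * (u \<bullet> u)"
proof -
  have "0 \<le> (norm x - 4 * \<kappa> * norm u)\<^sup>2 / (2 * \<kappa>)" using assms by simp
  also have "\<dots> = x \<bullet> x / (2 * \<kappa>) + 8 * \<kappa> * (u \<bullet> u) - 4 * (norm x * norm u)"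
    using assms unfolding power2_norm_eq_inner [symmetric] by (simp add: power2_eq_square field_simps)
  finally show ?thesis using Cauchy_Schwarz_ineq2 [of x u] by linarith
qed

lemma has_sum_finite_sum:
  fixes f :: "'i \<Rightarrow> 'a \<Rightarrow> 'b :: real_normed_field"
  assumes "finite I" "\<And>i. i \<in> I \<Longrightarrow> (f i has_sum s i) A"
  shows "((\<lambda>x. \<Sum>i\<in>I. f i x) has_sum (\<Sum>i\<in>I. s i)) A"
  using assms
proof (induction I rule: finite_induct)
  case (insert i I)
  then have "(f i has_sum s i) A" "((\<lambda>x. \<Sum>i\<in>I. f i x) has_sum (\<Sum>i\<in>I. s i)) A" by simp_all
  then show ?case using insert.hyps by (simp add: has_sum_add)
qed simp

section \<open>Second moments of Gaussian sums and theta functions with harmonic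
  coefficients\<close>

definition gauss_sum :: "vec24 set \<Rightarrow> real \<Rightarrow> complex" where
  "gauss_sum M t = (\<Sum>\<^sub>\<infinity>x\<in>M. of_real (exp (- pi * t * (x \<bullet> x))))"

definition gauss_moment :: "vec24 set \<Rightarrow> vec24 \<Rightarrow> real \<Rightarrow> complex" where
  "gauss_moment M u t = (\<Sum>\<^sub>\<infinity>x\<in>M. of_real ((x \<bullet> u)\<^sup>2) * of_real (exp (- pi * t * (x \<bullet> x))))"

definition norm_nat :: "vec24 \<Rightarrow> nat" where "norm_nat x = nat \<lfloor>x \<bullet> x\<rfloor>"

text \<open>What the harmonic argument uses of an even neighbour. The shift \<open>a\<close> in the
  Poisson formula is arbitrary because the second moments arise from varying it.\<close>

locale even_poisson =
  fixes M :: "vec24 set"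
  assumes summ: "theta_summable (\<lambda>x. x \<bullet> x) (\<lambda>_. 1) M"
    and even_norm: "\<And>x. x \<in> M \<Longrightarrow> x \<bullet> x / 2 \<in> \<int>"
    and poisson: "\<And>t a. t > 0 \<Longrightarrow> (\<Sum>\<^sub>\<infinity>x\<in>M. complex_of_real (exp (- pi * t * ((x + a) \<bullet> (x + a))))) =
     of_real (1 / t ^ 12) * (\<Sum>\<^sub>\<infinity>y\<in>M. of_real (exp (- pi * (y \<bullet> y) / t)) * exp (2 * pi * \<i> * of_real (y \<bullet> a)))"
begin

lemma summable_gauss: assumes "t > 0" shows "(\<lambda>x. exp (- pi * t * (x \<bullet> x))) summable_on M"
  using theta_summableD [OF summ assms] by simp

text \<open>The second difference at 0 of the Poisson formula with shift
  \<open>\<epsilon> *\<^sub>R u\<close>. Expanding the norm of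
  \<open>x + \<epsilon> *\<^sub>R u\<close> splits off the factor
  \<open>exp (- c * \<epsilon>\<^sup>2)\<close>, and its second-order term accounts for
  \<open>gauss_sum\<close>.\<close>

lemma gauss_moment_inversion:
  assumes t: "t > 0"
  shows "4 * pi\<^sup>2 * t\<^sup>2 * gauss_moment M u t - 2 * pi * t * (u \<bullet> u) * gauss_sum M t = - (4 * pi\<^sup>2 / t ^ 12) * gauss_moment M u (1 / t)"
proof -
  define g where "g x = exp (- pi * t * (x \<bullet> x))" for x :: vec24
  define g' where "g' x = exp (- pi * (x \<bullet> x) / t)" for x :: vec24
  define z where "z x = complex_of_real (- 2 * pi * t * (x \<bullet> u))" for x
  define z' where "z' x = 2 * pi * \<i> * of_real (x \<bullet> u)" for x
  define c where "c = pi * t * (u \<bullet> u)"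
  define T where "T = complex_of_real (1 / t ^ 12)"
  let ?L = "\<lambda>\<epsilon>. \<Sum>\<^sub>\<infinity>x\<in>M. of_real (g x) * exp (of_real \<epsilon> * z x)"
  let ?L' = "\<lambda>\<epsilon>. \<Sum>\<^sub>\<infinity>x\<in>M. of_real (g x) * exp (- (of_real \<epsilon> * z x))"
  let ?R = "\<lambda>\<epsilon>. \<Sum>\<^sub>\<infinity>x\<in>M. of_real (g' x) * exp (of_real \<epsilon> * z' x)"
  let ?R' = "\<lambda>\<epsilon>. \<Sum>\<^sub>\<infinity>x\<in>M. of_real (g' x) * exp (- (of_real \<epsilon> * z' x))"
  let ?G = "\<Sum>\<^sub>\<infinity>x\<in>M. complex_of_real (g x)" and ?G' = "\<Sum>\<^sub>\<infinity>x\<in>M. complex_of_real (g' x)"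
  have key: "of_real (exp (- c * \<epsilon>\<^sup>2)) * (\<Sum>\<^sub>\<infinity>x\<in>M. of_real (g x) * exp (of_real \<epsilon> * z x)) = T * (\<Sum>\<^sub>\<infinity>x\<in>M. of_real (g' x) * exp (of_real \<epsilon> * z' x))" for \<epsilon>
  proof -
    have "complex_of_real (exp (- pi * t * ((x + \<epsilon> *\<^sub>R u) \<bullet> (x + \<epsilon> *\<^sub>R u)))) = of_real (exp (- c * \<epsilon>\<^sup>2)) * (of_real (g x) * exp (of_real \<epsilon> * z x))" for x
    proof -
      have "(x + \<epsilon> *\<^sub>R u) \<bullet> (x + \<epsilon> *\<^sub>R u) = x \<bullet> x + 2 * \<epsilon> * (x \<bullet> u) + \<epsilon>\<^sup>2 * (u \<bullet> u)"
        by (simp add: inner_add_left inner_add_right inner_commute power2_eq_square)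
      then have "- pi * t * ((x + \<epsilon> *\<^sub>R u) \<bullet> (x + \<epsilon> *\<^sub>R u)) = - c * \<epsilon>\<^sup>2 + (- pi * t * (x \<bullet> x) + \<epsilon> * (- 2 * pi * t * (x \<bullet> u)))"
        by (simp add: c_def algebra_simps)
      then show ?thesis by (simp only: exp_add of_real_mult [symmetric] exp_of_real g_def z_def)
    qed
    moreover have "2 * pi * \<i> * of_real (y \<bullet> (\<epsilon> *\<^sub>R u)) = of_real \<epsilon> * z' y" for y by (simp add: z'_def)
    ultimately show ?thesis using poisson [OF t, of "\<epsilon> *\<^sub>R u"]
      by (simp only: infsum_cmult_right' g'_def [symmetric] T_def)
  qed
  have key': "of_real (exp (- c * \<epsilon>\<^sup>2)) * ?L' \<epsilon> = T * ?R' \<epsilon>" for \<epsilon>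
    using key [of "- \<epsilon>"] by (simp only: of_real_minus mult_minus_left power2_minus)
  have key0: "?G = T * ?G'" using key [of 0] by simp
  have dom: "4 * (t * \<bar>x \<bullet> u\<bar>) \<le> t * (x \<bullet> x) / 2 + 8 * t * (u \<bullet> u)" "4 * \<bar>x \<bullet> u\<bar> \<le> (x \<bullet> x) / t / 2 + 8 * t * (u \<bullet> u)" for x
    using mult_left_mono [OF inner_le_weighted_squares [of 1 x u], of t] inner_le_weighted_squares [OF t, of x u] t
    by (simp_all add: algebra_simps)
  have s1: "(\<lambda>x. g x * exp (2 * norm (z x))) summable_on M"
  proof (rule summable_on_comparison_test)
    show "(\<lambda>x. exp (8 * pi * t * (u \<bullet> u)) * exp (- pi * (t / 2) * (x \<bullet> x))) summable_on M"
      using t by (intro summable_on_cmult_right summable_gauss) simp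
    fix x
    have "norm (z x) = 2 * pi * t * \<bar>x \<bullet> u\<bar>" unfolding z_def norm_of_real using t by (simp add: abs_mult)
    then have "- pi * t * (x \<bullet> x) + 2 * norm (z x) \<le> 8 * pi * t * (u \<bullet> u) + - pi * (t / 2) * (x \<bullet> x)"
      using mult_left_mono [OF dom(1) [of x], of pi] by (simp add: algebra_simps)
    then show "g x * exp (2 * norm (z x)) \<le> exp (8 * pi * t * (u \<bullet> u)) * exp (- pi * (t / 2) * (x \<bullet> x))"
      unfolding g_def exp_add [symmetric] by (simp only: exp_le_cancel_iff)
  qed (simp add: g_def)
  have s2: "(\<lambda>x. g' x * exp (2 * norm (z' x))) summable_on M"
  proof (rule summable_on_comparison_test)
    show "(\<lambda>x. exp (8 * pi * t * (u \<bullet> u)) * exp (- pi * (1 / t / 2) * (x \<bullet> x))) summable_on M"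
      using t by (intro summable_on_cmult_right summable_gauss) simp
    fix x
    have "norm (z' x) = 2 * pi * \<bar>x \<bullet> u\<bar>" by (simp add: z'_def norm_mult)
    then have "- pi * (x \<bullet> x) / t + 2 * norm (z' x) \<le> 8 * pi * t * (u \<bullet> u) + - pi * (1 / t / 2) * (x \<bullet> x)"
      using mult_left_mono [OF dom(2) [of x], of pi] by (simp add: algebra_simps)
    then show "g' x * exp (2 * norm (z' x)) \<le> exp (8 * pi * t * (u \<bullet> u)) * exp (- pi * (1 / t / 2) * (x \<bullet> x))"
      unfolding g'_def exp_add [symmetric] by (simp only: exp_le_cancel_iff)
  qed (simp add: g'_def)
  have limL: "((\<lambda>\<epsilon>. (?L \<epsilon> + ?L' \<epsilon> - 2 * ?G) / of_real (\<epsilon>\<^sup>2)) \<longlongrightarrow> (\<Sum>\<^sub>\<infinity>x\<in>M. of_real (g x) * (z x)\<^sup>2)) (at_right 0)"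
    by (rule gaussian_second_difference [OF _ s1]) (simp add: g_def)
  have limR: "((\<lambda>\<epsilon>. (?R \<epsilon> + ?R' \<epsilon> - 2 * ?G') / of_real (\<epsilon>\<^sup>2)) \<longlongrightarrow> (\<Sum>\<^sub>\<infinity>x\<in>M. of_real (g' x) * (z' x)\<^sup>2)) (at_right 0)"
    by (rule gaussian_second_difference [OF _ s2]) (simp add: g'_def)
  have e1: "((\<lambda>\<epsilon>. complex_of_real (exp (- c * \<epsilon>\<^sup>2))) \<longlongrightarrow> of_real 1) (at_right 0)"
    by (intro tendsto_of_real) real_asymp
  have e2: "((\<lambda>\<epsilon>. complex_of_real ((exp (- c * \<epsilon>\<^sup>2) - 1) / \<epsilon>\<^sup>2)) \<longlongrightarrow> of_real (- c)) (at_right 0)"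
    by (intro tendsto_of_real) real_asymp
  have "((\<lambda>\<epsilon>. of_real (exp (- c * \<epsilon>\<^sup>2)) * ((?L \<epsilon> + ?L' \<epsilon> - 2 * ?G) / of_real (\<epsilon>\<^sup>2)) + 2 * ?G * of_real ((exp (- c * \<epsilon>\<^sup>2) - 1) / \<epsilon>\<^sup>2))
     \<longlongrightarrow> of_real 1 * (\<Sum>\<^sub>\<infinity>x\<in>M. of_real (g x) * (z x)\<^sup>2) + 2 * ?G * of_real (- c)) (at_right 0)"
    by (intro tendsto_add tendsto_mult limL e1 e2 tendsto_const)
  moreover have "of_real (exp (- c * \<epsilon>\<^sup>2)) * ((?L \<epsilon> + ?L' \<epsilon> - 2 * ?G) / of_real (\<epsilon>\<^sup>2)) + 2 * ?G * of_real ((exp (- c * \<epsilon>\<^sup>2) - 1) / \<epsilon>\<^sup>2)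
     = T * ((?R \<epsilon> + ?R' \<epsilon> - 2 * ?G') / of_real (\<epsilon>\<^sup>2))" for \<epsilon>
  proof -
    have alg: "e * ((l + l' - 2 * G) / d) + 2 * G * ((e - 1) / d) = (e * l + e * l' - 2 * G) / d" for e l l' G d :: complex
      by (simp add: diff_divide_distrib add_divide_distrib algebra_simps)
    have alg2: "(T * r + T * r' - 2 * (T * G)) / d = T * ((r + r' - 2 * G) / d)" for r r' G d :: complex
      by (simp add: diff_divide_distrib add_divide_distrib algebra_simps)
    have "of_real (exp (- c * \<epsilon>\<^sup>2)) * ((?L \<epsilon> + ?L' \<epsilon> - 2 * ?G) / of_real (\<epsilon>\<^sup>2)) + 2 * ?G * of_real ((exp (- c * \<epsilon>\<^sup>2) - 1) / \<epsilon>\<^sup>2)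
      = (of_real (exp (- c * \<epsilon>\<^sup>2)) * ?L \<epsilon> + of_real (exp (- c * \<epsilon>\<^sup>2)) * ?L' \<epsilon> - 2 * ?G) / of_real (\<epsilon>\<^sup>2)"
      unfolding of_real_divide of_real_diff of_real_1 by (rule alg)
    also have "\<dots> = T * ((?R \<epsilon> + ?R' \<epsilon> - 2 * ?G') / of_real (\<epsilon>\<^sup>2))" unfolding key key' key0 by (rule alg2)
    finally show ?thesis .
  qed
  ultimately have "((\<lambda>\<epsilon>. T * ((?R \<epsilon> + ?R' \<epsilon> - 2 * ?G') / of_real (\<epsilon>\<^sup>2)))
     \<longlongrightarrow> of_real 1 * (\<Sum>\<^sub>\<infinity>x\<in>M. of_real (g x) * (z x)\<^sup>2) + 2 * ?G * of_real (- c)) (at_right 0)"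
    by (simp only:)
  moreover have "((\<lambda>\<epsilon>. T * ((?R \<epsilon> + ?R' \<epsilon> - 2 * ?G') / of_real (\<epsilon>\<^sup>2))) \<longlongrightarrow> T * (\<Sum>\<^sub>\<infinity>x\<in>M. of_real (g' x) * (z' x)\<^sup>2)) (at_right 0)"
    by (intro tendsto_mult limR tendsto_const)
  ultimately have main: "of_real 1 * (\<Sum>\<^sub>\<infinity>x\<in>M. of_real (g x) * (z x)\<^sup>2) + 2 * ?G * of_real (- c) = T * (\<Sum>\<^sub>\<infinity>x\<in>M. of_real (g' x) * (z' x)\<^sup>2)"
    by (rule tendsto_unique [rotated]) simp
  have Q: "(\<Sum>\<^sub>\<infinity>x\<in>M. of_real (g x) * (z x)\<^sup>2) = 4 * pi\<^sup>2 * t\<^sup>2 * gauss_moment M u t"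
    unfolding gauss_moment_def infsum_cmult_right' [symmetric]
    by (intro infsum_cong) (simp add: g_def z_def power_mult_distrib)
  have Q': "(\<Sum>\<^sub>\<infinity>x\<in>M. of_real (g' x) * (z' x)\<^sup>2) = - (4 * pi\<^sup>2) * gauss_moment M u (1 / t)"
    unfolding gauss_moment_def infsum_cmult_right' [symmetric]
    by (intro infsum_cong) (simp add: g'_def z'_def power_mult_distrib)
  have G: "?G = gauss_sum M t" by (simp add: gauss_sum_def g_def)
  show ?thesis using main unfolding Q Q' G c_def T_def by (simp add: mult_ac)
qed

text \<open>The trace-free part of \<open>(x \<bullet> u)\<^sup>2\<close>, with 24 as the
  dimension.\<close>

definition harmonic :: "vec24 \<Rightarrow> vec24 \<Rightarrow> complex" where
  "harmonic u x = of_real ((x \<bullet> u)\<^sup>2 - (u \<bullet> u) * (x \<bullet> x) / 24)"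

lemma summable_gauss_moment:
  assumes "t > 0" shows "(\<lambda>x. of_real ((x \<bullet> u)\<^sup>2) * complex_of_real (exp (- pi * t * (x \<bullet> x)))) summable_on M"
proof -
  have "theta_summable (\<lambda>x. x \<bullet> x) (\<lambda>x. of_real ((x \<bullet> u)\<^sup>2)) M"
  proof (rule theta_summable_mono [OF summ])
    fix x
    have "(x \<bullet> u)\<^sup>2 \<le> (x \<bullet> x) * (u \<bullet> u)" by (rule Cauchy_Schwarz_ineq)
    also have "\<dots> \<le> (u \<bullet> u) * (1 + x \<bullet> x)" by (simp add: algebra_simps)
    finally show "norm (complex_of_real ((x \<bullet> u)\<^sup>2)) \<le> (u \<bullet> u) * (1 + x \<bullet> x)" by (simp add: norm_power)
  qed simp
  from theta_summable_imp_summable_on [OF this, of "\<i> * of_real t"] assms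
  have "(\<lambda>x. of_real ((x \<bullet> u)\<^sup>2) * exp (pi * \<i> * (\<i> * of_real t) * of_real (x \<bullet> x))) summable_on M" by simp
  moreover have "pi * \<i> * (\<i> * of_real t) * of_real (x \<bullet> x) = complex_of_real (- pi * t * (x \<bullet> x))" for x :: vec24
    by (simp add: complex_eq_iff)
  ultimately show ?thesis by (simp only: exp_of_real)
qed

lemma theta_harmonic_axis:
  assumes t: "t > 0"
  shows "theta (\<lambda>x. x \<bullet> x) (harmonic u) M (\<i> * of_real t) =
    gauss_moment M u t - of_real (u \<bullet> u / 24) * (\<Sum>e\<in>Basis. gauss_moment M e t)"
proof -
  have "((\<lambda>x. of_real ((x \<bullet> u)\<^sup>2) * of_real (exp (- pi * t * (x \<bullet> x))) -
      of_real (u \<bullet> u / 24) * (\<Sum>e\<in>Basis. of_real ((x \<bullet> e)\<^sup>2) * of_real (exp (- pi * t * (x \<bullet> x))))) has_sum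
    (gauss_moment M u t - of_real (u \<bullet> u / 24) * (\<Sum>e\<in>Basis. gauss_moment M e t))) M"
    unfolding gauss_moment_def
    by (intro has_sum_minus has_sum_cmult_right has_sum_finite_sum has_sum_infsum summable_gauss_moment t finite_Basis)
  then have "(\<Sum>\<^sub>\<infinity>x\<in>M. of_real ((x \<bullet> u)\<^sup>2) * of_real (exp (- pi * t * (x \<bullet> x))) -
      of_real (u \<bullet> u / 24) * (\<Sum>e\<in>Basis. of_real ((x \<bullet> e)\<^sup>2) * of_real (exp (- pi * t * (x \<bullet> x))))) =
    gauss_moment M u t - of_real (u \<bullet> u / 24) * (\<Sum>e\<in>Basis. gauss_moment M e t)" by (rule infsumI)
  moreover have "harmonic u x * of_real (exp (- pi * t * (x \<bullet> x))) = of_real ((x \<bullet> u)\<^sup>2) * of_real (exp (- pi * t * (x \<bullet> x))) -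
      of_real (u \<bullet> u / 24) * (\<Sum>e\<in>Basis. of_real ((x \<bullet> e)\<^sup>2) * of_real (exp (- pi * t * (x \<bullet> x))))" for x
    unfolding sum_distrib_right [symmetric] of_real_sum [symmetric] sum_Basis_inner_squared harmonic_def
    by (simp add: algebra_simps)
  ultimately show ?thesis unfolding theta_imaginary_axis by (simp only:)
qed

lemma theta_summable_harmonic: "theta_summable (\<lambda>x. x \<bullet> x) (harmonic u) M"
proof (rule theta_summable_mono [OF summ])
  fix x
  have "norm (harmonic u x) \<le> \<bar>(x \<bullet> u)\<^sup>2\<bar> + \<bar>(u \<bullet> u) * (x \<bullet> x) / 24\<bar>"
    unfolding harmonic_def norm_of_real by (rule abs_triangle_ineq4)
  also have "\<dots> \<le> (x \<bullet> x) * (u \<bullet> u) + (u \<bullet> u) * (x \<bullet> x)"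
    using Cauchy_Schwarz_ineq [of x u] by (intro add_mono) auto
  also have "\<dots> \<le> 2 * (u \<bullet> u) * (1 + x \<bullet> x)" by (simp add: algebra_simps)
  finally show "norm (harmonic u x) \<le> 2 * (u \<bullet> u) * (1 + x \<bullet> x)" .
qed simp

text \<open>In \<open>gauss_moment_inversion\<close> the term with \<open>gauss_sum\<close> is
  proportional to \<open>u \<bullet> u\<close>. The sum over \<open>Basis\<close> yields it 24
  times, so it cancels in the trace-free combination and only the factor \<open>- t ^ 14\<close>,
  equal to \<open>(\<i> * of_real t) ^ 14\<close>, is left.\<close>

lemma theta_harmonic_inversion:
  assumes \<tau>: "Im \<tau> > 0"
  shows "theta (\<lambda>x. x \<bullet> x) (harmonic u) M (- 1 / \<tau>) = \<tau> ^ 14 * theta (\<lambda>x. x \<bullet> x) (harmonic u) M \<tau>"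
proof -
  have hol: "theta (\<lambda>x. x \<bullet> x) (harmonic u) M holomorphic_on {\<tau>. Im \<tau> > 0}"
    by (rule theta_holomorphic [OF theta_summable_harmonic]) simp
  have "theta (\<lambda>x. x \<bullet> x) (harmonic u) M (- 1 / \<tau>) = 1 * \<tau> ^ 14 * theta (\<lambda>x. x \<bullet> x) (harmonic u) M \<tau>"
  proof (rule theta_inversion_continuation [OF hol hol _ \<tau>])
    fix t :: real assume t: "t > 0"
    define A where "A v = gauss_moment M v t" for v
    define B where "B v = gauss_moment M v (1 / t)" for v
    define \<Theta> where "\<Theta> = gauss_sum M t"
    have eq: "B v = complex_of_real (t ^ 13 / (2 * pi)) * of_real (v \<bullet> v) * \<Theta> - of_real (t ^ 14) * A v" for v
    proof -
      have "complex_of_real (4 * pi\<^sup>2 / t ^ 12) * B v = 2 * pi * t * (v \<bullet> v) * \<Theta> - 4 * pi\<^sup>2 * t\<^sup>2 * A v"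
        using gauss_moment_inversion [OF t, of v] by (simp add: A_def B_def \<Theta>_def algebra_simps)
      then have "of_real (t ^ 12 / (4 * pi\<^sup>2)) * (complex_of_real (4 * pi\<^sup>2 / t ^ 12) * B v) =
         of_real (t ^ 12 / (4 * pi\<^sup>2)) * (2 * pi * t * (v \<bullet> v) * \<Theta> - 4 * pi\<^sup>2 * t\<^sup>2 * A v)" by (simp only:)
      moreover have "of_real (t ^ 12 / (4 * pi\<^sup>2)) * (complex_of_real (4 * pi\<^sup>2 / t ^ 12) * B v) = B v"
        using t by (simp add: mult.assoc [symmetric])
      moreover have "of_real (t ^ 12 / (4 * pi\<^sup>2)) * (2 * pi * t * (v \<bullet> v) * \<Theta> - 4 * pi\<^sup>2 * t\<^sup>2 * A v) =
         complex_of_real (t ^ 13 / (2 * pi)) * of_real (v \<bullet> v) * \<Theta> - of_real (t ^ 14) * A v"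
        by (simp add: field_simps power2_eq_square power_numeral_reduce)
      ultimately show ?thesis by (simp only:)
    qed
    have sumB: "(\<Sum>e\<in>Basis. B e) = complex_of_real (t ^ 13 / (2 * pi)) * 24 * \<Theta> - of_real (t ^ 14) * (\<Sum>e\<in>Basis. A e)"
    proof -
      have "(\<Sum>e\<in>(Basis::vec24 set). complex_of_real (t ^ 13 / (2 * pi)) * of_real (e \<bullet> e) * \<Theta>) = (\<Sum>e\<in>(Basis::vec24 set). complex_of_real (t ^ 13 / (2 * pi)) * \<Theta>)"
        by (intro sum.cong refl) simp
      then show ?thesis unfolding eq sum_subtractf sum_distrib_left [symmetric] by simp
    qed
    have "theta (\<lambda>x. x \<bullet> x) (harmonic u) M (\<i> * of_real (1 / t)) = B u - of_real (u \<bullet> u / 24) * (\<Sum>e\<in>Basis. B e)"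
      unfolding B_def using t by (intro theta_harmonic_axis) simp
    also have "\<dots> = - of_real (t ^ 14) * (A u - of_real (u \<bullet> u / 24) * (\<Sum>e\<in>Basis. A e))"
      unfolding sumB eq [of u] by (simp add: algebra_simps)
    also have "\<dots> = 1 * (\<i> * of_real t) ^ 14 * theta (\<lambda>x. x \<bullet> x) (harmonic u) M (\<i> * of_real t)"
    proof -
      have "\<i> ^ 14 = ((\<i>\<^sup>2)\<^sup>2) ^ 3 * \<i>\<^sup>2" by (simp only: power_mult [symmetric] power_add [symmetric]) simp
      then have "(\<i> * of_real t) ^ 14 = - complex_of_real (t ^ 14)" by (simp add: power_mult_distrib)
      then show ?thesis unfolding theta_harmonic_axis [OF t] A_def by simp
    qed
    finally show "theta (\<lambda>x. x \<bullet> x) (harmonic u) M (\<i> * of_real (1 / t)) = 1 * (\<i> * of_real t) ^ 14 * theta (\<lambda>x. x \<bullet> x) (harmonic u) M (\<i> * of_real t)" .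
  qed
  then show ?thesis by simp
qed

lemma even_norm_nat:
  assumes "x \<in> M" shows "x \<bullet> x = real (norm_nat x)" "even (norm_nat x)"
proof -
  obtain k where k: "x \<bullet> x / 2 = of_int k" using even_norm [OF assms] by (rule Ints_cases)
  then have xx: "x \<bullet> x = of_int (2 * k)" by simp
  have "k \<ge> 0" using k inner_ge_zero [of x] by (simp add: field_simps)
  then show "x \<bullet> x = real (norm_nat x)" unfolding norm_nat_def xx floor_of_int by simp
  have "norm_nat x = 2 * nat k" unfolding norm_nat_def xx floor_of_int using \<open>k \<ge> 0\<close> by simp
  then show "even (norm_nat x)" by simp
qed

text \<open>Norm 2 is the coefficient of \<open>w\<^sup>2\<close>, extracted by the second
  derivative at 0 of a series that vanishes identically. Its constant term is 0 since
  \<open>harmonic u 0 = 0\<close>, and on the shell the subtracted trace term is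
  \<open>2 * (u \<bullet> u) / 24\<close>.\<close>

theorem eutactic_shell:
  "(\<Sum>x\<in>shell M 2. (x \<bullet> u)\<^sup>2) = real (card (shell M 2)) / 12 * (u \<bullet> u)"
proof -
  let ?\<Phi> = "theta_series norm_nat (harmonic u) M"
  have fps: "?\<Phi> has_fps_expansion Abs_fps (theta_coeff norm_nat (harmonic u) M)" "?\<Phi> holomorphic_on ball 0 1"
    by (rule theta_series_fps [OF theta_summable_harmonic], erule even_norm_nat(1))+
  have ex: "?\<Phi> (exp (pi * \<i> * \<tau>)) = theta (\<lambda>x. x \<bullet> x) (harmonic u) M \<tau>" for \<tau>
    by (rule theta_series_exp) (erule even_norm_nat(1))
  have zero: "?\<Phi> w = 0" if "w \<in> ball 0 1" for w
  proof (rule weight14_cusp_form_eq_0 [OF fps(2) _ _ _ that])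
    show "?\<Phi> 0 = 0"
      unfolding theta_series_def
    proof (rule infsum_0)
      fix x assume "x \<in> M"
      show "harmonic u x * 0 ^ norm_nat x = 0"
      proof (cases "norm_nat x = 0")
        case True
        then have "x = 0" using even_norm_nat(1) [OF \<open>x \<in> M\<close>] by simp
        then show ?thesis by (simp add: harmonic_def)
      qed (simp add: zero_power)
    qed
    show "?\<Phi> (- w) = ?\<Phi> w" for w
      unfolding theta_series_def by (intro infsum_cong) (simp add: even_norm_nat(2) power_minus_even)
    show "?\<Phi> (exp (pi * \<i> * (- 1 / \<tau>))) = \<tau> ^ 14 * ?\<Phi> (exp (pi * \<i> * \<tau>))" if "Im \<tau> > 0" for \<tau>
      unfolding ex by (rule theta_harmonic_inversion [OF that])
  qed
  have "(deriv ^^ 2) ?\<Phi> 0 = (deriv ^^ 2) (\<lambda>_. 0) 0"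
  proof (rule higher_deriv_cong_ev)
    have "eventually (\<lambda>w. w \<in> ball 0 1) (nhds (0::complex))" by (intro eventually_nhds_in_open) auto
    then show "\<forall>\<^sub>F w in nhds 0. ?\<Phi> w = 0" by eventually_elim (rule zero)
  qed simp
  then have "theta_coeff norm_nat (harmonic u) M 2 = 0"
    using fps_nth_fps_expansion [OF fps(1), of 2] by simp
  moreover have sh: "{x \<in> M. norm_nat x = 2} = shell M 2"
    unfolding shell_def using even_norm_nat(1) by (intro Collect_cong) auto
  moreover have fin: "finite (shell M 2)"
    using theta_summable_finite_shell [OF summ, of 2] by (simp add: shell_def)
  ultimately have "(\<Sum>x\<in>shell M 2. harmonic u x) = 0" by (simp add: theta_coeff_def)
  then have "complex_of_real (\<Sum>x\<in>shell M 2. (x \<bullet> u)\<^sup>2 - (u \<bullet> u) * (x \<bullet> x) / 24) = 0"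
    unfolding harmonic_def of_real_sum by simp
  then have "(\<Sum>x\<in>shell M 2. (x \<bullet> u)\<^sup>2 - (u \<bullet> u) * (x \<bullet> x) / 24) = 0" by (simp only: of_real_eq_0_iff)
  moreover have "(\<Sum>x\<in>shell M 2. (u \<bullet> u) * (x \<bullet> x) / 24) = (\<Sum>x\<in>shell M 2. (u \<bullet> u) / 12)"
    by (intro sum.cong) (auto simp: shell_def)
  ultimately show ?thesis by (simp add: sum_subtractf)
qed

end

section \<open>Jacobi theta functions\<close>

definition jacobi_char :: "int \<Rightarrow> complex" where "jacobi_char m = (if even m then 1 else - 1)"

abbreviation "theta2 \<equiv> theta (\<lambda>m::int. (1 / 2 + of_int m)\<^sup>2) (\<lambda>_. 1) UNIV"
abbreviation "theta3 \<equiv> theta (\<lambda>m::int. (of_int m)\<^sup>2) (\<lambda>_. 1) UNIV"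
abbreviation "theta4 \<equiv> theta (\<lambda>m::int. (of_int m)\<^sup>2) jacobi_char UNIV"

lemma jacobi_char_exp: "exp (pi * \<i> * of_int m) = jacobi_char m"
proof (cases "even m")
  case True
  then obtain k where "m = 2 * k" by (rule evenE)
  then have "exp (pi * \<i> * of_int m) = exp (2 * pi * \<i> * of_real (of_int k))" by (simp add: mult_ac)
  also have "\<dots> = 1" by (rule exp_2pi_i_Ints) simp
  finally show ?thesis using True by (simp add: jacobi_char_def)
next
  case False
  then obtain k where k: "m = 2 * k + 1" by (rule oddE)
  then have "exp (pi * \<i> * of_int m) = exp (2 * pi * \<i> * of_real (of_int k + 1 / 2))" by (simp add: algebra_simps)
  also have "\<dots> = - 1" by (rule exp_2pi_i_half) simp
  finally show ?thesis using False by (simp add: jacobi_char_def)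
qed

lemma theta_summable_int:
  assumes "\<And>m. norm (c m) \<le> 1"
  shows "theta_summable (\<lambda>m::int. (x + of_int m)\<^sup>2) c UNIV"
  unfolding theta_summable_def
proof (intro allI impI)
  fix r :: real assume "r > 0"
  then show "(\<lambda>m. norm (c m) * exp (- pi * r * (x + of_int m)\<^sup>2)) summable_on UNIV"
    by (intro summable_on_comparison_test [OF summable_on_gaussian_int [of r x]]) (auto simp: assms mult_left_le_one_le)
qed

lemma theta_summable_jacobi:
  "theta_summable (\<lambda>m::int. (1 / 2 + of_int m)\<^sup>2) (\<lambda>_. 1) UNIV"
  "theta_summable (\<lambda>m::int. (of_int m)\<^sup>2) (\<lambda>_. 1) UNIV"
  "theta_summable (\<lambda>m::int. (of_int m)\<^sup>2) jacobi_char UNIV"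
  using theta_summable_int [of "\<lambda>_. 1" "1 / 2"] theta_summable_int [of "\<lambda>_. 1" 0] theta_summable_int [of jacobi_char 0]
  by (simp_all add: jacobi_char_def)

lemma theta3_axis: assumes t: "t > 0" shows "theta3 (\<i> * of_real (1 / t)) = of_real (sqrt t) * theta3 (\<i> * of_real t)"
proof -
  have "theta3 (\<i> * of_real (1 / t)) = (\<Sum>\<^sub>\<infinity>m::int. exp (of_real (- pi * (1 / t) * (0 + of_int m)\<^sup>2) + 2 * pi * \<i> * (0::real) * of_int m))"
    unfolding theta_imaginary_axis by (simp only: exp_of_real add_0 add_0_right of_real_0 mult_zero_left mult_zero_right mult_1)
  also have "\<dots> = of_real (1 / sqrt (1 / t)) * (\<Sum>\<^sub>\<infinity>k::int. exp (of_real (- pi * (of_int k - 0)\<^sup>2 / (1 / t)) + 2 * pi * \<i> * (0::real) * (of_int k - (0::real))))"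
    using t by (intro poisson_gaussian_int) simp
  also have "\<dots> = of_real (sqrt t) * theta3 (\<i> * of_real t)"
  proof -
    have "exp (of_real (- pi * (of_int k - 0)\<^sup>2 / (1 / t)) + 2 * pi * \<i> * (0::real) * (of_int k - (0::real))) = 1 * complex_of_real (exp (- pi * t * (of_int k)\<^sup>2))" for k :: int
      unfolding exp_of_real [symmetric] mult_1 by (intro arg_cong [where f = exp]) simp
    moreover have "1 / sqrt (1 / t) = sqrt t" by (simp add: real_sqrt_divide)
    ultimately show ?thesis unfolding theta_imaginary_axis by (simp only:)
  qed
  finally show ?thesis .
qed

text \<open>The shift by 1/2 becomes the alternating character on the dual side.\<close>

lemma theta2_axis: assumes t: "t > 0" shows "theta2 (\<i> * of_real (1 / t)) = of_real (sqrt t) * theta4 (\<i> * of_real t)"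
proof -
  have "theta2 (\<i> * of_real (1 / t)) = (\<Sum>\<^sub>\<infinity>m::int. exp (of_real (- pi * (1 / t) * (1 / 2 + of_int m)\<^sup>2) + 2 * pi * \<i> * (0::real) * of_int m))"
    unfolding theta_imaginary_axis by (simp only: exp_of_real add_0_right of_real_0 mult_zero_left mult_zero_right mult_1)
  also have "\<dots> = of_real (1 / sqrt (1 / t)) * (\<Sum>\<^sub>\<infinity>k::int. exp (of_real (- pi * (of_int k - 0)\<^sup>2 / (1 / t)) + 2 * pi * \<i> * (1 / 2 :: real) * (of_int k - (0::real))))"
    using t by (intro poisson_gaussian_int) simp
  also have "\<dots> = of_real (sqrt t) * theta4 (\<i> * of_real t)"
  proof -
    have "exp (of_real (- pi * (of_int k - 0)\<^sup>2 / (1 / t)) + 2 * pi * \<i> * (1 / 2 :: real) * (of_int k - (0::real))) = jacobi_char k * complex_of_real (exp (- pi * t * (of_int k)\<^sup>2))" for k :: int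
    proof -
      have "complex_of_real (- pi * (of_int k - 0)\<^sup>2 / (1 / t)) + 2 * pi * \<i> * (1 / 2 :: real) * (of_int k - (0::real)) = pi * \<i> * of_int k + of_real (- pi * t * (of_int k)\<^sup>2)"
        by (simp add: mult_ac)
      then show ?thesis by (simp only: exp_add jacobi_char_exp exp_of_real)
    qed
    moreover have "1 / sqrt (1 / t) = sqrt t" by (simp add: real_sqrt_divide)
    ultimately show ?thesis unfolding theta_imaginary_axis by (simp only:)
  qed
  finally show ?thesis .
qed

text \<open>The reason for fourth powers below: they turn the factor \<open>sqrt t\<close> into a
  power of \<open>\<tau>\<close>, of weight 2, with a minus sign.\<close>

lemma i_times_square: "- 1 * (\<i> * of_real t)\<^sup>2 = of_real (sqrt t) ^ 4" if "t > 0"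
proof -
  have "complex_of_real (sqrt t) ^ 4 = of_real ((sqrt t ^ 2) ^ 2)" by (simp flip: power_mult)
  also have "\<dots> = of_real (t\<^sup>2)" using that by simp
  finally show ?thesis by (simp add: power_mult_distrib)
qed

lemma theta3_inversion:
  assumes \<tau>: "Im \<tau> > 0" shows "theta3 (- 1 / \<tau>) ^ 4 = - (\<tau>\<^sup>2) * theta3 \<tau> ^ 4"
proof -
  have h: "(\<lambda>\<tau>. theta3 \<tau> ^ 4) holomorphic_on {\<tau>. Im \<tau> > 0}"
    by (intro holomorphic_on_power theta_holomorphic theta_summable_jacobi) simp
  have "(\<lambda>\<tau>. theta3 \<tau> ^ 4) (- 1 / \<tau>) = - 1 * \<tau> ^ 2 * (\<lambda>\<tau>. theta3 \<tau> ^ 4) \<tau>"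
    by (rule theta_inversion_continuation [OF h h _ \<tau>]) (simp only: theta3_axis power_mult_distrib [of "of_real (sqrt _)"] i_times_square)
  then show ?thesis by simp
qed

lemma theta2_inversion:
  assumes \<tau>: "Im \<tau> > 0" shows "theta2 (- 1 / \<tau>) ^ 4 = - (\<tau>\<^sup>2) * theta4 \<tau> ^ 4"
proof -
  have h: "(\<lambda>\<tau>. theta2 \<tau> ^ 4) holomorphic_on {\<tau>. Im \<tau> > 0}" "(\<lambda>\<tau>. theta4 \<tau> ^ 4) holomorphic_on {\<tau>. Im \<tau> > 0}"
    by (intro holomorphic_on_power theta_holomorphic theta_summable_jacobi; simp)+
  have "(\<lambda>\<tau>. theta2 \<tau> ^ 4) (- 1 / \<tau>) = - 1 * \<tau> ^ 2 * (\<lambda>\<tau>. theta4 \<tau> ^ 4) \<tau>"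
    by (rule theta_inversion_continuation [OF h(2,1) _ \<tau>]) (simp only: theta2_axis power_mult_distrib [of "of_real (sqrt _)"] i_times_square)
  then show ?thesis by simp
qed

lemma theta4_inversion:
  assumes \<tau>: "Im \<tau> > 0" shows "theta4 (- 1 / \<tau>) ^ 4 = - (\<tau>\<^sup>2) * theta2 \<tau> ^ 4"
proof -
  have "\<tau> \<noteq> 0" using \<tau> by auto
  then have "- 1 / (- 1 / \<tau>) = \<tau>" by simp
  then have "theta2 \<tau> ^ 4 = - ((- 1 / \<tau>)\<^sup>2) * theta4 (- 1 / \<tau>) ^ 4"
    using theta2_inversion [OF Im_inversion_pos [OF \<tau>]] by (simp only:)
  then have "- (\<tau>\<^sup>2) * theta2 \<tau> ^ 4 = (\<tau>\<^sup>2 * (- 1 / \<tau>)\<^sup>2) * theta4 (- 1 / \<tau>) ^ 4" by simp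
  also have "\<tau>\<^sup>2 * (- 1 / \<tau>)\<^sup>2 = 1" using \<open>\<tau> \<noteq> 0\<close> by (simp add: power_divide)
  finally show ?thesis by simp
qed

section \<open>Power series of the Jacobi theta constants\<close>

definition "sq_nat m = nat ((m::int)\<^sup>2)"
text \<open>The exponent in \<open>theta2\<close> minus 1/4. The four missing quarters make up the
  factor \<open>w\<close> in front of \<open>series2 w ^ 4\<close>, so that all series have integral
  exponents.\<close>

definition "pronic_nat m = nat ((m::int) * m + m)"

abbreviation "series2 \<equiv> theta_series pronic_nat (\<lambda>_. 1) UNIV"
abbreviation "series3 \<equiv> theta_series sq_nat (\<lambda>_. 1) UNIV"
abbreviation "series4 \<equiv> theta_series sq_nat jacobi_char UNIV"

lemma real_sq_nat: "(of_int m)\<^sup>2 = real (sq_nat m)"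
  by (simp add: sq_nat_def)

lemma pronic_nonneg: "(m::int) * m + m \<ge> 0"
proof -
  have "m * (m + 1) \<ge> 0" by (cases "m \<ge> 0") (auto simp: mult_nonneg_nonneg intro!: mult_nonpos_nonpos)
  then show ?thesis by (simp add: distrib_left)
qed

lemma real_pronic_nat: "(of_int m)\<^sup>2 + of_int m = real (pronic_nat m)"
proof -
  have "real (pronic_nat m) = of_int (m * m + m)"
    unfolding pronic_nat_def using pronic_nonneg [of m] by (simp only: of_nat_nat)
  then show ?thesis by (simp add: power2_eq_square)
qed

lemma theta_summable_pronic: "theta_summable (\<lambda>m::int. (of_int m)\<^sup>2 + of_int m) (\<lambda>_. 1) UNIV"
  unfolding theta_summable_def
proof (intro allI impI)
  fix r :: real assume r: "r > 0"
  have "(\<lambda>m::int. exp (pi * r / 4) * (norm (1::complex) * exp (- pi * r * (1 / 2 + of_int m)\<^sup>2))) summable_on UNIV"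
    by (intro summable_on_cmult_right theta_summableD [OF theta_summable_jacobi(1) r])
  moreover have "exp (pi * r / 4) * (norm (1::complex) * exp (- pi * r * (1 / 2 + of_int m)\<^sup>2)) = norm (1::complex) * exp (- pi * r * ((of_int m)\<^sup>2 + of_int m))" for m :: int
  proof -
    have "pi * r / 4 + - pi * r * (1 / 2 + of_int m)\<^sup>2 = - pi * r * ((of_int m)\<^sup>2 + of_int m)"
      by (simp add: power2_eq_square field_simps)
    then show ?thesis by (simp only: exp_add [symmetric] norm_one mult_1)
  qed
  ultimately show "(\<lambda>m::int. norm (1::complex) * exp (- pi * r * ((of_int m)\<^sup>2 + of_int m))) summable_on UNIV"
    by (simp only:)
qed

lemma series_exp:
  "series3 (exp (pi * \<i> * \<tau>)) = theta3 \<tau>" "series4 (exp (pi * \<i> * \<tau>)) = theta4 \<tau>"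
  "exp (pi * \<i> * \<tau>) * series2 (exp (pi * \<i> * \<tau>)) ^ 4 = theta2 \<tau> ^ 4"
proof -
  show "series3 (exp (pi * \<i> * \<tau>)) = theta3 \<tau>" "series4 (exp (pi * \<i> * \<tau>)) = theta4 \<tau>"
    by (rule theta_series_exp, rule real_sq_nat)+
  have "theta2 \<tau> = exp (pi * \<i> * \<tau> / 4) * theta (\<lambda>m::int. (of_int m)\<^sup>2 + of_int m) (\<lambda>_. 1) UNIV \<tau>"
    unfolding theta_def infsum_cmult_right' [symmetric]
  proof (rule infsum_cong)
    fix m :: int
    have "pi * \<i> * \<tau> * of_real ((1 / 2 + of_int m)\<^sup>2) = pi * \<i> * \<tau> / 4 + pi * \<i> * \<tau> * of_real ((of_int m)\<^sup>2 + of_int m)"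
      by (simp add: power2_eq_square field_simps)
    then show "1 * exp (pi * \<i> * \<tau> * of_real ((1 / 2 + of_int m)\<^sup>2)) = exp (pi * \<i> * \<tau> / 4) * (1 * exp (pi * \<i> * \<tau> * of_real ((of_int m)\<^sup>2 + of_int m)))"
      by (simp only: exp_add mult_1)
  qed
  moreover have "series2 (exp (pi * \<i> * \<tau>)) = theta (\<lambda>m::int. (of_int m)\<^sup>2 + of_int m) (\<lambda>_. 1) UNIV \<tau>"
    by (rule theta_series_exp, rule real_pronic_nat)
  moreover have "exp (pi * \<i> * \<tau> / 4) ^ 4 = exp (pi * \<i> * \<tau>)" by (simp add: exp_of_nat_mult [symmetric])
  ultimately show "exp (pi * \<i> * \<tau>) * series2 (exp (pi * \<i> * \<tau>)) ^ 4 = theta2 \<tau> ^ 4"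
    by (simp only: power_mult_distrib)
qed

lemma series_fps:
  "series2 has_fps_expansion Abs_fps (theta_coeff pronic_nat (\<lambda>_. 1) UNIV)" "series2 holomorphic_on ball 0 1"
  "series3 has_fps_expansion Abs_fps (theta_coeff sq_nat (\<lambda>_. 1) UNIV)" "series3 holomorphic_on ball 0 1"
  "series4 has_fps_expansion Abs_fps (theta_coeff sq_nat jacobi_char UNIV)" "series4 holomorphic_on ball 0 1"
  by (rule theta_series_fps [OF theta_summable_pronic real_pronic_nat] theta_series_fps [OF theta_summable_jacobi(2) real_sq_nat]
      theta_series_fps [OF theta_summable_jacobi(3) real_sq_nat])+

lemma even_pronic_nat: "even (pronic_nat m)"
  unfolding pronic_nat_def using pronic_nonneg [of m] by (simp add: even_nat_iff)

text \<open>The sign change of \<open>w\<close> is the translation of \<open>\<tau>\<close> by 1. A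
  square has the parity of its root, and \<open>m * m + m\<close> is even.\<close>

lemma series_minus: "series2 (- w) = series2 w" "series3 (- w) = series4 w" "series4 (- w) = series3 w"
proof -
  show "series2 (- w) = series2 w"
    unfolding theta_series_def by (simp add: even_pronic_nat power_minus_even)
  have *: "(- w) ^ sq_nat m = jacobi_char m * w ^ sq_nat m" for m
  proof -
    have "even (sq_nat m) \<longleftrightarrow> even m" unfolding sq_nat_def by (simp add: even_nat_iff)
    then show ?thesis by (cases "even m") (auto simp: jacobi_char_def power_minus_even power_minus_odd)
  qed
  have j: "jacobi_char m * jacobi_char m = 1" for m by (simp add: jacobi_char_def)
  show "series3 (- w) = series4 w" unfolding theta_series_def * by simp
  show "series4 (- w) = series3 w" unfolding theta_series_def * mult.assoc [symmetric] j by simp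
qed

lemma sq_nat_sets: "{m \<in> UNIV. sq_nat m = 0} = {0}" "{m \<in> UNIV. sq_nat m = 1} = {1, - 1}" "{m \<in> UNIV. sq_nat m = 2} = {}"
  "{m \<in> UNIV. pronic_nat m = 0} = {0, - 1}" "{m \<in> UNIV. pronic_nat m = Suc 0} = {}"
proof -
  have b: "m = - 1 \<or> m = 0 \<or> m = 1" if "m\<^sup>2 \<le> 2" for m :: int
  proof (rule ccontr)
    assume "\<not> ?thesis"
    then have "2 \<le> \<bar>m\<bar>" by linarith
    then have "2\<^sup>2 \<le> \<bar>m\<bar>\<^sup>2" by (intro power_mono) auto
    then show False using that by simp
  qed
  show "{m \<in> UNIV. sq_nat m = 0} = {0}" by (auto simp: sq_nat_def)
  have sq: "m\<^sup>2 = int k" if "sq_nat m = k" for m k using that by (auto simp: sq_nat_def)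
  show "{m \<in> UNIV. sq_nat m = 1} = {1, - 1}"
  proof (intro equalityI subsetI)
    fix m assume "m \<in> {m \<in> UNIV. sq_nat m = 1}"
    then have "m\<^sup>2 = 1" using sq [of m 1] by simp
    then show "m \<in> {1, - 1}" by (simp add: power2_eq_1_iff)
  qed (auto simp: sq_nat_def)
  show "{m \<in> UNIV. sq_nat m = 2} = {}"
  proof -
    have False if "sq_nat m = 2" for m
    proof -
      have "m\<^sup>2 = 2" using sq [OF that] by simp
      with b [of m] show False by auto
    qed
    then show ?thesis by blast
  qed
  show "{m \<in> UNIV. pronic_nat m = 0} = {0, - 1}"
  proof (intro equalityI subsetI)
    fix m assume "m \<in> {m \<in> UNIV. pronic_nat m = 0}"
    then have "m * (m + 1) = 0" using pronic_nonneg [of m] by (simp add: pronic_nat_def distrib_left)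
    then show "m \<in> {0, - 1}" by auto
  qed (auto simp: pronic_nat_def)
  show "{m \<in> UNIV. pronic_nat m = Suc 0} = {}" using even_pronic_nat odd_one by (metis (mono_tags, lifting) One_nat_def empty_Collect_eq)
qed

lemma jacobi_coeffs:
  "theta_coeff sq_nat (\<lambda>_. 1) UNIV 0 = 1" "theta_coeff sq_nat (\<lambda>_. 1) UNIV (Suc 0) = 2" "theta_coeff sq_nat (\<lambda>_. 1) UNIV 2 = 0"
  "theta_coeff sq_nat jacobi_char UNIV 0 = 1" "theta_coeff sq_nat jacobi_char UNIV (Suc 0) = - 2" "theta_coeff sq_nat jacobi_char UNIV 2 = 0"
  "theta_coeff pronic_nat (\<lambda>_. 1) UNIV 0 = 2" "theta_coeff pronic_nat (\<lambda>_. 1) UNIV (Suc 0) = 0"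
  unfolding theta_coeff_def sq_nat_sets sq_nat_sets(2) [unfolded One_nat_def] by (simp_all add: jacobi_char_def)

section \<open>Products and powers of power series up to degree 2\<close>

lemma fps_mult_nth_Suc_0:
  fixes f g :: "complex fps"
  shows "fps_nth (f * g) (Suc 0) = fps_nth f 0 * fps_nth g (Suc 0) + fps_nth f (Suc 0) * fps_nth g 0"
  by (simp add: fps_mult_nth)

lemma fps_mult_nth_2:
  fixes f g :: "complex fps"
  shows "fps_nth (f * g) 2 = fps_nth f 0 * fps_nth g 2 + fps_nth f (Suc 0) * fps_nth g (Suc 0) + fps_nth f 2 * fps_nth g 0"
  by (simp add: fps_mult_nth numeral_2_eq_2)

lemma fps_power_low_coeffs:
  fixes f :: "complex fps"
  assumes "fps_nth f 0 = 1"
  shows "fps_nth (f ^ n) 0 = 1 \<and> fps_nth (f ^ n) (Suc 0) = of_nat n * fps_nth f (Suc 0) \<and>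
    fps_nth (f ^ n) 2 = of_nat n * fps_nth f 2 + of_nat n * (of_nat n - 1) / 2 * (fps_nth f (Suc 0))\<^sup>2"
proof (induction n)
  case 0
  then show ?case by simp
next
  case (Suc n)
  show ?case unfolding power_Suc fps_mult_nth_0 fps_mult_nth_Suc_0 fps_mult_nth_2 using Suc assms
    by (simp add: field_simps power2_eq_square)
qed

section \<open>Counting shadow vectors of norm 2\<close>

lemma norm_nat_eq: "x \<bullet> x \<in> \<int> \<Longrightarrow> x \<bullet> x = real (norm_nat x)"
  by (auto simp: norm_nat_def elim!: Ints_cases)

context odd_selfdual
begin

lemma lattice_norm_nat: "x \<in> \<Lambda> \<Longrightarrow> x \<bullet> x = real (norm_nat x)"
  by (intro norm_nat_eq inner_Ints)

lemma shadow_norm_nat: assumes "v \<in> shadow \<Lambda>" shows "v \<bullet> v = real (norm_nat v)" "even (norm_nat v)"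
proof -
  obtain k where k: "v \<bullet> v / 2 = of_int k" using shadow_norm_even [OF assms] by (rule Ints_cases)
  then have vv: "v \<bullet> v = of_int (2 * k)" by simp
  show "v \<bullet> v = real (norm_nat v)" by (rule norm_nat_eq) (simp add: vv)
  have "k \<ge> 0" using k inner_ge_zero [of v] by (simp add: field_simps)
  then have "norm_nat v = 2 * nat k" unfolding norm_nat_def vv floor_of_int by simp
  then show "even (norm_nat v)" by simp
qed

text \<open>The factor that a term of the theta function of \<open>\<Lambda>\<close> acquires under
  \<open>\<tau> \<mapsto> \<tau> + 1\<close>.\<close>

definition sign :: "vec24 \<Rightarrow> complex" where "sign x = (- 1) ^ norm_nat x"

abbreviation "lattice_series \<equiv> theta_series norm_nat (\<lambda>_. 1) \<Lambda>"
abbreviation "signed_series \<equiv> theta_series norm_nat sign \<Lambda>"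
abbreviation "shadow_series \<equiv> theta_series norm_nat (\<lambda>_. 1) (shadow \<Lambda>)"

lemma theta_summable_sign: "theta_summable (\<lambda>x. x \<bullet> x) sign \<Lambda>"
  using theta_summable_lattice by (simp add: theta_summable_def sign_def norm_power)

lemma lattice_series_fps:
  "lattice_series has_fps_expansion Abs_fps (theta_coeff norm_nat (\<lambda>_. 1) \<Lambda>)" "lattice_series holomorphic_on ball 0 1"
  by (rule theta_series_fps [OF theta_summable_lattice], erule lattice_norm_nat)+

lemma signed_series_fps:
  "signed_series has_fps_expansion Abs_fps (theta_coeff norm_nat sign \<Lambda>)" "signed_series holomorphic_on ball 0 1"
  by (rule theta_series_fps [OF theta_summable_sign], erule lattice_norm_nat)+

lemma shadow_series_fps:
  "shadow_series has_fps_expansion Abs_fps (theta_coeff norm_nat (\<lambda>_. 1) (shadow \<Lambda>))" "shadow_series holomorphic_on ball 0 1"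
  by (rule theta_series_fps [OF theta_summable_shadow], erule shadow_norm_nat(1))+

lemma lattice_series_exp: "lattice_series (exp (pi * \<i> * \<tau>)) = theta_lattice \<tau>"
  by (rule theta_series_exp) (erule lattice_norm_nat)

lemma shadow_series_exp: "shadow_series (exp (pi * \<i> * \<tau>)) = theta_shadow \<tau>"
  by (rule theta_series_exp) (erule shadow_norm_nat(1))

lemma lattice_series_minus: "lattice_series (- w) = signed_series w" "signed_series (- w) = lattice_series w"
proof -
  have *: "(- w) ^ norm_nat x = sign x * w ^ norm_nat x" for x unfolding sign_def by (rule power_minus)
  have s: "sign x * sign x = 1" for x by (simp add: sign_def flip: power_add power2_eq_square power_mult)
  show "lattice_series (- w) = signed_series w" unfolding theta_series_def * by simp
  show "signed_series (- w) = lattice_series w" unfolding theta_series_def * mult.assoc [symmetric] s by simp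
qed

lemma signed_series_exp: "signed_series (exp (pi * \<i> * \<tau>)) = theta_lattice (\<tau> + 1)"
proof -
  have "exp (pi * \<i> * (\<tau> + 1)) = - exp (pi * \<i> * \<tau>)" by (simp add: ring_distribs exp_add)
  then have "theta_lattice (\<tau> + 1) = lattice_series (- exp (pi * \<i> * \<tau>))"
    unfolding lattice_series_exp [symmetric] by (simp only:)
  then show ?thesis by (simp only: lattice_series_minus)
qed

lemma shadow_series_minus: "shadow_series (- w) = shadow_series w"
  unfolding theta_series_def by (intro infsum_cong) (simp add: shadow_norm_nat(2) power_minus_even)

text \<open>The weight 2 factors are the theta function of \<open>D\<^sub>4\<close> and its conjugates; subtracting the powers
  of the Jacobi thetas, which are the theta functions of \<open>\<int>\<^sup>2\<^sup>4\<close> and of its shadow, removes the constant term.\<close>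

definition cusp_series :: "complex \<Rightarrow> complex" where
  "cusp_series w = (shadow_series w - (w * series2 w ^ 4) ^ 6) * (series3 w ^ 4 + series4 w ^ 4)
     - (signed_series w - series4 w ^ 24) * (series3 w ^ 4 + w * series2 w ^ 4)
     - (lattice_series w - series3 w ^ 24) * (series4 w ^ 4 - w * series2 w ^ 4)"

lemma zero_shell: "{x \<in> \<Lambda>. norm_nat x = 0} = {0}"
proof (intro equalityI subsetI)
  fix x assume "x \<in> {x \<in> \<Lambda>. norm_nat x = 0}"
  then show "x \<in> {0}" using lattice_norm_nat [of x] by simp
qed (simp add: zero_mem norm_nat_def)

lemma zero_shell_shadow: "{x \<in> shadow \<Lambda>. norm_nat x = 0} = {}"
proof -
  have False if "x \<in> shadow \<Lambda>" "norm_nat x = 0" for x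
  proof -
    have "x = 0" using shadow_norm_nat(1) [OF that(1)] that(2) by simp
    then show False using that(1) zero_mem by (simp add: shadow_def)
  qed
  then show ?thesis by blast
qed

text \<open>The absence of norm 1 clears degree 1 for the lattice, evenness of the norms clears it
  for the shadow, and \<open>sign\<close> is 1 on vectors of norm 2.\<close>

lemma low_coeffs:
  assumes no1: "\<And>x. x \<in> \<Lambda> \<Longrightarrow> x \<bullet> x \<noteq> 1"
  shows "theta_coeff norm_nat (\<lambda>_. 1) \<Lambda> 0 = 1" "theta_coeff norm_nat (\<lambda>_. 1) \<Lambda> (Suc 0) = 0"
    "theta_coeff norm_nat (\<lambda>_. 1) \<Lambda> 2 = of_nat (card (shell \<Lambda> 2))"
    "theta_coeff norm_nat sign \<Lambda> 0 = 1" "theta_coeff norm_nat sign \<Lambda> (Suc 0) = 0"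
    "theta_coeff norm_nat sign \<Lambda> 2 = of_nat (card (shell \<Lambda> 2))"
    "theta_coeff norm_nat (\<lambda>_. 1) (shadow \<Lambda>) 0 = 0" "theta_coeff norm_nat (\<lambda>_. 1) (shadow \<Lambda>) (Suc 0) = 0"
    "theta_coeff norm_nat (\<lambda>_. 1) (shadow \<Lambda>) 2 = of_nat (card (shell (shadow \<Lambda>) 2))"
proof -
  have L1: "{x \<in> \<Lambda>. norm_nat x = Suc 0} = {}"
    using no1 lattice_norm_nat by fastforce
  have L2: "{x \<in> \<Lambda>. norm_nat x = 2} = shell \<Lambda> 2"
    unfolding shell_def using lattice_norm_nat by (intro Collect_cong) auto
  have S1: "{x \<in> shadow \<Lambda>. norm_nat x = Suc 0} = {}"
    using shadow_norm_nat(2) by fastforce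
  have S2: "{x \<in> shadow \<Lambda>. norm_nat x = 2} = shell (shadow \<Lambda>) 2"
    unfolding shell_def using shadow_norm_nat(1) by (intro Collect_cong) auto
  have fin: "finite (shell \<Lambda> 2)" "finite (shell (shadow \<Lambda>) 2)"
    using theta_summable_finite_shell [OF theta_summable_lattice, of 2] theta_summable_finite_shell [OF theta_summable_shadow, of 2]
    by (simp_all add: shell_def)
  have sg: "(\<Sum>x\<in>shell \<Lambda> 2. sign x) = of_nat (card (shell \<Lambda> 2))"
  proof -
    have "(\<Sum>x\<in>shell \<Lambda> 2. sign x) = (\<Sum>x\<in>shell \<Lambda> 2. 1)"
      by (intro sum.cong refl) (simp add: L2 [symmetric] sign_def)
    then show ?thesis by simp
  qed
  show "theta_coeff norm_nat (\<lambda>_. 1) \<Lambda> 0 = 1" "theta_coeff norm_nat (\<lambda>_. 1) \<Lambda> (Suc 0) = 0"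
    "theta_coeff norm_nat (\<lambda>_. 1) \<Lambda> 2 = of_nat (card (shell \<Lambda> 2))"
    "theta_coeff norm_nat sign \<Lambda> 0 = 1" "theta_coeff norm_nat sign \<Lambda> (Suc 0) = 0"
    "theta_coeff norm_nat sign \<Lambda> 2 = of_nat (card (shell \<Lambda> 2))"
    "theta_coeff norm_nat (\<lambda>_. 1) (shadow \<Lambda>) 0 = 0" "theta_coeff norm_nat (\<lambda>_. 1) (shadow \<Lambda>) (Suc 0) = 0"
    "theta_coeff norm_nat (\<lambda>_. 1) (shadow \<Lambda>) 2 = of_nat (card (shell (shadow \<Lambda>) 2))"
    unfolding theta_coeff_def zero_shell zero_shell_shadow L1 L2 S1 S2
    using fin sg by (simp_all add: sign_def norm_nat_def)
qed

text \<open>Inversion exchanges the first two products of \<open>cusp_series\<close> and preserves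
  the third; the sign change of \<open>w\<close> exchanges the last two and preserves the first. The
  signs between the products are chosen so that the minus sign in the inversion of the weight 2
  factors is compensated.\<close>

lemma cusp_series_eq_0:
  assumes "w \<in> ball 0 1" shows "cusp_series w = 0"
proof (rule weight14_cusp_form_eq_0 [OF _ _ _ _ assms])
  show "cusp_series holomorphic_on ball 0 1"
    unfolding cusp_series_def [abs_def]
    by (intro holomorphic_intros shadow_series_fps signed_series_fps lattice_series_fps series_fps)
  have at0: "theta_series n c X 0 = theta_coeff n c X 0" for n :: "'b \<Rightarrow> nat" and c X
  proof -
    have "theta_series n c X 0 = infsum c {x \<in> X. n x = 0}"
      unfolding theta_series_def by (rule infsum_cong_neutral) (auto simp: zero_power)
    then show ?thesis by (simp add: theta_coeff_def)
  qed
  show "cusp_series 0 = 0"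
    unfolding cusp_series_def at0 jacobi_coeffs unfolding theta_coeff_def zero_shell zero_shell_shadow
    by (simp add: sign_def norm_nat_def)
  show "cusp_series (- w) = cusp_series w" for w
    unfolding cusp_series_def series_minus lattice_series_minus shadow_series_minus by (simp add: algebra_simps)
  show "cusp_series (exp (pi * \<i> * (- 1 / \<tau>))) = \<tau> ^ 14 * cusp_series (exp (pi * \<i> * \<tau>))" if \<tau>: "Im \<tau> > 0" for \<tau>
  proof -
    have expand: "cusp_series (exp (pi * \<i> * \<sigma>)) = (theta_shadow \<sigma> - (theta2 \<sigma> ^ 4) ^ 6) * (theta3 \<sigma> ^ 4 + theta4 \<sigma> ^ 4)
     - (theta_lattice (\<sigma> + 1) - (theta4 \<sigma> ^ 4) ^ 6) * (theta3 \<sigma> ^ 4 + theta2 \<sigma> ^ 4)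
     - (theta_lattice \<sigma> - (theta3 \<sigma> ^ 4) ^ 6) * (theta4 \<sigma> ^ 4 - theta2 \<sigma> ^ 4)" for \<sigma>
      unfolding cusp_series_def series_exp lattice_series_exp signed_series_exp shadow_series_exp by (simp flip: power_mult)
    have "\<tau> \<noteq> 0" using \<tau> by auto
    then have "- 1 / (- 1 / \<tau>) = \<tau>" by simp
    then have "theta_shadow \<tau> = (- 1 / \<tau>) ^ 12 * theta_lattice (- 1 / \<tau> + 1)"
      using theta_shadow_inversion [OF Im_inversion_pos [OF \<tau>]] by (simp only:)
    then have "\<tau> ^ 12 * theta_shadow \<tau> = (\<tau> * (- 1 / \<tau>)) ^ 12 * theta_lattice (- 1 / \<tau> + 1)"
      by (simp only: power_mult_distrib mult.assoc)
    also have "\<tau> * (- 1 / \<tau>) = - 1" using \<open>\<tau> \<noteq> 0\<close> by simp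
    finally have signed: "theta_lattice (- 1 / \<tau> + 1) = \<tau> ^ 12 * theta_shadow \<tau>" by simp
    define a b c s p m where "a = theta3 \<tau> ^ 4" and "b = theta4 \<tau> ^ 4" and "c = theta2 \<tau> ^ 4"
      and "s = theta_shadow \<tau>" and "p = theta_lattice \<tau>" and "m = theta_lattice (\<tau> + 1)"
    have pw: "(- (\<tau>\<^sup>2) * z) ^ 6 = \<tau> ^ 12 * z ^ 6" for z :: complex
      by (simp add: power_mult_distrib flip: power_mult)
    have t14: "\<tau> ^ 14 = \<tau> ^ 12 * \<tau>\<^sup>2" by (simp flip: power_add)
    have "(\<tau> ^ 12 * m - (- (\<tau>\<^sup>2) * b) ^ 6) * (- (\<tau>\<^sup>2) * a + - (\<tau>\<^sup>2) * c)
       - (\<tau> ^ 12 * s - (- (\<tau>\<^sup>2) * c) ^ 6) * (- (\<tau>\<^sup>2) * a + - (\<tau>\<^sup>2) * b)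
       - (\<tau> ^ 12 * p - (- (\<tau>\<^sup>2) * a) ^ 6) * (- (\<tau>\<^sup>2) * c - - (\<tau>\<^sup>2) * b)
     = \<tau> ^ 14 * ((s - c ^ 6) * (a + b) - (m - b ^ 6) * (a + c) - (p - a ^ 6) * (b - c))"
      unfolding pw t14 by (simp add: algebra_simps)
    then show ?thesis
      unfolding expand theta_shadow_inversion [OF \<tau>] theta_lattice_inversion [OF \<tau>] signed
        theta2_inversion [OF \<tau>] theta3_inversion [OF \<tau>] theta4_inversion [OF \<tau>]
        a_def b_def c_def s_def p_def m_def .
  qed
qed

theorem card_shadow_shell:
  assumes no1: "\<And>x. x \<in> \<Lambda> \<Longrightarrow> x \<bullet> x \<noteq> 1"
  shows "card (shell (shadow \<Lambda>) 2) = card (shell \<Lambda> 2) + 48"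
proof -
  define F2 F3 F4 FL FM FS where "F2 = Abs_fps (theta_coeff pronic_nat (\<lambda>_. 1) UNIV)"
    and "F3 = Abs_fps (theta_coeff sq_nat (\<lambda>_. 1) UNIV)" and "F4 = Abs_fps (theta_coeff sq_nat jacobi_char UNIV)"
    and "FL = Abs_fps (theta_coeff norm_nat (\<lambda>_. 1) \<Lambda>)" and "FM = Abs_fps (theta_coeff norm_nat sign \<Lambda>)"
    and "FS = Abs_fps (theta_coeff norm_nat (\<lambda>_. 1) (shadow \<Lambda>))"
  have pow: "(\<lambda>w. f w ^ n) has_fps_expansion F ^ n" if "f has_fps_expansion F" for f :: "complex \<Rightarrow> complex" and F n
    by (induction n) (auto intro: has_fps_expansion_mult that)
  define P where "P = (FS - (fps_X * F2 ^ 4) ^ 6) * (F3 ^ 4 + F4 ^ 4) - (FM - F4 ^ 24) * (F3 ^ 4 + fps_X * F2 ^ 4)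
     - (FL - F3 ^ 24) * (F4 ^ 4 - fps_X * F2 ^ 4)"
  have "cusp_series has_fps_expansion P"
    unfolding cusp_series_def [abs_def] P_def F2_def F3_def F4_def FL_def FM_def FS_def
    by (intro has_fps_expansion_diff has_fps_expansion_mult has_fps_expansion_add pow has_fps_expansion_fps_X
        lattice_series_fps signed_series_fps shadow_series_fps series_fps)
  moreover have "(deriv ^^ 2) cusp_series 0 = (deriv ^^ 2) (\<lambda>_. 0) 0"
  proof (rule higher_deriv_cong_ev)
    have "eventually (\<lambda>w. w \<in> ball 0 1) (nhds (0::complex))" by (intro eventually_nhds_in_open) auto
    then show "\<forall>\<^sub>F w in nhds 0. cusp_series w = 0" by eventually_elim (rule cusp_series_eq_0)
  qed simp
  ultimately have P2: "fps_nth P 2 = 0" using fps_nth_fps_expansion [of cusp_series P 2] by simp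
  define Y where "Y = fps_X * F2 ^ 4"
  have F2: "fps_nth F2 0 = 2" "fps_nth F2 (Suc 0) = 0" by (simp_all add: F2_def jacobi_coeffs)
  have "fps_nth (F2 ^ 4) 0 = 16" "fps_nth (F2 ^ 4) (Suc 0) = 0"
    unfolding power4_eq_xxxx by (simp_all add: fps_mult_nth_Suc_0 F2)
  then have Y: "fps_nth Y 0 = 0" "fps_nth Y (Suc 0) = 16" "fps_nth Y 2 = 0"
    unfolding Y_def by (simp_all add: fps_mult_nth_Suc_0 fps_mult_nth_2)
  have Y6: "fps_nth (Y ^ 6) 0 = 0" "fps_nth (Y ^ 6) (Suc 0) = 0" "fps_nth (Y ^ 6) 2 = 0"
  proof -
    have "Y ^ 6 = (Y * (Y * Y)) * (Y * (Y * Y))" by (simp add: power_numeral_reduce mult_ac)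
    then show "fps_nth (Y ^ 6) 0 = 0" "fps_nth (Y ^ 6) (Suc 0) = 0" "fps_nth (Y ^ 6) 2 = 0"
      by (simp_all add: fps_mult_nth_Suc_0 fps_mult_nth_2 Y)
  qed
  have F3: "fps_nth F3 0 = 1" "fps_nth F3 (Suc 0) = 2" "fps_nth F3 2 = 0" by (simp_all add: F3_def jacobi_coeffs)
  have F4: "fps_nth F4 0 = 1" "fps_nth F4 (Suc 0) = - 2" "fps_nth F4 2 = 0" by (simp_all add: F4_def jacobi_coeffs)
  note p3 = fps_power_low_coeffs [OF F3(1)] and p4 = fps_power_low_coeffs [OF F4(1)]
  have FL: "fps_nth FL 0 = 1" "fps_nth FL (Suc 0) = 0" "fps_nth FL 2 = of_nat (card (shell \<Lambda> 2))"
    and FM: "fps_nth FM 0 = 1" "fps_nth FM (Suc 0) = 0" "fps_nth FM 2 = of_nat (card (shell \<Lambda> 2))"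
    and FS: "fps_nth FS 0 = 0" "fps_nth FS (Suc 0) = 0" "fps_nth FS 2 = of_nat (card (shell (shadow \<Lambda>) 2))"
    by (simp_all add: FL_def FM_def FS_def low_coeffs [OF no1])
  \<comment> \<open>\<open>F3 ^ 24\<close> begins with 1, 48, 1104 and \<open>F3 ^ 4 + Y\<close>
    with 1, 24; for \<open>F4 ^ 24\<close> and \<open>F4 ^ 4 - Y\<close> the coefficients of degree
    1 change sign. So each of the last two products has the coefficient
    \<open>card (shell \<Lambda> 2) - 1104 + 48 * 24\<close>, which exceeds the number of roots by
    48. The first product counts the shadow vectors twice, as \<open>F3 ^ 4 + F4 ^ 4\<close> begins
    with 2.\<close>
  have "fps_nth P 2 = 2 * of_nat (card (shell (shadow \<Lambda>) 2)) - 2 * of_nat (card (shell \<Lambda> 2)) - 96"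
    unfolding P_def Y_def [symmetric] fps_sub_nth fps_add_nth fps_mult_nth_2
    by (simp add: Y Y6 FL FM FS F3 F4 p3 p4 algebra_simps)
  with P2 have "of_nat (2 * card (shell (shadow \<Lambda>) 2)) = (of_nat (2 * card (shell \<Lambda> 2) + 96) :: complex)"
    by (simp add: algebra_simps)
  then have "2 * card (shell (shadow \<Lambda>) 2) = 2 * card (shell \<Lambda> 2) + 96" by (simp only: of_nat_eq_iff)
  then show ?thesis by simp
qed

section \<open>Root systems of the even neighbours\<close>

lemma even_poisson_neighbour:
  assumes "w \<in> shadow \<Lambda>" shows "even_poisson (neighbour w)"
  by unfold_locales (use assms theta_summable_neighbour neighbour_norm_even poisson_neighbour in blast)+

lemma root_system_neighbour:
  assumes w: "w \<in> shadow \<Lambda>" shows "root_system_norm2 (shell (neighbour w) 2)"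
  unfolding root_system_norm2_def
proof (intro conjI ballI)
  show "finite (shell (neighbour w) 2)"
    using theta_summable_finite_shell [OF theta_summable_neighbour [OF w], of 2] by (simp add: shell_def)
  fix r s assume rs: "r \<in> shell (neighbour w) 2" "s \<in> shell (neighbour w) 2"
  then have n: "r \<in> neighbour w" "s \<in> neighbour w" "r \<bullet> r = 2" "s \<bullet> s = 2" by (simp_all add: shell_def)
  show "r \<bullet> s \<in> \<int>" by (rule neighbour_inner_Ints [OF w n(1,2)])
  have "(s - (s \<bullet> r) *\<^sub>R r) \<bullet> (s - (s \<bullet> r) *\<^sub>R r) = 2"
    using n by (simp add: inner_diff_left inner_diff_right inner_commute)
  then show "s - (s \<bullet> r) *\<^sub>R r \<in> shell (neighbour w) 2"
    using neighbour_reflect [OF w n(1,2)] by (simp add: shell_def)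
qed (simp add: shell_def)

lemma eutactic_neighbour:
  assumes w: "w \<in> shadow \<Lambda>"
  shows "(\<Sum>s\<in>shell (neighbour w) 2. (s \<bullet> u)\<^sup>2) = real (card (shell (neighbour w) 2)) / 12 * (u \<bullet> u)"
  by (rule even_poisson.eutactic_shell [OF even_poisson_neighbour [OF w]])

lemma strongly_eutactic_neighbour:
  assumes w: "w \<in> shadow \<Lambda>" shows "strongly_eutactic (shell (neighbour w) 2)"
proof (rule eutactic_imp_strongly_eutactic [OF _ _ eutactic_neighbour [OF w]])
  show "finite (shell (neighbour w) 2)"
    using root_system_neighbour [OF w] by (simp add: root_system_norm2_def)
qed (simp add: shell_def)

end

section \<open>The two root systems\<close>

lemma root_system_norm2_Int:
  "root_system_norm2 S \<Longrightarrow> root_system_norm2 T \<Longrightarrow> root_system_norm2 (S \<inter> T)"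
  by (simp add: root_system_norm2_def)

text \<open>For \<open>s \<in> S - R\<close> the eutaxy of \<open>R\<close> and \<open>T\<close> gives \<open>4 (h\<^sub>T - h\<^sub>R)\<close> for the sum of \<open>(s \<bullet> t)\<^sup>2\<close> over
  \<open>T - R\<close>, whereas \<open>s \<bullet> t = \<plusminus>1/2\<close> gives \<open>24 (h\<^sub>T - h\<^sub>R) / 4\<close>.\<close>

lemma eutactic_pair_trivial:
  fixes R S T :: "vec24 set"
  assumes fin: "finite T" and RT: "R \<subseteq> T" and RS: "R \<subseteq> S" and S2: "\<And>s. s \<in> S \<Longrightarrow> s \<bullet> s = 2"
    and euR: "\<And>u. (\<Sum>r\<in>R. (r \<bullet> u)\<^sup>2) = real (card R) / 12 * (u \<bullet> u)"
    and euT: "\<And>u. (\<Sum>t\<in>T. (t \<bullet> u)\<^sup>2) = real (card T) / 12 * (u \<bullet> u)"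
    and half: "\<forall>s\<in>S - R. \<forall>t\<in>T - R. s \<bullet> t = 1/2 \<or> s \<bullet> t = -1/2"
  shows "T = R \<or> S = R"
proof (cases "S = R")
  case False
  then obtain s where s: "s \<in> S - R" using RS by blast
  have finR: "finite R" using RT fin by (rule finite_subset)
  have "(\<Sum>t\<in>T - R. (t \<bullet> s)\<^sup>2) = (\<Sum>t\<in>T - R. 1 / 4)"
  proof (rule sum.cong [OF refl])
    fix t assume "t \<in> T - R"
    with half s have "t \<bullet> s = 1/2 \<or> t \<bullet> s = -1/2" by (simp add: inner_commute)
    moreover have "(1 / 2 :: real)\<^sup>2 = 1 / 4" "(- 1 / 2 :: real)\<^sup>2 = 1 / 4" by (simp_all add: power2_eq_square)
    ultimately show "(t \<bullet> s)\<^sup>2 = 1 / 4" by metis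
  qed
  then have "(\<Sum>t\<in>T - R. (t \<bullet> s)\<^sup>2) = real (card (T - R)) / 4" by simp
  moreover have "(\<Sum>t\<in>T - R. (t \<bullet> s)\<^sup>2) = (\<Sum>t\<in>T. (t \<bullet> s)\<^sup>2) - (\<Sum>t\<in>R. (t \<bullet> s)\<^sup>2)"
    by (rule sum_diff [OF fin RT])
  moreover have "real (card (T - R)) = real (card T) - real (card R)"
    using card_Diff_subset [OF finR RT] card_mono [OF fin RT] by simp
  ultimately have "real (card T) = real (card R)" unfolding euR euT using S2 s by simp
  then have "T = R" using card_subset_eq [OF fin RT] by simp
  then show ?thesis ..
qed simp

theorem proposition13p1:
  fixes \<Lambda> :: "vec24 set"
  assumes "selfdual \<Lambda>" and "odd_lattice \<Lambda>" and "has_minimum \<Lambda> 2"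
  defines "R \<equiv> shell \<Lambda> 2"
  shows "\<exists>S T. root_system_norm2 S \<and> root_system_norm2 T \<and>
           strongly_eutactic S \<and> strongly_eutactic T \<and>
           R = S \<inter> T \<and>
           coxeter_number S + coxeter_number T = 3 * (real (card R) / 24) + 2 \<and>
           (\<forall>s\<in>S - R. \<forall>t\<in>T - R. s \<bullet> t = 1/2 \<or> s \<bullet> t = -1/2) \<and>
           shell (shadow \<Lambda>) 2 = (S - R) \<union> (T - R) \<and>
           ((T = R \<or> S = R) \<longleftrightarrow> strongly_eutactic R)"
proof -
  interpret odd_selfdual \<Lambda> using assms(1,2) by unfold_locales
  have min: "2 \<le> x \<bullet> x" if "x \<in> \<Lambda>" "x \<noteq> 0" for x
    using assms(3) that by (simp add: has_minimum_def)
  have no1: "x \<bullet> x \<noteq> 1" if "x \<in> \<Lambda>" for x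
    using min [OF that] by (cases "x = 0") auto
  have "R \<noteq> {}" using assms(3) by (auto simp: has_minimum_def R_def shell_def)
  obtain w where w: "w \<in> shadow \<Lambda>" by (rule shadow_nonempty)
  obtain z where z: "z \<in> \<Lambda>" "z \<notin> even_part \<Lambda>" by (rule odd_vector)
  \<comment> \<open>Since \<open>z\<close> is odd, \<open>w\<close> and \<open>w'\<close> represent
    the two cosets of the even part in the shadow, hence the two even neighbours.\<close>
  define w' where "w' = w + z"
  have w': "w' \<in> shadow \<Lambda>" unfolding w'_def by (rule shadow_add_mem [OF w z(1)])
  define S T where "S = shell (neighbour w) 2" and "T = shell (neighbour w') 2"
  have R_iff: "x \<in> R \<longleftrightarrow> x \<in> even_part \<Lambda> \<and> x \<bullet> x = 2" for x
    by (auto simp: R_def shell_def even_part_iff)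
  have S_iff: "x \<in> S \<longleftrightarrow> (x \<in> even_part \<Lambda> \<or> x - w \<in> even_part \<Lambda>) \<and> x \<bullet> x = 2" for x
    by (simp add: S_def shell_def neighbour_iff)
  have T_iff: "x \<in> T \<longleftrightarrow> (x \<in> even_part \<Lambda> \<or> x - w' \<in> even_part \<Lambda>) \<and> x \<bullet> x = 2" for x
    by (simp add: T_def shell_def neighbour_iff)
  have not_both: "\<not> (x - w \<in> even_part \<Lambda> \<and> x - w' \<in> even_part \<Lambda>)" for x
  proof
    assume "x - w \<in> even_part \<Lambda> \<and> x - w' \<in> even_part \<Lambda>"
    then have "(x - w) - (x - w') \<in> even_part \<Lambda>" by (elim conjE) (rule even_part_diff)
    then show False using z by (simp add: w'_def)
  qed
  have RST: "R = S \<inter> T" using not_both by (auto simp: R_iff S_iff T_iff)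
  have rS: "root_system_norm2 S" and rT: "root_system_norm2 T"
    unfolding S_def T_def by (rule root_system_neighbour w w')+
  have sS: "strongly_eutactic S" and sT: "strongly_eutactic T"
    unfolding S_def T_def by (rule strongly_eutactic_neighbour w w')+
  have fin: "finite S" "finite T" using rS rT by (simp_all add: root_system_norm2_def)
  have shadow_not_even: "v \<notin> even_part \<Lambda>" if "v \<in> shadow \<Lambda>" for v
    using that even_part_subset by (auto simp: shadow_def)
  have coset: "v \<in> shadow \<Lambda> \<longleftrightarrow> v - w \<in> even_part \<Lambda> \<or> v - w' \<in> even_part \<Lambda>" for v
  proof
    assume v: "v \<in> shadow \<Lambda>"
    show "v - w \<in> even_part \<Lambda> \<or> v - w' \<in> even_part \<Lambda>"
    proof (cases "v - w \<in> even_part \<Lambda>")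
      case False
      then have "(v - w) - z \<in> even_part \<Lambda>" using z shadow_diff [OF v w] by (intro odd_diff_even)
      then show ?thesis by (simp add: w'_def diff_diff_eq)
    qed simp
  next
    assume "v - w \<in> even_part \<Lambda> \<or> v - w' \<in> even_part \<Lambda>"
    then have "w + (v - w) \<in> shadow \<Lambda> \<or> w' + (v - w') \<in> shadow \<Lambda>"
      using shadow_add_mem [OF w] shadow_add_mem [OF w'] even_part_subset by blast
    then show "v \<in> shadow \<Lambda>" by simp
  qed
  have SR: "x \<in> S - R \<longleftrightarrow> x - w \<in> even_part \<Lambda> \<and> x \<bullet> x = 2" for x
    using coset [of x] shadow_not_even [of x] by (auto simp: S_iff R_iff)
  have TR: "x \<in> T - R \<longleftrightarrow> x - w' \<in> even_part \<Lambda> \<and> x \<bullet> x = 2" for x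
    using coset [of x] shadow_not_even [of x] by (auto simp: T_iff R_iff)
  have shell_eq: "shell (shadow \<Lambda>) 2 = (S - R) \<union> (T - R)"
  proof (rule set_eqI)
    show "x \<in> shell (shadow \<Lambda>) 2 \<longleftrightarrow> x \<in> (S - R) \<union> (T - R)" for x
      unfolding Un_iff SR TR shell_def mem_Collect_eq coset by blast
  qed
  have half: "\<forall>s\<in>S - R. \<forall>t\<in>T - R. s \<bullet> t = 1/2 \<or> s \<bullet> t = -1/2"
  proof (intro ballI)
    fix s t assume "s \<in> S - R" "t \<in> T - R"
    then have st: "s - w \<in> even_part \<Lambda>" "s \<bullet> s = 2" "t - w' \<in> even_part \<Lambda>" "t \<bullet> t = 2" by (simp_all only: SR TR)
    have in_shadow: "s \<in> shadow \<Lambda>" "t \<in> shadow \<Lambda>" using st by (simp_all add: coset)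
    have m: "s - t \<in> \<Lambda>" by (rule shadow_diff [OF in_shadow])
    have "- t \<in> shadow \<Lambda>"
    proof -
      have "- (2 *\<^sub>R t) \<in> \<Lambda>" using double_shadow_even [OF in_shadow(2)] by (intro uminus_mem even_part_subset)
      then have "t + - (2 *\<^sub>R t) \<in> shadow \<Lambda>" by (rule shadow_add_mem [OF in_shadow(2)])
      then show ?thesis by (simp add: scaleR_2)
    qed
    then have p: "s + t \<in> \<Lambda>" using shadow_diff [OF in_shadow(1), of "- t"] by simp
    have odd: "s - t \<notin> even_part \<Lambda>"
    proof
      assume "s - t \<in> even_part \<Lambda>"
      then have "(s - t) + (t - w') \<in> even_part \<Lambda>" using st(3) by (rule even_part_add)
      then show False using not_both [of s] st(1) by simp
    qed
    \<comment> \<open>The norm \<open>4 - 2 * (s \<bullet> t)\<close> of \<open>s - t\<close> is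
      odd, so \<open>s \<bullet> t\<close> is an integer plus 1/2. Both \<open>s - t\<close> and
      \<open>s + t\<close> are nonzero in \<open>\<Lambda>\<close>, so the minimum 2 confines
      \<open>s \<bullet> t\<close> to [-1, 1].\<close>
    have "(s - t) \<bullet> (s - t) / 2 = 2 - s \<bullet> t" using st by (simp add: inner_diff_left inner_diff_right inner_commute)
    with odd_half_Ints [OF m odd] have "2 - s \<bullet> t - 1 / 2 \<in> \<int>" by (simp only:)
    then obtain k where k: "2 - s \<bullet> t - 1 / 2 = of_int k" by (rule Ints_cases)
    have "s \<noteq> t" using st not_both [of s] by auto
    then have "2 \<le> (s - t) \<bullet> (s - t)" by (intro min m) simp
    then have "s \<bullet> t \<le> 1" using st by (simp add: inner_diff_left inner_diff_right inner_commute)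
    have "s \<noteq> - t"
    proof
      assume "s = - t"
      then have "s - t = - (2 *\<^sub>R t)" by (simp add: scaleR_2)
      then show False using odd even_part_uminus [OF double_shadow_even [OF in_shadow(2)]] by simp
    qed
    then have "s + t \<noteq> 0" by (simp add: eq_neg_iff_add_eq_0)
    then have "2 \<le> (s + t) \<bullet> (s + t)" by (rule min [OF p])
    then have "- 1 \<le> s \<bullet> t" using st by (simp add: inner_add_left inner_add_right inner_commute)
    have "real_of_int k \<ge> 1 / 2" "real_of_int k \<le> 5 / 2" using k \<open>s \<bullet> t \<le> 1\<close> \<open>- 1 \<le> s \<bullet> t\<close> by linarith+
    then have "k = 1 \<or> k = 2" by linarith
    then show "s \<bullet> t = 1/2 \<or> s \<bullet> t = -1/2" using k by auto
  qed
  have RS: "R \<subseteq> S" and RT: "R \<subseteq> T" using RST by auto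
  have finR: "finite R" using RS fin(1) by (rule finite_subset)
  have cox: "coxeter_number S + coxeter_number T = 3 * (real (card R) / 24) + 2"
  proof -
    have "(S - R) \<inter> (T - R) = {}" using RST by blast
    then have "card (shell (shadow \<Lambda>) 2) = card (S - R) + card (T - R)"
      unfolding shell_eq using fin by (intro card_Un_disjoint) auto
    moreover have "card S = card R + card (S - R)" "card T = card R + card (T - R)"
      using card_Diff_subset [OF finR RS] card_mono [OF fin(1) RS] card_Diff_subset [OF finR RT] card_mono [OF fin(2) RT] by simp_all
    ultimately have "card S + card T = 3 * card R + 48"
      using card_shadow_shell [OF no1] by (simp add: R_def)
    then have "real (card S) + real (card T) = 3 * real (card R) + 48" by linarith
    then show ?thesis by (simp add: coxeter_number_def field_simps)
  qed
  have "(T = R \<or> S = R) \<longleftrightarrow> strongly_eutactic R"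
  proof
    assume "T = R \<or> S = R"
    then show "strongly_eutactic R" using sS sT by auto
  next
    assume "strongly_eutactic R"
    moreover have "root_system_norm2 R" unfolding RST by (rule root_system_norm2_Int [OF rS rT])
    ultimately have euR: "(\<Sum>r\<in>R. (r \<bullet> u)\<^sup>2) = real (card R) / 12 * (u \<bullet> u)" for u
      using \<open>R \<noteq> {}\<close> by (intro strongly_eutactic_imp_eutactic)
    have euT: "(\<Sum>t\<in>T. (t \<bullet> u)\<^sup>2) = real (card T) / 12 * (u \<bullet> u)" for u
      unfolding T_def by (rule eutactic_neighbour [OF w'])
    show "T = R \<or> S = R"
      by (rule eutactic_pair_trivial [OF fin(2) RT RS _ euR euT half]) (simp add: S_def shell_def)
  qed
  then show ?thesis using rS rT sS sT RST cox half shell_eq by (intro exI [of _ S] exI [of _ T] conjI)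
qed

end
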